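(* Let $n\ge 1$. The simplicial complex $\Delta_{\mathcal{C}_n,2}$ is pure, with every facet having exactly $2(n-1)$ vertices; moreover, it is a weak pseudomanifold (without boundary).
   Context: **Half-cylinder and universal cover.** $\mathcal{C}_n$ is the annulus with $n$ marked points on one of its boundary components (and none on the other). Its universal cover $\overline{\mathcal{C}}_n$ has vertices $\alpha_i$, $i\in\mathbb{Z}$ (the lifts of the marked points, in order along the boundary line); the covering map $\pi$ sends $\alpha_i$ to the marked point indexed by $i \bmod n$. Write $\alpha_i+j=\alpha_{i+j}$, $\alpha_j-\alpha_i=j-i$, and $\alpha_i<\alpha_j$ iff $i<j$. An edge of $\overline{\mathcal{C}}_n$ is an isotopy class of curves joining two distinct vertices $u,v$; it is determined by the unordered pair and denoted $[u,v]=[v,u]$. Its length is $|v-u|$. Put $[u,v]+j=[u+j,v+j]$; a translation of $e$ is an edge $e+\ell n$ with $\ell\in\mathbb{Z}$. An edge of $\mathcal{C}_n$ is a projection $\pi(e)$, with $\pi(e)=\pi(f)$ iff $f$ is a translation of $e$; the length of $\pi(e)$ is the length of $e$. **Crossings.** Two edges of $\overline{\mathcal{C}}_n$ intersect iff they can be written $[a_1,b_1]$, $[a_2,b_2]$ with $a_1<a_2<b_1<b_2$. A $3$-crossing is a set of three pairwise intersecting edges. **$2$-triangulations.** A $2$-triangulation on $\mathcal{C}_n$ is an inclusion-maximal set $T$ of edges of $\mathcal{C}_n$ such that $\pi^{-1}(T)$ contains no $3$-crossing. Convention: edges of length $<2$ (which never occur in a $3$-crossing) are disregarded, i.e. only edges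 of length $\ge 2$ are considered. An edge is $2$-relevant if its length $\ell$ satisfies $2<\ell\le 2n$. **Complex.** $\Delta_{\mathcal{C}_n,2}$ is the simplicial complex whose vertices are the $2$-relevant edges of $\mathcal{C}_n$ and whose facets are the sets of $2$-relevant edges of the $2$-triangulations on $\mathcal{C}_n$. A weak pseudomanifold without boundary is a pure simplicial complex in which every codimension-$1$ face lies in exactly two facets. *)

theory Defs
  imports Main
begin

section \<open>Edges of the half-cylinder and of its universal cover\<close>

text \<open>
  The vertex \<open>\<alpha>\<^sub>i\<close> of the universal cover is represented by the integer \<open>i\<close>, and an edge
  \<open>[u,v]\<close> by the unordered pair of its two distinct end points.
\<close>

definition cover_edges :: "int set set" where
  "cover_edges = {{u, v} | u v. u \<noteq> v}"

definition edge_length :: "int set \<Rightarrow> int" where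
  "edge_length e = Max e - Min e"

definition shift :: "int \<Rightarrow> int set \<Rightarrow> int set" where
  "shift j e = (\<lambda>x. x + j) ` e"

text \<open>
  An edge of the half-cylinder with \<open>n\<close> marked points is identified with its fibre, that is,
  with the set of all translations of one of its lifts.
\<close>

definition proj :: "nat \<Rightarrow> int set \<Rightarrow> int set set" where
  "proj n e = {shift (l * int n) e | l. True}"

definition cyl_edges :: "nat \<Rightarrow> int set set set" where
  "cyl_edges n = proj n ` cover_edges"

definition cyl_length :: "int set set \<Rightarrow> int" where
  "cyl_length c = (THE l. \<forall>e\<in>c. edge_length e = l)"

definition preimage :: "nat \<Rightarrow> int set set set \<Rightarrow> int set set" where
  "preimage n T = {e \<in> cover_edges. proj n e \<in> T}"

definition relevant_edges :: "nat \<Rightarrow> int set set set" where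
  "relevant_edges n = {c \<in> cyl_edges n. 2 < cyl_length c \<and> cyl_length c \<le> 2 * int n}"


section \<open>Crossings and 2-triangulations\<close>

definition crosses :: "int set \<Rightarrow> int set \<Rightarrow> bool" where
  "crosses e f \<longleftrightarrow> (\<exists>a1 b1 a2 b2. a1 < a2 \<and> a2 < b1 \<and> b1 < b2 \<and>
     (e = {a1, b1} \<and> f = {a2, b2} \<or> f = {a1, b1} \<and> e = {a2, b2}))"

definition three_crossing :: "int set set \<Rightarrow> bool" where
  "three_crossing X \<longleftrightarrow> X \<subseteq> cover_edges \<and> card X = 3 \<and>
     (\<forall>e\<in>X. \<forall>f\<in>X. e \<noteq> f \<longrightarrow> crosses e f)"

text \<open>Edges of length less than 2 are disregarded.\<close>

definition three_crossing_free :: "nat \<Rightarrow> int set set set \<Rightarrow> bool" where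
  "three_crossing_free n T \<longleftrightarrow> T \<subseteq> {c \<in> cyl_edges n. 2 \<le> cyl_length c} \<and>
     \<not> (\<exists>X \<subseteq> preimage n T. three_crossing X)"

definition two_triangulation :: "nat \<Rightarrow> int set set set \<Rightarrow> bool" where
  "two_triangulation n T \<longleftrightarrow> three_crossing_free n T \<and>
     (\<forall>T'. three_crossing_free n T' \<and> T \<subseteq> T' \<longrightarrow> T' = T)"


section \<open>Simplicial complexes\<close>

definition simplicial_complex :: "'v set set \<Rightarrow> bool" where
  "simplicial_complex K \<longleftrightarrow> K \<noteq> {} \<and> (\<forall>s\<in>K. finite s \<and> (\<forall>t\<subseteq>s. t \<in> K))"

definition facets :: "'v set set \<Rightarrow> 'v set set" where
  "facets K = {F \<in> K. \<forall>G\<in>K. F \<subseteq> G \<longrightarrow> G = F}"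

definition pure_complex :: "'v set set \<Rightarrow> bool" where
  "pure_complex K \<longleftrightarrow> simplicial_complex K \<and> (\<forall>F\<in>facets K. \<forall>G\<in>facets K. card F = card G)"

definition codim1_face :: "'v set set \<Rightarrow> 'v set \<Rightarrow> bool" where
  "codim1_face K s \<longleftrightarrow> s \<in> K \<and> (\<exists>F\<in>facets K. s \<subseteq> F \<and> card F = card s + 1)"

definition weak_pseudomanifold :: "'v set set \<Rightarrow> bool" where
  "weak_pseudomanifold K \<longleftrightarrow> pure_complex K \<and>
     (\<forall>s. codim1_face K s \<longrightarrow> card {F \<in> facets K. s \<subseteq> F} = 2)"

text \<open>
  The complex is given by its set of faces. Lemmas \<open>facets_Delta\<close> and \<open>vertices_Delta\<close>
  below show that its facets and its vertices are the expected ones.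
\<close>

definition Delta :: "nat \<Rightarrow> int set set set set" where
  "Delta n = {s. \<exists>T. two_triangulation n T \<and> s \<subseteq> T \<inter> relevant_edges n}"


section \<open>Basic properties\<close>

lemma cover_edgeE:
  assumes "e \<in> cover_edges"
  obtains u v where "e = {u, v}" "u < v"
  using assms unfolding cover_edges_def by (auto, metis insert_commute linorder_neq_iff)

lemma cover_edgesI: "u \<noteq> v \<Longrightarrow> {u, v} \<in> cover_edges"
  unfolding cover_edges_def by blast

lemma edge_length_pair: "edge_length {u, v} = \<bar>v - u\<bar>"
  unfolding edge_length_def by (auto simp: max_def min_def)

lemma shift_pair [simp]: "shift j {u, v} = {u + j, v + j}"
  by (simp add: shift_def)

lemma shift_shift [simp]: "shift i (shift j e) = shift (i + j) e"
  by (auto simp: shift_def image_image add_ac)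

lemma shift_0 [simp]: "shift 0 e = e"
  by (simp add: shift_def)

lemma shift_cover_edges: "e \<in> cover_edges \<Longrightarrow> shift j e \<in> cover_edges"
  by (erule cover_edgeE) (auto intro: cover_edgesI)

lemma edge_length_shift: "e \<in> cover_edges \<Longrightarrow> edge_length (shift j e) = edge_length e"
  by (erule cover_edgeE) (simp add: edge_length_pair)

lemma shift_in_proj: "shift (l * int n) e \<in> proj n e"
  unfolding proj_def by blast

lemma self_in_proj: "e \<in> proj n e"
  using shift_in_proj[of 0 n e] by simp

lemma proj_shift: "proj n (shift (l * int n) e) = proj n e"
proof -
  have "shift (k * int n) e \<in> proj n (shift (l * int n) e)" for k
    using shift_in_proj[of "k - l" n "shift (l * int n) e"] by (simp add: algebra_simps)
  moreover have "shift (k * int n) (shift (l * int n) e) \<in> proj n e" for k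
    using shift_in_proj[of "k + l" n e] by (simp add: algebra_simps)
  ultimately show ?thesis
    unfolding proj_def[of n e] proj_def[of n "shift (l * int n) e"] by blast
qed

lemma proj_eq_iff: "proj n e = proj n f \<longleftrightarrow> (\<exists>l. f = shift (l * int n) e)"
proof
  assume "proj n e = proj n f"
  then have "f \<in> proj n e" using self_in_proj by blast
  then show "\<exists>l. f = shift (l * int n) e" unfolding proj_def by blast
qed (auto simp: proj_shift)

lemma cyl_length_proj: "e \<in> cover_edges \<Longrightarrow> cyl_length (proj n e) = edge_length e"
  unfolding cyl_length_def
  by (rule the_equality) (use self_in_proj in \<open>auto simp: proj_def edge_length_shift\<close>)

lemma three_crossingI:
  assumes "a < b" "b < c" "c < a'" "a' < b'" "b' < c'"
  shows "three_crossing {{a, a'}, {b, b'}, {c, c'}}"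
proof -
  have "crosses {a, a'} {b, b'}" "crosses {b, b'} {c, c'}" "crosses {a, a'} {c, c'}"
    using assms unfolding crosses_def by (metis order.strict_trans)+
  moreover have "crosses f e" if "crosses e f" for e f :: "int set"
    using that unfolding crosses_def by metis
  moreover have "card {{a, a'}, {b, b'}, {c, c'}} = 3"
    using assms by (auto simp: doubleton_eq_iff)
  ultimately show ?thesis
    unfolding three_crossing_def using assms
    by (auto intro!: cover_edgesI)
qed

lemma three_crossing_length:
  assumes X: "three_crossing X" and e: "e \<in> X"
  shows "edge_length e > 2"
proof (rule ccontr)
  assume "\<not> edge_length e > 2"
  have "finite X" using X by (metis three_crossing_def card.infinite zero_neq_numeral)
  then have "card (X - {e}) = 2" using X e by (simp add: three_crossing_def)
  then obtain f g where "X - {e} = {f, g}" "f \<noteq> g" by (auto simp: card_2_iff)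
  then have fg: "f \<in> X" "g \<in> X" "f \<noteq> e" "g \<noteq> e" "f \<noteq> g" by blast+
  obtain u v where e': "e = {u, v}" "u < v"
    using X e by (meson cover_edgeE subsetD three_crossing_def)
  have "v \<le> u + 2" using \<open>\<not> edge_length e > 2\<close> e' by (simp add: edge_length_pair)
  have *: "u + 1 \<in> h" if "crosses e h" for h
    using that \<open>v \<le> u + 2\<close> e' unfolding crosses_def
    by (smt (verit) doubleton_eq_iff insertCI)
  have "crosses e f" "crosses e g" "crosses f g"
    using X e fg unfolding three_crossing_def by simp_all
  then have "u + 1 \<in> f" "u + 1 \<in> g" "crosses f g" using * by blast+
  moreover have "f \<inter> g = {}" if "crosses f g"
    using that unfolding crosses_def by (elim exE conjE disjE) simp_all
  ultimately show False by blast
qed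

lemma three_crossing_free_length_le:
  assumes "n \<ge> 1" and T: "three_crossing_free n T" and c: "c \<in> T"
  shows "cyl_length c \<le> 2 * int n"
proof (rule ccontr)
  assume long: "\<not> cyl_length c \<le> 2 * int n"
  from T c obtain e where e: "e \<in> cover_edges" "c = proj n e"
    unfolding three_crossing_free_def cyl_edges_def by blast
  obtain u v where uv: "e = {u, v}" "u < v" using e(1) by (rule cover_edgeE)
  have "v > u + 2 * int n" using long e uv by (simp add: cyl_length_proj edge_length_pair)
  then have "three_crossing {{u, v}, {u + int n, v + int n}, {u + 2 * int n, v + 2 * int n}}"
    using \<open>n \<ge> 1\<close> by (intro three_crossingI) auto
  moreover have "shift (l * int n) e \<in> preimage n T" for l
    using e c by (simp add: preimage_def shift_cover_edges proj_shift)
  from this[of 0] this[of 1] this[of 2]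
  have "{{u, v}, {u + int n, v + int n}, {u + 2 * int n, v + 2 * int n}} \<subseteq> preimage n T"
    by (simp add: uv)
  ultimately show False using T unfolding three_crossing_free_def by blast
qed

lemma length_two_in_two_triangulation:
  assumes T: "two_triangulation n T" and c: "c \<in> cyl_edges n" "cyl_length c = 2"
  shows "c \<in> T"
proof -
  have free: "three_crossing_free n T" using T by (simp add: two_triangulation_def)
  have "\<not> three_crossing X" if X: "X \<subseteq> preimage n (insert c T)" for X
  proof
    assume 3: "three_crossing X"
    have "e \<in> preimage n T" if e: "e \<in> X" for e
    proof -
      have "e \<in> cover_edges" "proj n e = c \<or> proj n e \<in> T"
        using X e by (auto simp: preimage_def)
      moreover have "edge_length e > 2" using 3 e by (rule three_crossing_length)
      ultimately show ?thesis using c(2) by (auto simp: preimage_def cyl_length_proj)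
    qed
    then have "X \<subseteq> preimage n T" by (rule subsetI)
    then show False using 3 free unfolding three_crossing_free_def by simp
  qed
  then have "three_crossing_free n (insert c T)"
    using free c unfolding three_crossing_free_def by simp
  then show ?thesis using T unfolding two_triangulation_def by blast
qed

lemma two_triangulation_decomp:
  assumes "n \<ge> 1" and T: "two_triangulation n T"
  shows "T = (T \<inter> relevant_edges n) \<union> {c \<in> cyl_edges n. cyl_length c = 2}"
proof -
  have "c \<in> relevant_edges n \<or> c \<in> cyl_edges n \<and> cyl_length c = 2" if "c \<in> T" for c
  proof -
    have "three_crossing_free n T" using T by (simp add: two_triangulation_def)
    then have "c \<in> cyl_edges n" "2 \<le> cyl_length c" "cyl_length c \<le> 2 * int n"
      using that three_crossing_free_length_le[OF \<open>n \<ge> 1\<close>]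
      by (auto simp: three_crossing_free_def)
    then show ?thesis by (auto simp: relevant_edges_def)
  qed
  then show ?thesis using length_two_in_two_triangulation[OF T] by blast
qed

theorem facets_Delta:
  assumes "n \<ge> 1"
  shows "facets (Delta n) = {T \<inter> relevant_edges n | T. two_triangulation n T}"
proof -
  have *: "T = T'" if "two_triangulation n T" "two_triangulation n T'"
    "T \<inter> relevant_edges n \<subseteq> T' \<inter> relevant_edges n" for T T'
  proof -
    have "T \<subseteq> T'" using that two_triangulation_decomp[OF assms] by blast
    then show ?thesis using that unfolding two_triangulation_def by blast
  qed
  show ?thesis
  proof (intro equalityI subsetI)
    fix F assume "F \<in> facets (Delta n)"
    then show "F \<in> {T \<inter> relevant_edges n | T. two_triangulation n T}"
      unfolding facets_def Delta_def by blast
  next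
    fix F assume "F \<in> {T \<inter> relevant_edges n | T. two_triangulation n T}"
    then obtain T where T: "two_triangulation n T" "F = T \<inter> relevant_edges n" by blast
    have "G = F" if G: "G \<in> Delta n" "F \<subseteq> G" for G
    proof -
      obtain T' where T': "two_triangulation n T'" "G \<subseteq> T' \<inter> relevant_edges n"
        using G unfolding Delta_def by blast
      then have "T = T'" using *[OF T(1) T'(1)] T(2) G(2) by blast
      then show ?thesis using T T' G by blast
    qed
    moreover have "F \<in> Delta n" using T unfolding Delta_def by blast
    ultimately show "F \<in> facets (Delta n)" unfolding facets_def by blast
  qed
qed

lemma finite_short_edges:
  assumes "n \<ge> 1"
  shows "finite {c \<in> cyl_edges n. cyl_length c \<le> m}"
proof (rule finite_subset)
  show "{c \<in> cyl_edges n. cyl_length c \<le> m}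
      \<subseteq> (\<lambda>(u, l). proj n {u, u + l}) ` ({0..<int n} \<times> {0..m})"
  proof
    fix c assume c: "c \<in> {c \<in> cyl_edges n. cyl_length c \<le> m}"
    then obtain e where e: "e \<in> cover_edges" "c = proj n e" by (auto simp: cyl_edges_def)
    obtain u v where uv: "e = {u, v}" "u < v" using e(1) by (rule cover_edgeE)
    have "c = proj n (shift ((- (u div int n)) * int n) e)" by (simp only: proj_shift e(2))
    also have "shift ((- (u div int n)) * int n) e = {u mod int n, u mod int n + (v - u)}"
      by (simp add: uv minus_div_mult_eq_mod[symmetric] algebra_simps)
    finally have "c = proj n {u mod int n, u mod int n + (v - u)}" .
    moreover have "v - u \<le> m" using c e uv by (simp add: cyl_length_proj edge_length_pair)
    ultimately show "c \<in> (\<lambda>(u, l). proj n {u, u + l}) ` ({0..<int n} \<times> {0..m})"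
      using assms uv by (intro image_eqI[of _ _ "(u mod int n, v - u)"]) auto
  qed
qed simp

lemma two_triangulation_extend:
  assumes "n \<ge> 1" and "three_crossing_free n S"
  shows "\<exists>T. two_triangulation n T \<and> S \<subseteq> T"
proof -
  let ?A = "{T. three_crossing_free n T}"
  have "?A \<subseteq> Pow {c \<in> cyl_edges n. cyl_length c \<le> 2 * int n}"
    using three_crossing_free_length_le[OF \<open>n \<ge> 1\<close>]
    by (auto simp: three_crossing_free_def)
  then have "finite ?A"
    by (rule finite_subset) (use finite_short_edges[OF \<open>n \<ge> 1\<close>] in simp)
  from finite_has_maximal2[OF this, of S] assms(2) show ?thesis
    unfolding two_triangulation_def by auto
qed

lemma relevant_edge_crossing_free:
  assumes "n \<ge> 1" "c \<in> relevant_edges n"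
  shows "three_crossing_free n {c}"
proof -
  obtain e where e: "e \<in> cover_edges" "c = proj n e"
    using assms by (auto simp: relevant_edges_def cyl_edges_def)
  obtain u v where uv: "e = {u, v}" "u < v" using e(1) by (rule cover_edgeE)
  have len: "v - u \<le> 2 * int n"
    using assms e uv by (simp add: relevant_edges_def cyl_length_proj edge_length_pair)
  have "\<not> three_crossing X" if X: "X \<subseteq> preimage n {c}" for X
  proof
    assume 3: "three_crossing X"
    have lift: "\<exists>l. f = {u + l * int n, v + l * int n}" if "f \<in> X" for f
    proof -
      have "proj n e = proj n f" using that X e by (auto simp: preimage_def)
      then show ?thesis by (auto simp: proj_eq_iff uv)
    qed
    have close: "\<bar>k - l\<bar> < 2"
      if "crosses {u + k * int n, v + k * int n} {u + l * int n, v + l * int n}" for k l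
    proof -
      have "\<bar>k * int n - l * int n\<bar> < v - u"
        using that uv(2) unfolding crosses_def by (auto simp: doubleton_eq_iff)
      then have "\<bar>k - l\<bar> * int n < 2 * int n"
        using len by (simp add: abs_mult left_diff_distrib[symmetric])
      then show ?thesis by (rule mult_right_less_imp_less) simp
    qed
    obtain f1 f2 f3 where f: "X = {f1, f2, f3}" "f1 \<noteq> f2" "f2 \<noteq> f3" "f1 \<noteq> f3"
      using 3 by (auto simp: three_crossing_def card_3_iff)
    then obtain k1 k2 k3 where k: "f1 = {u + k1 * int n, v + k1 * int n}"
      "f2 = {u + k2 * int n, v + k2 * int n}" "f3 = {u + k3 * int n, v + k3 * int n}"
      using lift by (metis insertCI)
    have "crosses f1 f2" "crosses f2 f3" "crosses f1 f3"
      using 3 f unfolding three_crossing_def by auto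
    then have "\<bar>k1 - k2\<bar> < 2" "\<bar>k2 - k3\<bar> < 2" "\<bar>k1 - k3\<bar> < 2"
      using close k by metis+
    moreover have "k1 \<noteq> k2" "k2 \<noteq> k3" "k1 \<noteq> k3" using f k by auto
    ultimately show False by linarith
  qed
  then show ?thesis
    using assms(2) by (auto simp: three_crossing_free_def relevant_edges_def)
qed

theorem vertices_Delta:
  assumes "n \<ge> 1"
  shows "\<Union> (Delta n) = relevant_edges n"
proof
  show "\<Union> (Delta n) \<subseteq> relevant_edges n" unfolding Delta_def by blast
  show "relevant_edges n \<subseteq> \<Union> (Delta n)"
  proof
    fix c assume c: "c \<in> relevant_edges n"
    obtain T where "two_triangulation n T" "{c} \<subseteq> T"
      using two_triangulation_extend[OF assms relevant_edge_crossing_free[OF assms c]] by blast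
    then have "{c} \<in> Delta n" using c unfolding Delta_def by blast
    then show "c \<in> \<Union> (Delta n)" by blast
  qed
qed

end

(*
  A set of edges of C_n is encoded by the set of its lifts, closed up to a set of chords of a regular
  4n-gon that is invariant under the rotation by n steps. Since only lengths up to 2n matter, a
  3-crossing of the universal cover is the same as three pairwise crossing chords of the 4n-gon, so
  that the facets are the maximal rotation invariant 3-crossing-free sets of chords.

  Three consecutive vertices v - 1, v, v + 1 of the 4n-gon always span a pentagram with two further
  vertices x < y, all of whose sides belong to the facet. Contracting this ear (and its rotations)
  removes the vertex v: the neighbours of v up to x go to v - 1, those from y on go to v + 1. Facets
  for n become facets for n - 1, and exactly three orbits of chords are lost, which gives purity.
  A chord outside the ear is flipped after the contraction. A chord of the ear at v that ends in v is
  flipped by moving x or y to the next neighbour of v; a suitable v always exists. Uniqueness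
  of the flip compares the ears of three facets that share a ridge.
*)
theory Submission
  imports Defs
begin

section \<open>Rotation invariant chord sets of the 4n-gon\<close>

text \<open>Overlaps of an ear with its own rotations shape most of the argument. A side of the ear
  at 0 can be a rotation of another side, or can join two removed vertices, so that moving one end
  of a chord also changes the rule at its other end. Such coincidences amount to divisibility by
  \<open>n\<close> together with a congruence modulo \<open>4 * n\<close>; this leaves few
  positions, and each is settled by hand, often by an explicit 3-crossing. From \<open>n = 3\<close>
  on, v - 1, v and v + 1 lie in distinct rotation classes; hence the induction starts at
  \<open>n = 2\<close>, where all facets can be listed.

  Contraction is inverted by taking all chords that obey the ear and contract into the given set,
  together with the orbit of (v - 1, v + 1). Maximality survives because every chord of the smaller
  polygon has such a preimage. Of the three lost orbits one is that of (v - 1, v + 1), whose ends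
  become adjacent; the other two arise because (v - 1, x) merges with (v, x), and (v + 1, y) with
  (v, y).\<close>

text \<open>A pair \<open>(i, j)\<close> stands for the chord between the residues of \<open>i\<close> and \<open>j\<close> modulo \<open>4 * n\<close>. The
  relation \<open>eqv\<close> identifies it with its reversal, with its rotations by multiples of \<open>n\<close>, and with
  the other representatives of the same residues.\<close>

definition eqv :: "int \<Rightarrow> int \<times> int \<Rightarrow> int \<times> int \<Rightarrow> bool" where
  "eqv n c d \<longleftrightarrow> (\<exists>k a. d = (fst c + n * k, snd c + n * k + 4 * n * a) \<or>
     d = (snd c + n * k, fst c + n * k + 4 * n * a))"

definition orb :: "int \<Rightarrow> int \<times> int \<Rightarrow> (int \<times> int) set" where
  "orb n c = {d. eqv n c d}"

definition closed :: "int \<Rightarrow> (int \<times> int) set \<Rightarrow> bool" where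
  "closed n E \<longleftrightarrow> (\<forall>c\<in>E. orb n c \<subseteq> E)"

definition chords :: "int \<Rightarrow> (int \<times> int) set" where
  "chords n = {(i, j). 2 \<le> (j - i) mod (4 * n) \<and> (j - i) mod (4 * n) \<le> 4 * n - 2}"

text \<open>A 3-crossing of the polygon: opposite corners of a hexagon are joined. Choosing lifts of
  all six ends within one turn makes crossing a chain of inequalities.\<close>

definition hexa :: "int \<Rightarrow> (int \<times> int) set \<Rightarrow> int \<Rightarrow> int \<Rightarrow> int \<Rightarrow> int \<Rightarrow> int \<Rightarrow> int \<Rightarrow> bool" where
  "hexa n E a b c a' b' c' \<longleftrightarrow> a < b \<and> b < c \<and> c < a' \<and> a' < b' \<and> b' < c' \<and> c' < a + 4 * n \<and>
     (a, a') \<in> E \<and> (b, b') \<in> E \<and> (c, c') \<in> E"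

definition free :: "int \<Rightarrow> (int \<times> int) set \<Rightarrow> bool" where
  "free n E \<longleftrightarrow> closed n E \<and> E \<subseteq> chords n \<and> (\<forall>a b c a' b' c'. \<not> hexa n E a b c a' b' c')"

definition facet :: "int \<Rightarrow> (int \<times> int) set \<Rightarrow> bool" where
  "facet n T \<longleftrightarrow> free n T \<and> (\<forall>E. free n E \<and> T \<subseteq> E \<longrightarrow> E = T)"

lemma eqv_shift [simp]: "eqv n (i, j) (i + n * k, j + n * k + 4 * n * a)"
  unfolding eqv_def by auto

lemma eqv_swap [simp]: "eqv n (i, j) (j, i)"
  unfolding eqv_def by (rule exI[of _ 0], rule exI[of _ 0]) simp

lemma eqvE:
  assumes "eqv n (i, j) (i', j')"
  obtains (direct) k a where "i' = i + n * k" "j' = j + n * k + 4 * n * a"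
  | (swap) k a where "i' = j + n * k" "j' = i + n * k + 4 * n * a"
  using assms unfolding eqv_def by auto

lemma eqvI:
  assumes "i' = i + n * k" "j' = j + n * k + 4 * n * a"
  shows "eqv n (i, j) (i', j')"
  using assms by simp

lemma eqvI':
  assumes "i' = j + n * k" "j' = i + n * k + 4 * n * a"
  shows "eqv n (i, j) (i', j')"
  using assms unfolding eqv_def by auto

lemma eqv_refl [simp]: "eqv n c c"
  by (cases c) (auto intro!: eqvI[of _ _ _ 0 _ _ 0])

lemma eqv_sym: "eqv n c d \<Longrightarrow> eqv n d c"
proof (cases c; cases d)
  fix i j i' j' assume *: "eqv n c d" "c = (i, j)" "d = (i', j')"
  then have "eqv n (i, j) (i', j')" by simp
  then show "eqv n d c"
  proof (cases rule: eqvE)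
    case (direct k a)
    then show ?thesis unfolding * by (intro eqvI[of _ _ _ "- k" _ _ "- a"]) simp_all
  next
    case (swap k a)
    \<comment> \<open>Undoing a reversal moves the turn \<open>4 * n * a\<close> to the other end,
      where it counts as \<open>4 * a\<close> rotations by \<open>n\<close>.\<close>
    then show ?thesis unfolding *
      by (intro eqvI'[of _ _ _ "- k - 4 * a" _ _ a]) (simp_all add: algebra_simps)
  qed
qed

lemma eqv_trans: "eqv n c d \<Longrightarrow> eqv n d e \<Longrightarrow> eqv n c e"
proof (cases c; cases d; cases e)
  fix i j i' j' i'' j''
  assume *: "eqv n c d" "eqv n d e" "c = (i, j)" "d = (i', j')" "e = (i'', j'')"
  then have 1: "eqv n (i, j) (i', j')" and 2: "eqv n (i', j') (i'', j'')" by simp_all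
  show "eqv n c e"
  using 1 proof (cases rule: eqvE)
    case d: (direct k a)
    from 2 show ?thesis
    proof (cases rule: eqvE)
      case (direct l b)
      then show ?thesis unfolding * d
        by (intro eqvI[of _ _ _ "k + l" _ _ "a + b"]) (simp_all add: algebra_simps)
    next
      case (swap l b)
      then show ?thesis unfolding * d
        by (intro eqvI'[of _ _ _ "k + l + 4 * a" _ _ "b - a"]) (simp_all add: algebra_simps)
    qed
  next
    case d: (swap k a)
    from 2 show ?thesis
    proof (cases rule: eqvE)
      case (direct l b)
      then show ?thesis unfolding * d
        by (intro eqvI'[of _ _ _ "k + l" _ _ "a + b"]) (simp_all add: algebra_simps)
    next
      case (swap l b)
      then show ?thesis unfolding * d
        by (intro eqvI[of _ _ _ "k + l + 4 * a" _ _ "b - a"]) (simp_all add: algebra_simps)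
    qed
  qed
qed

text \<open>The unordered pair of the residues of the ends modulo \<open>n\<close> is an invariant
  of the orbit; many non-equivalences below rest on it.\<close>

lemma eqv_class':
  assumes "eqv n (u, w) (i, j)" shows "n dvd j - w \<and> n dvd i - u \<or> n dvd j - u \<and> n dvd i - w"
  using assms
proof (cases rule: eqvE)
  case (direct k a)
  then have "j - w = n * (k + 4 * a)" "i - u = n * k" by (simp_all add: algebra_simps)
  then show ?thesis by (metis dvd_triv_left)
next
  case (swap k a)
  then have "j - u = n * (k + 4 * a)" "i - w = n * k" by (simp_all add: algebra_simps)
  then show ?thesis by (metis dvd_triv_left)
qed

lemma orb_eq_iff: "orb n c = orb n d \<longleftrightarrow> eqv n c d"
  unfolding orb_def using eqv_sym eqv_trans eqv_refl by blast

lemma mem_orb [simp]: "d \<in> orb n c \<longleftrightarrow> eqv n c d"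
  by (simp add: orb_def)

lemma closedD: "closed n E \<Longrightarrow> c \<in> E \<Longrightarrow> eqv n c d \<Longrightarrow> d \<in> E"
  unfolding closed_def using mem_orb by blast

lemma closed_iff: "closed n E \<Longrightarrow> eqv n c d \<Longrightarrow> c \<in> E \<longleftrightarrow> d \<in> E"
  using closedD eqv_sym by blast

lemma closed_swap: "closed n E \<Longrightarrow> (i, j) \<in> E \<Longrightarrow> (j, i) \<in> E"
  by (erule (1) closedD) simp

lemma closed_shift:
  "closed n E \<Longrightarrow> (i, j) \<in> E \<Longrightarrow> (i + n * k, j + n * k + 4 * n * a) \<in> E"
  by (erule (1) closedD) simp

lemma closed_turn: "closed n E \<Longrightarrow> (i, j) \<in> E \<Longrightarrow> (j, i + 4 * n) \<in> E"
  by (erule (1) closedD) (rule eqvI'[of _ _ _ 0 _ _ 1], simp_all)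

lemma closedI:
  assumes "\<And>i j. (i, j) \<in> E \<Longrightarrow> (j, i) \<in> E"
    and "\<And>i j k a. (i, j) \<in> E \<Longrightarrow> (i + n * k, j + n * k + 4 * n * a) \<in> E"
  shows "closed n E"
  unfolding closed_def
proof (intro ballI subsetI)
  fix c d assume "c \<in> E" "d \<in> orb n c"
  moreover obtain i j i' j' where "c = (i, j)" "d = (i', j')" by (cases c; cases d) blast
  ultimately have "(i, j) \<in> E" "eqv n (i, j) (i', j')" by simp_all
  then show "d \<in> E" unfolding \<open>d = (i', j')\<close>
    by (elim eqvE) (use assms in auto)
qed

lemma closed_orb [simp]: "closed n (orb n c)"
  unfolding closed_def orb_def using eqv_trans by blast

lemma closed_Un: "closed n A \<Longrightarrow> closed n B \<Longrightarrow> closed n (A \<union> B)"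
  unfolding closed_def by blast

lemma closed_Diff: "closed n A \<Longrightarrow> closed n B \<Longrightarrow> closed n (A - B)"
  using closed_iff[of n B] closedD[of n A] unfolding closed_def orb_def by blast

lemma free_closed: "free n E \<Longrightarrow> closed n E"
  and free_chords: "free n E \<Longrightarrow> E \<subseteq> chords n"
  and free_hexa: "free n E \<Longrightarrow> \<not> hexa n E a b c a' b' c'"
  by (simp_all add: free_def)

lemma facet_free: "facet n T \<Longrightarrow> free n T"
  and facet_closed: "facet n T \<Longrightarrow> closed n T"
  and facet_max: "facet n T \<Longrightarrow> free n E \<Longrightarrow> T \<subseteq> E \<Longrightarrow> E = T"
  by (simp_all add: facet_def free_closed)

lemma hexa_turn: "closed n E \<Longrightarrow> hexa n E a b c a' b' c' \<Longrightarrow> hexa n E b c a' b' c' (a + 4 * n)"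
  unfolding hexa_def by (simp add: closed_turn)

lemma chordsI: "i + 2 \<le> j \<Longrightarrow> j \<le> i + 4 * n - 2 \<Longrightarrow> (i, j) \<in> chords n"
  by (simp add: chords_def)

lemma chords_iff: "i < j \<Longrightarrow> j < i + 4 * n \<Longrightarrow> (i, j) \<in> chords n \<longleftrightarrow> i + 2 \<le> j \<and> j \<le> i + 4 * n - 2"
  by (auto simp add: chords_def)

lemma mod_flip:
  fixes d m :: int
  assumes "0 < d mod m" "0 < m" shows "(- d) mod m = m - d mod m"
  using assms by (metis less_numeral_extra(3) zmod_zminus1_eq_if)

lemma closed_chords: assumes "n > 0" shows "closed n (chords n)"
proof (rule closedI)
  fix i j assume "(i, j) \<in> chords n"
  then show "(j, i) \<in> chords n"
    using mod_flip[of "j - i" "4 * n"] assms by (simp add: chords_def)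
next
  fix i j k a assume "(i, j) \<in> chords n"
  moreover have "(j + n * k + 4 * n * a - (i + n * k)) mod (4 * n) = (j - i) mod (4 * n)"
    by (metis (no_types, opaque_lifting) add.commute add_diff_cancel_left diff_add_eq mod_mult_self2)
  ultimately show "(i + n * k, j + n * k + 4 * n * a) \<in> chords n" by (simp add: chords_def)
qed

lemma chord_rep:
  assumes "n > 0" "closed n E" "(i, j) \<in> E" "E \<subseteq> chords n"
  obtains j' where "i + 2 \<le> j'" "j' \<le> i + 4 * n - 2" "(i, j') \<in> E" "eqv n (i, j) (i, j')"
    "4 * n dvd j' - j"
proof -
  define j' where "j' = i + (j - i) mod (4 * n)"
  have "j' = j + n * 0 + 4 * n * (- ((j - i) div (4 * n)))"
    unfolding j'_def by (simp add: minus_mult_div_eq_mod[symmetric])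
  then have e: "eqv n (i, j) (i, j')"
    by (intro eqvI[of _ _ _ 0 _ _ "- ((j - i) div (4 * n))"]) simp_all
  moreover have "4 * n dvd j' - j"
    using \<open>j' = j + _ + _\<close> by simp
  ultimately show ?thesis
    using that[of j'] assms(3,4) closedD[OF assms(2,3) e] by (auto simp: chords_def j'_def)
qed

lemma dvd_cases:
  fixes n d :: int
  assumes "n dvd d" "0 < d" "d < 4 * n"
  shows "d = n \<or> d = 2 * n \<or> d = 3 * n"
proof -
  obtain k where k: "d = n * k" using assms(1) by blast
  have "n > 0" using assms by auto
  then have "0 < k" "k < 4" using assms k by (auto simp: zero_less_mult_iff mult.commute[of n k])
  then have "k = 1 \<or> k = 2 \<or> k = 3" by auto
  then show ?thesis using k by auto
qed

lemma card_image_cong: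
  assumes "\<And>a b. a \<in> A \<Longrightarrow> b \<in> A \<Longrightarrow> f a = f b \<longleftrightarrow> g a = g b"
  shows "card (f ` A) = card (g ` A)"
proof (rule bij_betw_same_card)
  have *: "inv_into A f (f a) \<in> A \<and> f (inv_into A f (f a)) = f a" if "a \<in> A" for a
    using that by (simp add: inv_into_into f_inv_into_f)
  show "bij_betw (\<lambda>z. g (inv_into A f z)) (f ` A) (g ` A)"
  proof (rule bij_betw_imageI)
    show "inj_on (\<lambda>z. g (inv_into A f z)) (f ` A)"
      by (rule inj_onI) (use assms * in \<open>auto, metis\<close>)
    have "g (inv_into A f (f a)) = g a" if "a \<in> A" for a using assms * that by blast
    then show "(\<lambda>z. g (inv_into A f z)) ` f ` A = g ` A" by (simp add: image_image)
  qed
qed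

text \<open>Rotation brings the first end into \<open>[0, n)\<close>; the difference of the ends can
  be taken below \<open>4 * n\<close>, whence the bound \<open>5 * n\<close> for the second
  end.\<close>

lemma finite_orbs:
  assumes n: "n > 0" and "closed n E" "E \<subseteq> chords n"
  shows "finite (orb n ` E)"
proof (rule finite_subset)
  show "orb n ` E \<subseteq> orb n ` ({0..<n} \<times> {0..5 * n})"
  proof
    fix O' assume "O' \<in> orb n ` E"
    then obtain i j where c: "(i, j) \<in> E" "O' = orb n (i, j)" by auto
    obtain j' where j': "i + 2 \<le> j'" "j' \<le> i + 4 * n - 2" "eqv n (i, j) (i, j')"
      using chord_rep[OF n assms(2) c(1) assms(3)] by blast
    have "eqv n (i, j') (i mod n, j' - n * (i div n))"
      by (rule eqvI[of _ _ _ "- (i div n)" _ _ 0]) (simp_all add: minus_mult_div_eq_mod[symmetric])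
    then have "O' = orb n (i mod n, j' - n * (i div n))"
      unfolding c(2) orb_eq_iff using j'(3) eqv_trans by blast
    moreover have "j' - n * (i div n) = (j' - i) + i mod n" by (simp add: minus_mult_div_eq_mod[symmetric])
    moreover have "0 \<le> (j' - i) + i mod n" "(j' - i) + i mod n \<le> 5 * n"
      using j' n pos_mod_bound[OF n, of i] pos_mod_sign[OF n, of i] by linarith+
    ultimately show "O' \<in> orb n ` ({0..<n} \<times> {0..5 * n})"
      using n by (intro image_eqI) auto
  qed
qed simp

text \<open>A closed set is the union of its orbits, so free sets inject into the power set of a
  finite set and maximal ones exist above \<open>E\<close>.\<close>

lemma free_extend:
  assumes n: "n > 0" and E: "free n E"
  obtains T where "facet n T" "E \<subseteq> T"
proof -
  have Union: "\<Union> (orb n ` A) = A" if "closed n A" for A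
    using that eqv_refl unfolding closed_def orb_def by blast
  have "inj_on ((`) (orb n)) {T. free n T}"
    by (rule inj_onI) (metis Union free_closed mem_Collect_eq)
  moreover have "(`) (orb n) ` {T. free n T} \<subseteq> Pow (orb n ` chords n)"
    using free_chords by blast
  then have "finite ((`) (orb n) ` {T. free n T})"
    using finite_orbs[OF n closed_chords[OF n]] finite_subset by blast
  ultimately have "finite {T. free n T}" by (rule finite_imageD[rotated])
  from finite_has_maximal2[OF this, of E] E that show ?thesis
    unfolding facet_def by auto
qed

lemma hexa_orb_member:
  assumes "free n T" "hexa n (T \<union> D) a b c a' b' c'"
  shows "(a, a') \<in> D \<or> (b, b') \<in> D \<or> (c, c') \<in> D"
  using assms unfolding free_def hexa_def by blast

text \<open>A chord of a 3-crossing has two ends of the other chords strictly on each side, so its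
  length is at least 3 both ways. Adding chords of length 2 therefore creates no crossing.\<close>

lemma facet_boundary:
  assumes n: "n \<ge> 2" and T: "facet n T" shows "(i, i + 2) \<in> T"
proof -
  let ?D = "orb n (i, i + 2)"
  have cl: "closed n (T \<union> ?D)" using facet_closed[OF T] by (simp add: closed_Un)
  have short: "u + 3 \<le> w \<Longrightarrow> w \<le> u + 4 * n - 3 \<Longrightarrow> (u, w) \<notin> ?D" for u w
  proof
    assume *: "u + 3 \<le> w" "w \<le> u + 4 * n - 3" "(u, w) \<in> ?D"
    then have "eqv n (i, i + 2) (u, w)" by simp
    then show False
    proof (cases rule: eqvE)
      case (direct k a)
      then have "4 * n dvd w - u - 2" by simp
      then show False using * by (auto dest: zdvd_imp_le)
    next
      case (swap k a)
      then have "w - u + 2 = 4 * n * a" by simp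
      then have "4 * n dvd w - u + 2" by simp
      then show False using * by (auto dest: zdvd_imp_le)
    qed
  qed
  have "\<not> hexa n (T \<union> ?D) a b c a' b' c'" for a b c a' b' c'
  proof
    assume h: "hexa n (T \<union> ?D) a b c a' b' c'"
    then have "(a, a') \<notin> ?D" "(b, b') \<notin> ?D" "(c, c') \<notin> ?D"
      unfolding hexa_def by (intro short; linarith)+
    then show False using hexa_orb_member[OF facet_free[OF T] h] by blast
  qed
  moreover have "?D \<subseteq> chords n"
    using closedD[OF closed_chords, of n "(i, i + 2)"] chordsI[of i "i + 2" n] n by auto
  ultimately have "free n (T \<union> ?D)"
    using cl T by (auto simp: free_def facet_def)
  then have "T \<union> ?D = T" using facet_max[OF T] by blast
  then show ?thesis using mem_orb eqv_refl by blast
qed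

section \<open>Existence of ears\<close>

text \<open>Transports crossings when \<open>m i j\<close> is the new place of the end
  \<open>i\<close> of the chord \<open>(i, j)\<close>. Any of the six ends can be listed first, so
  checking that one gap stays open yields all six inequalities.\<close>

lemma hexa_map:
  assumes cl: "closed n E"
    and mem: "\<And>i j. (i, j) \<in> E \<Longrightarrow> (m i j, m j i) \<in> S"
    and per: "\<And>i j. m (i + 4 * n) j = m i j + 4 * n'" "\<And>i j. m i (j + 4 * n) = m i j"
    and last: "\<And>a b c a' b' c'. hexa n E a b c a' b' c' \<Longrightarrow> m c' c < m a a' + 4 * n'"
    and h: "hexa n E a b c a' b' c'"
  shows "hexa n' S (m a a') (m b b') (m c c') (m a' a) (m b' b) (m c' c)"
proof -
  note h1 = hexa_turn[OF cl h]
  note h2 = hexa_turn[OF cl h1]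
  note h3 = hexa_turn[OF cl h2]
  note h4 = hexa_turn[OF cl h3]
  note h5 = hexa_turn[OF cl h4]
  have "m a a' < m b b'" "m b b' < m c c'" "m c c' < m a' a" "m a' a < m b' b" "m b' b < m c' c"
    using last[OF h1] last[OF h2] last[OF h3] last[OF h4] last[OF h5] by (simp_all add: per)
  then show ?thesis
    using last[OF h] mem h unfolding hexa_def by blast
qed

lemma closed_translate:
  "closed n E \<Longrightarrow> (i + n * k, j + n * k) \<in> E \<longleftrightarrow> (i, j) \<in> E"
  by (rule closed_iff[symmetric], assumption, rule eqvI[of _ _ _ k _ _ 0]) simp_all

text \<open>In a crossing that uses rotations of the missing chord \<open>(v, z)\<close>, pull their end \<open>v\<close> back to
  \<open>v - 1\<close>. The result is a crossing unless the preceding end of the crossing already is \<open>v - 1\<close>,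
  which is what \<open>core\<close> excludes. Diameters contain two rotations of \<open>v\<close>; the last conjunct of
  \<open>moved\<close> makes sure that only one of them moves.\<close>

lemma facet_push:
  assumes n: "n \<ge> 2" and T: "facet n T" and z: "v + 2 \<le> z" "z \<le> v + 4 * n - 2"
    and old: "(v - 1, z) \<in> T"
    and core: "\<And>b c b'. v < b \<Longrightarrow> b < c \<Longrightarrow> c < z \<Longrightarrow> z < b' \<Longrightarrow> b' < v + 4 * n - 1 \<Longrightarrow>
      (b, b') \<in> T \<union> orb n (v, z) \<Longrightarrow> (c, v + 4 * n - 1) \<in> T \<union> orb n (v, z) \<Longrightarrow> False"
  shows "(v, z) \<in> T"
proof (rule ccontr)
  assume new: "(v, z) \<notin> T"
  let ?D = "orb n (v, z)"
  define moved where "moved i j \<longleftrightarrow> n dvd i - v \<and> 4 * n dvd (j - i) - (z - v) \<and>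
      (z - v = 2 * n \<longrightarrow> (i - v) mod (4 * n) < 2 * n)" for i j
  define m where "m i j = (if moved i j then i - 1 else i)" for i j
  note cl = facet_closed[OF T]
  have clTD: "closed n (T \<union> ?D)" using cl by (simp add: closed_Un)
  have D_moved: "moved i j \<or> moved j i" if "(i, j) \<in> ?D" for i j
  proof -
    \<comment> \<open>Used for diameters, where both ends look like rotations of \<open>v\<close>:
      if one end fails the half-turn condition, the antipodal end satisfies it.\<close>
    have half: "(w + 2 * n) mod (4 * n) < 2 * n" if "n dvd w" "\<not> w mod (4 * n) < 2 * n" for w
    proof -
      have "0 \<le> w mod (4 * n)" "w mod (4 * n) < 4 * n" using n by simp_all
      moreover have "(w + 2 * n) mod (4 * n) = (w mod (4 * n) + 2 * n - 4 * n) mod (4 * n)"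
        by (metis (no_types, opaque_lifting) diff_add_eq minus_mod_self2 mod_add_left_eq)
      moreover have "(w mod (4 * n) + 2 * n - 4 * n) mod (4 * n) = w mod (4 * n) + 2 * n - 4 * n"
        using calculation(2) that(2) by (intro mod_pos_pos_trivial) linarith+
      ultimately show ?thesis by linarith
    qed
    have eqv': "eqv n (v, z) (i, j)" using that by simp
    from eqv' have "(n dvd i - v \<and> 4 * n dvd (j - i) - (z - v)) \<or> (n dvd j - v \<and> 4 * n dvd (i - j) - (z - v))"
    proof (cases rule: eqvE)
      case (direct k a)
      then show ?thesis by simp
    next
      case (swap k a)
      have "n dvd j - v" "i - j - (z - v) = 4 * n * (- a)" using swap by simp_all
      then show ?thesis by (metis dvd_triv_left)
    qed
    moreover have "n dvd j - v \<and> 4 * n dvd (i - j) - (z - v)"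
      if "n dvd i - v" "4 * n dvd (j - i) - (z - v)" "z - v = 2 * n"
    proof -
      have "(i - j) - (z - v) = - ((j - i) - (z - v)) - 4 * n" using that(3) by simp
      moreover have "j - v = (j - i) - (z - v) + (i - v) + 2 * n" using that(3) by simp
      moreover have "n dvd (j - i) - (z - v)" using that(2) by (rule dvd_mult_right)
      ultimately show ?thesis using that by (metis dvd_add dvd_diff dvd_minus_iff dvd_refl dvd_triv_right)
    qed
    moreover have "n dvd i - v \<and> 4 * n dvd (j - i) - (z - v)"
      if "n dvd j - v" "4 * n dvd (i - j) - (z - v)" "z - v = 2 * n"
    proof -
      have "(j - i) - (z - v) = - ((i - j) - (z - v)) - 4 * n" using that(3) by simp
      moreover have "i - v = (i - j) - (z - v) + (j - v) + 2 * n" using that(3) by simp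
      moreover have "n dvd (i - j) - (z - v)" using that(2) by (rule dvd_mult_right)
      ultimately show ?thesis using that by (metis dvd_add dvd_diff dvd_minus_iff dvd_refl dvd_triv_right)
    qed
    moreover have "(j - v) mod (4 * n) < 2 * n"
      if "n dvd i - v" "4 * n dvd (j - i) - (z - v)" "z - v = 2 * n" "\<not> (i - v) mod (4 * n) < 2 * n"
    proof -
      have "(j - v) mod (4 * n) = (i - v + 2 * n) mod (4 * n)"
        using that(2,3) by (subst mod_eq_dvd_iff) (simp add: algebra_simps)
      then show ?thesis using half[OF that(1,4)] by simp
    qed
    ultimately show ?thesis unfolding moved_def by blast
  qed
  have moved_eqv: "eqv n (v, z) (i, j)" "eqv n (v - 1, z) (i - 1, j)" if "moved i j" for i j
  proof -
    obtain k a where "i - v = n * k" "j - i - (z - v) = 4 * n * a"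
      using \<open>moved i j\<close> unfolding moved_def dvd_def by blast
    then have "i = v + n * k" "j = z + n * k + 4 * n * a" by linarith+
    then show "eqv n (v, z) (i, j)" "eqv n (v - 1, z) (i - 1, j)"
      by (intro eqvI[of _ _ _ k _ _ a]; simp)+
  qed
  \<comment> \<open>If both ends moved, \<open>4 * n\<close> would divide
    \<open>2 * (z - v)\<close>, so the chord would be a diameter; but antipodal ends never lie in
    the same half-turn.\<close>
  have not_both: "\<not> (moved i j \<and> moved j i)" for i j
  proof
    assume *: "moved i j \<and> moved j i"
    have "2 * (z - v) = - (((j - i) - (z - v)) + ((i - j) - (z - v)))" by simp
    moreover have "4 * n dvd ((j - i) - (z - v)) + ((i - j) - (z - v))"
      using * unfolding moved_def by (intro dvd_add) auto
    ultimately have "4 * n dvd 2 * (z - v)" by (metis dvd_minus_iff)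
    then obtain t where t: "2 * (z - v) = 4 * n * t" by blast
    then have "z - v = 2 * (n * t)" by simp
    then have "0 < n * t" "n * t < 2 * n" using z n by linarith+
    then have "0 < t" "t < 2" using n by (auto simp: zero_less_mult_iff mult.commute[of n t])
    then have "t = 1" by simp
    then have zz: "z - v = 2 * n" using t by simp
    have "4 * n dvd (j - v) - (i - v + 2 * n)" using * zz unfolding moved_def by (simp add: algebra_simps)
    then have e: "(j - v) mod (4 * n) = ((i - v) mod (4 * n) + 2 * n) mod (4 * n)"
      by (metis mod_eq_dvd_iff mod_add_left_eq)
    have "0 \<le> (i - v) mod (4 * n)" "(i - v) mod (4 * n) < 2 * n" "(j - v) mod (4 * n) < 2 * n"
      using * zz n unfolding moved_def by simp_all
    then show False using e by simp
  qed
  have T_unmoved: "\<not> moved i j \<and> \<not> moved j i" if "(i, j) \<in> T" for i j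
    using that new closed_swap[OF cl] moved_eqv(1) closed_iff[OF cl] by blast
  have mem: "(m i j, m j i) \<in> T" if "(i, j) \<in> T \<union> ?D" for i j
  proof (cases "(i, j) \<in> T")
    case True
    then show ?thesis using T_unmoved by (simp add: m_def)
  next
    case False
    then have "(i, j) \<in> ?D" using that by blast
    then consider "moved i j" "\<not> moved j i" | "moved j i" "\<not> moved i j"
      using D_moved not_both by blast
    then show ?thesis
    proof cases
      case 1
      then show ?thesis using closedD[OF cl old moved_eqv(2)] by (simp add: m_def)
    next
      case 2
      then show ?thesis using closed_swap[OF cl closedD[OF cl old moved_eqv(2)[OF 2(1)]]]
        by (simp add: m_def)
    qed
  qed
  have per1: "moved (i + 4 * n) j = moved i j" for i j
  proof -
    have "4 * n dvd j - (i + 4 * n) - (z - v) \<longleftrightarrow> 4 * n dvd j - i - (z - v)"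
      by (metis (no_types, opaque_lifting) diff_diff_eq diff_right_commute dvd_minus_mod mod_mult_self2_is_0
        minus_mod_self2 dvd_eq_mod_eq_0)
    moreover have "n dvd i + 4 * n - v \<longleftrightarrow> n dvd i - v"
      by (metis (no_types, lifting) add_diff_eq add.commute dvd_add_right_iff dvd_triv_right diff_add_eq)
    moreover have "(i + 4 * n - v) mod (4 * n) = (i - v) mod (4 * n)"
      by (metis diff_add_eq mod_add_self2)
    ultimately show ?thesis unfolding moved_def by (simp only:)
  qed
  have per2: "moved i (j + 4 * n) = moved i j" for i j
  proof -
    have "4 * n dvd (j + 4 * n) - i - (z - v) \<longleftrightarrow> 4 * n dvd j - i - (z - v)"
      by (metis (no_types, opaque_lifting) diff_add_eq dvd_add_left_iff dvd_refl)
    then show ?thesis unfolding moved_def by simp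
  qed
  have last: "m c' c < m a a' + 4 * n" if h: "hexa n (T \<union> ?D) a b c a' b' c'" for a b c a' b' c'
  proof (rule ccontr)
    assume *: "\<not> m c' c < m a a' + 4 * n"
    have h': "a < b" "b < c" "c < a'" "a' < b'" "b' < c'" "c' < a + 4 * n"
      "(b, b') \<in> T \<union> ?D" "(c, c') \<in> T \<union> ?D" using h unfolding hexa_def by auto
    have "moved a a'" and c': "c' = a + 4 * n - 1"
      using * h'(6) unfolding m_def by (auto split: if_splits)
    then obtain k s where k: "a - v = n * k" and s: "a' - a - (z - v) = 4 * n * s"
      unfolding moved_def dvd_def by blast
    \<comment> \<open>The two differences lie strictly between 0 and \<open>4 * n\<close> and are
      congruent, hence equal. Translating back by \<open>n * k\<close> puts the moved end at
      \<open>v\<close>, which is the situation excluded by \<open>core\<close>.\<close>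
    have "\<bar>4 * n * s\<bar> < 4 * n" using s h' z by linarith
    then have "\<bar>s\<bar> * (4 * n) < 1 * (4 * n)" using n by (simp add: abs_mult mult.commute)
    then have "\<bar>s\<bar> < 1" using n by (simp only: mult_less_cancel_right)
    then have s0: "s = 0" by simp
    have tr: "(i - n * k, j - n * k) \<in> T \<union> ?D" if "(i, j) \<in> T \<union> ?D" for i j
      using closed_translate[OF clTD, of "i - n * k" k "j - n * k"] that by simp
    show False
    proof (rule core)
      show "(b - n * k, b' - n * k) \<in> T \<union> ?D" using h'(7) by (rule tr)
      have "(c - n * k, c' - n * k) \<in> T \<union> ?D" using h'(8) by (rule tr)
      moreover have "c' - n * k = v + 4 * n - 1" using c' k by linarith
      ultimately show "(c - n * k, v + 4 * n - 1) \<in> T \<union> ?D" by simp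
    qed (use h' c' k s s0 in auto)
  qed
  have "\<not> hexa n (T \<union> ?D) a b c a' b' c'" for a b c a' b' c'
  proof
    assume h: "hexa n (T \<union> ?D) a b c a' b' c'"
    have "m (i + 4 * n) j = m i j + 4 * n" "m i (j + 4 * n) = m i j" for i j
      using per1 per2 by (simp_all add: m_def)
    then have "hexa n T (m a a') (m b b') (m c c') (m a' a) (m b' b) (m c' c)"
      by (intro hexa_map[where m = m and n' = n, OF clTD _ _ _ _ h]) (use mem last in blast)+
    then show False using free_hexa[OF facet_free[OF T]] by blast
  qed
  moreover have "?D \<subseteq> chords n"
    using closedD[OF closed_chords chordsI[OF z]] n by auto
  ultimately have "free n (T \<union> ?D)"
    using clTD T by (auto simp: free_def facet_def)
  then have "T \<union> ?D = T" using facet_max[OF T] by blast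
  then show False using new mem_orb eqv_refl by blast
qed


text \<open>Together with the boundary chord \<open>(v - 1, v + 1)\<close>, these are the sides of the pentagram on
  \<open>v - 1, v, v + 1, x, y\<close>.\<close>

definition star :: "int \<Rightarrow> (int \<times> int) set \<Rightarrow> int \<Rightarrow> int \<Rightarrow> int \<Rightarrow> bool" where
  "star n T v x y \<longleftrightarrow> v + 1 < x \<and> x < y \<and> y < v - 1 + 4 * n \<and>
     (v - 1, x) \<in> T \<and> (v, x) \<in> T \<and> (v, y) \<in> T \<and> (v + 1, y) \<in> T"

lemma first_neighbour:
  fixes lo hi :: int
  assumes "P z" "lo < z"
  obtains x where "P x" "lo < x" "x \<le> z" "\<And>j. lo < j \<Longrightarrow> j < x \<Longrightarrow> \<not> P j"
proof -
  let ?A = "{j \<in> {lo<..z}. P j}"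
  have fin: "finite ?A" by (rule finite_subset[of _ "{lo<..z}"]) auto
  have "Min ?A \<in> ?A" by (rule Min_in[OF fin]) (use assms in auto)
  moreover have "\<not> P j" if "lo < j" "j < Min ?A" for j
  proof
    assume "P j"
    have "j \<le> z" using \<open>Min ?A \<in> ?A\<close> that by simp
    then have "j \<in> ?A" using that \<open>P j\<close> by simp
    then show False using Min_le[OF fin] that by fastforce
  qed
  ultimately show ?thesis using that[of "Min ?A"] by simp
qed

lemma dvd4: "n \<noteq> 0 \<Longrightarrow> 4 * n dvd m * n \<longleftrightarrow> 4 dvd m" for n m :: int
  by simp

text \<open>The corners are chosen greedily: \<open>x\<close> is the first neighbour of -1 beyond 1,
  and \<open>y\<close> the first neighbour of 0 beyond \<open>x\<close>. The sides
  \<open>(0, x)\<close> and \<open>(1, y)\<close> then follow from \<open>facet_push\<close>; a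
  crossing that blocked them would contradict one of the two choices.\<close>

lemma star_exists_aux:
  assumes n: "n \<ge> 3" and T: "facet n T"
  obtains x y where "star n T 0 x y"
proof -
  note cl = facet_closed[OF T] and fr = facet_free[OF T]
  have bd: "(i, i + 2) \<in> T" for i using facet_boundary[OF _ T] n by simp
  have "(-1, 4 * n - 3) \<in> T" using closed_turn[OF cl, of "-3" "-1"] bd[of "-3"] by simp
  then obtain x where x: "(-1, x) \<in> T" "1 < x" "x \<le> 4 * n - 3"
    and first: "\<And>j. 1 < j \<Longrightarrow> j < x \<Longrightarrow> (-1, j) \<notin> T"
    using first_neighbour[of "\<lambda>j. (-1, j) \<in> T" "4 * n - 3" 1] n by auto
  have tr: "(i + n * k, j + n * k) \<in> T" if "(i, j) \<in> T" for i j k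
    using closed_translate[OF cl] that by simp
  have tr4: "(i, j + 4 * n * a) \<in> T" if "(i, j) \<in> T" for i j a
    using closed_shift[OF cl that, of 0 a] by simp
  have first': "False" if "(b, 4 * n - 1) \<in> T" "1 < b" "b < x" for b
    using first[OF that(2,3)] tr4[OF closed_swap[OF cl that(1)], of 0] closed_swap[OF cl that(1)]
      closed_shift[OF cl closed_swap[OF cl that(1)], of "- 4" 1] by (simp add: algebra_simps)
  have 0: "(0, x) \<in> T"
  proof (rule facet_push[OF _ T])
    show "2 \<le> n" "0 + 2 \<le> x" "x \<le> 0 + 4 * n - 2" "(0 - 1, x) \<in> T" using n x by simp_all
  next
    fix b c b' assume h: "0 < b" "b < c" "c < x" and "(c, 0 + 4 * n - 1) \<in> T \<union> orb n (0, x)"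
    then consider "(c, 4 * n - 1) \<in> T" | "eqv n (0, x) (c, 4 * n - 1)" by auto
    then show False
    proof cases
      case 1
      show False by (rule first'[OF 1]) (use h in linarith)+
    next
      case 2
      then show False
      proof (cases rule: eqvE)
        case (direct k a)
        \<comment> \<open>The rotation of the new chord \<open>(0, x)\<close> is traded for the same
          rotation of the old chord \<open>(-1, x)\<close>, which lies in \<open>T\<close>.\<close>
        then have "(c - 1, 4 * n - 1) \<in> T"
          using closed_shift[OF cl x(1), of k a] by simp
        moreover have "n \<le> c" using direct(1) h by (intro zdvd_imp_le) auto
        ultimately show False using first'[of "c - 1"] h n by simp
      next
        case (swap k a)
        then have "1 = n * (4 - k - 4 * a)" by (simp add: algebra_simps)
        then have "n dvd 1" by (metis dvd_triv_left)
        then show False using n by simp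
      qed
    qed
  qed
  have "(0, 4 * n - 2) \<in> T" using closed_turn[OF cl, of "-2" 0] bd[of "-2"] by simp
  then obtain y where y: "(0, y) \<in> T" "x < y" "y \<le> 4 * n - 2"
    and next': "\<And>j. x < j \<Longrightarrow> j < y \<Longrightarrow> (0, j) \<notin> T"
    using first_neighbour[of "\<lambda>j. (0, j) \<in> T" "4 * n - 2" x] x(3) by auto
  \<comment> \<open>Such a chord would complete \<open>(0, y)\<close> and \<open>(-1, x)\<close> to
    a 3-crossing, or contradict the choice of \<open>x\<close> if it ends in the lift
    \<open>4 * n - 1\<close> of -1.\<close>
  have cross: "False" if "(b, b') \<in> T" "1 < b" "b < x" "y < b'" "b' < 4 * n" for b b'
  proof (cases "b' = 4 * n - 1")
    case True
    then show False using first' that by simp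
  next
    case False
    have "(x, -1 + 4 * n) \<in> T" using closed_turn[OF cl x(1)] .
    then have "hexa n T 0 b x y b' (-1 + 4 * n)"
      unfolding hexa_def using y that False by auto
    then show False using free_hexa[OF fr] by blast
  qed
  have 1: "(1, y) \<in> T"
  proof (rule facet_push[OF _ T])
    show "2 \<le> n" "1 + 2 \<le> y" "y \<le> 1 + 4 * n - 2" "(1 - 1, y) \<in> T" using n x y by simp_all
  next
    fix b c b' assume h: "1 < b" "b < c" "c < y" "y < b'" "b' < 1 + 4 * n - 1"
      and B: "(b, b') \<in> T \<union> orb n (1, y)" and C: "(c, 1 + 4 * n - 1) \<in> T \<union> orb n (1, y)"
    have B': "(b, b') \<in> T \<or> eqv n (1, y) (b, b')" using B by simp
    have C': "(c, 4 * n) \<in> T \<or> eqv n (1, y) (c, 4 * n)" using C by simp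
    show False
    proof (cases "(c, 4 * n) \<in> T")
      case CT: True
      then have c0: "(0, c) \<in> T" using closed_shift[OF cl closed_swap[OF cl CT], of "-4" 1] by simp
      then have cx: "c \<le> x" using next' h by force
      show False using B'
      proof
        assume "(b, b') \<in> T"
        then show False using cross[of b b'] h cx by simp
      next
        assume "eqv n (1, y) (b, b')"
        then show False
        proof (cases rule: eqvE)
          case (direct k a)
          then have "(b - 1, b') \<in> T" using closed_shift[OF cl y(1), of k a] by simp
          moreover have "1 < b - 1" 
          proof -
            have "n \<le> b - 1" using direct(1) h by (intro zdvd_imp_le) auto
            then show ?thesis using n by simp
          qed
          ultimately show False using cross[of "b - 1" b'] h cx by simp
        next
          case (swap k a)
          then have bT: "(b, b' - 1) \<in> T"
            using closed_swap[OF cl closed_shift[OF cl y(1), of "k + 4 * a" "-a"]] by (simp add: algebra_simps)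
          have kd: "b' - 1 = n * (k + 4 * a)" using swap by (simp add: algebra_simps)
          then have "n dvd b' - 1" by simp
          then have b3: "b' - 1 = n \<or> b' - 1 = 2 * n \<or> b' - 1 = 3 * n"
            using h by (intro dvd_cases) auto
          show False
          proof (cases "b' - 1 = y")
            case False
            then show False using cross[OF bT] h cx by simp
          next
            case True
            \<comment> \<open>Now \<open>b\<close> and \<open>y\<close> are multiples of
              \<open>n\<close> and \<open>b\<close> is congruent to \<open>2 * y\<close> modulo
              \<open>4 * n\<close>. The order of the ends leaves one position, and there the
              rotation \<open>(n, c + n)\<close> of \<open>(0, c)\<close> is the forbidden
              chord.\<close>
            have bb: "b = y + b' - 1 + 4 * n * (- a)" using swap by simp
            then have "b = n * (2 * (k + 4 * a) - 4 * a)" using True kd by (simp add: algebra_simps)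
            then have "n dvd b" by (metis dvd_triv_left)
            have "b - 2 * y = 4 * n * (- a)" using bb True by linarith
            then have "4 * n dvd b - 2 * y" by (metis dvd_triv_left)
            have "b = 2 * n \<and> y = 3 * n"
            proof -
              have "n dvd b" by fact
              then have b4: "b = n \<or> b = 2 * n \<or> b = 3 * n" using h y by (intro dvd_cases) auto
              moreover have "b < y" using h by simp
              moreover have "b - 2 * y \<noteq> (-3) * n" "b - 2 * y \<noteq> (-5) * n"
                using \<open>4 * n dvd b - 2 * y\<close> dvd4[of n "-3"] dvd4[of n "-5"] n by auto
              ultimately show ?thesis using b3 True n by auto
            qed
            then have by': "b = 2 * n" "y = 3 * n" by auto
            have "(n, c + n) \<in> T" using tr[OF c0, of 1] by (simp add: algebra_simps)
            then show False using cross[of n "c + n"] h cx by' n y by simp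
          qed
        qed
      qed
    next
      case False
      then have "eqv n (1, y) (c, 4 * n)" using C' by simp
      then have "\<exists>l a. c = 1 + n * l \<and> 4 * n = y + n * l + 4 * n * a"
      proof (cases rule: eqvE)
        case (swap k a)
        then have "1 = n * (4 - k - 4 * a)" by (simp add: algebra_simps)
        then have "n dvd 1" by (metis dvd_triv_left)
        then show ?thesis using n by simp
      qed blast
      then obtain l a where l: "c = 1 + n * l" "4 * n = y + n * l + 4 * n * a" by blast
      have yd: "y = n * (4 - l - 4 * a)" using l by (simp add: algebra_simps)
      then have "n dvd y" by simp
      then have y3: "y = n \<or> y = 2 * n \<or> y = 3 * n" using h y x by (intro dvd_cases) auto
      have "n dvd c - 1" using l by simp
      then have c3: "c - 1 = n \<or> c - 1 = 2 * n \<or> c - 1 = 3 * n" using h y by (intro dvd_cases) auto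
      have "(c - 1) + y = 4 * n * (1 - a)" using l by (simp add: algebra_simps)
      then have "4 * n dvd (c - 1) + y" by (metis dvd_triv_left)
      then have cy: "c - 1 + y \<noteq> 3 * n" "c - 1 + y \<noteq> 5 * n"
        using dvd4[of n 3] dvd4[of n 5] n by auto
      \<comment> \<open>Both \<open>y\<close> and \<open>c - 1\<close> are among \<open>n\<close>,
        \<open>2 * n\<close>, \<open>3 * n\<close> and their sum is a multiple of
        \<open>4 * n\<close>; since \<open>c < y\<close>, one choice remains.\<close>
      have yc: "y = 3 * n" "c = n + 1"
        using y3 c3 h n cy by auto
      have "(n, 4 * n) \<in> T" using tr[OF y(1), of 1] yc by (simp add: algebra_simps)
      then have nT: "(0, n) \<in> T" using closed_shift[OF cl closed_swap[OF cl], of n "4 * n" "-4" 1] by simp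
      then have nx: "n \<le> x" using next'[of n] yc n by force
      show False using B'
      proof
        assume bT: "(b, b') \<in> T"
        show False
        proof (cases "b = x")
          case True
          then have "b = n" using h yc nx by simp
          then have "(0, b' - n) \<in> T" using tr[OF bT, of "-1"] by simp
          then show False using next'[of "b' - n"] h yc True \<open>b = n\<close> by simp
        next
          case False
          then show False using cross[OF bT] h yc nx by simp
        qed
      next
        assume "eqv n (1, y) (b, b')"
        then show False
        proof (cases rule: eqvE)
          case (direct k a)
          then have "n \<le> b - 1" using h by (intro zdvd_imp_le) auto
          then show False using h yc by simp
        next
          case (swap k a)
          have "n dvd b" using swap yc by simp
          then have "b = n" using dvd_cases[of n b] h yc n by auto
          have "n dvd b' - 1" using swap by (simp add: mult.assoc)
          then have "b' - 1 = 3 * n" using dvd_cases[of n "b' - 1"] h yc n by auto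
          then have "4 * n * a = 5 * n" using swap yc \<open>b = n\<close> by linarith
          then have "4 * n dvd 5 * n" by (metis dvd_triv_left)
          then show False using n dvd4[of n 5] by simp
        qed
      qed
    qed
  qed
  have "star n T 0 x y" unfolding star_def using x 0 y 1 by auto
  then show ?thesis by (rule that)
qed


text \<open>A chord violating one of these bounds would form a 3-crossing with two sides of the
  pentagram.\<close>

lemma star_neighbours:
  assumes T: "free n T" and st: "star n T v x y"
  shows "(v - 1, j) \<in> T \<Longrightarrow> v + 1 < j \<Longrightarrow> x \<le> j"
    and "(v, j) \<in> T \<Longrightarrow> j \<le> x \<or> y \<le> j"
    and "(v + 1, j) \<in> T \<Longrightarrow> j < v - 1 + 4 * n \<Longrightarrow> j \<le> y"
proof -
  show "x \<le> j" if "(v - 1, j) \<in> T" "v + 1 < j"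
    using free_hexa[OF T, of "v - 1" v "v + 1" j x y] st that unfolding hexa_def star_def by force
  show "j \<le> x \<or> y \<le> j" if "(v, j) \<in> T"
    using free_hexa[OF T, of "v - 1" v "v + 1" x j y] st that unfolding hexa_def star_def by force
  show "j \<le> y" if "(v + 1, j) \<in> T" "j < v - 1 + 4 * n"
    using free_hexa[OF T, of "v - 1" v "v + 1" x y j] st that unfolding hexa_def star_def by force
qed

section \<open>Translations and reflections of chord sets\<close>

definition transl :: "int \<Rightarrow> (int \<times> int) set \<Rightarrow> (int \<times> int) set" where
  "transl s E = {(i, j). (i + s, j + s) \<in> E}"

definition mirror :: "(int \<times> int) set \<Rightarrow> (int \<times> int) set" where
  "mirror E = {(i, j). (- i, - j) \<in> E}"

lemma mem_transl [simp]: "(i, j) \<in> transl s E \<longleftrightarrow> (i + s, j + s) \<in> E"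
  by (simp add: transl_def)

lemma mem_mirror [simp]: "(i, j) \<in> mirror E \<longleftrightarrow> (- i, - j) \<in> E"
  by (simp add: mirror_def)

lemma transl_transl [simp]: "transl s (transl t E) = transl (s + t) E"
  by (auto simp: transl_def add_ac)

lemma transl_0 [simp]: "transl 0 E = E" by (simp add: transl_def)

lemma mirror_mirror [simp]: "mirror (mirror E) = E" by (simp add: mirror_def)

lemma eqv_transl: "eqv n (i + s, j + s) (i' + s, j' + s) \<longleftrightarrow> eqv n (i, j) (i', j')"
  unfolding eqv_def by (simp add: algebra_simps)

lemma eqv_mirror: "eqv n (- i, - j) (- i', - j') \<longleftrightarrow> eqv n (i, j) (i', j')"
proof -
  have *: "eqv n (- i, - j) (- i', - j')" if "eqv n (i, j) (i', j')" for i j i' j'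
    using that
  proof (cases rule: eqvE)
    case (direct k a)
    then show ?thesis by (intro eqvI[of _ _ _ "- k" _ _ "- a"]) simp_all
  next
    case (swap k a)
    then show ?thesis by (intro eqvI'[of _ _ _ "- k" _ _ "- a"]) simp_all
  qed
  from *[of i j i' j'] *[of "- i" "- j" "- i'" "- j'"] show ?thesis by auto
qed

lemma free_transl: assumes "free n E" shows "free n (transl s E)"
proof -
  note cl = free_closed[OF assms]
  have "closed n (transl s E)"
  proof (rule closedI)
    fix i j k a assume "(i, j) \<in> transl s E"
    then show "(j, i) \<in> transl s E" "(i + n * k, j + n * k + 4 * n * a) \<in> transl s E"
      using closed_swap[OF cl] closed_shift[OF cl, of "i + s" "j + s" k a] by (simp_all add: algebra_simps)
  qed
  moreover have "transl s E \<subseteq> chords n" using free_chords[OF assms] by (auto simp: transl_def chords_def)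
  moreover have "\<not> hexa n (transl s E) a b c a' b' c'" for a b c a' b' c'
    using free_hexa[OF assms, of "a + s" "b + s" "c + s" "a' + s" "b' + s" "c' + s"]
    unfolding hexa_def by auto
  ultimately show ?thesis by (simp add: free_def)
qed

lemma free_mirror: assumes n: "n > 0" and E: "free n E" shows "free n (mirror E)"
proof -
  note cl = free_closed[OF E]
  have "closed n (mirror E)"
  proof (rule closedI)
    fix i j k a assume "(i, j) \<in> mirror E"
    then show "(j, i) \<in> mirror E" "(i + n * k, j + n * k + 4 * n * a) \<in> mirror E"
      using closed_swap[OF cl] closed_shift[OF cl, of "- i" "- j" "- k" "- a"] by simp_all
  qed
  moreover have "mirror E \<subseteq> chords n"
  proof
    fix c assume "c \<in> mirror E"
    moreover obtain i j where "c = (i, j)" by (cases c)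
    ultimately have "(- j, - i) \<in> chords n" using free_chords[OF E] closed_swap[OF cl] by auto
    then show "c \<in> chords n" using \<open>c = (i, j)\<close> by (simp add: chords_def)
  qed
  moreover have "\<not> hexa n (mirror E) a b c a' b' c'" for a b c a' b' c'
  proof
    assume h: "hexa n (mirror E) a b c a' b' c'"
    then have "hexa n E (- c') (- b') (- a') (- c) (- b) (- a)"
      unfolding hexa_def using closed_swap[OF cl] by auto
    then show False using free_hexa[OF E] by blast
  qed
  ultimately show ?thesis by (simp add: free_def)
qed

lemma facet_transl: assumes "facet n T" shows "facet n (transl s T)"
  unfolding facet_def
proof (intro conjI allI impI)
  show "free n (transl s T)" using assms by (simp add: free_transl facet_free)
  fix E assume E: "free n E \<and> transl s T \<subseteq> E"
  then have "T \<subseteq> transl (- s) E" by (force simp: transl_def)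
  then have "transl (- s) E = T" using facet_max[OF assms] free_transl E by blast
  then show "E = transl s T" by auto
qed

lemma facet_mirror: assumes "n > 0" "facet n T" shows "facet n (mirror T)"
  unfolding facet_def
proof (intro conjI allI impI)
  show "free n (mirror T)" using assms by (simp add: free_mirror facet_free)
  fix E assume E: "free n E \<and> mirror T \<subseteq> E"
  then have "T \<subseteq> mirror E" by (force simp: mirror_def)
  then have "mirror E = T" using facet_max[OF assms(2)] free_mirror assms(1) E by blast
  then show "E = mirror T" by auto
qed

lemma star_transl: "star n (transl s T) v x y \<longleftrightarrow> star n T (v + s) (x + s) (y + s)"
  unfolding star_def by (auto simp: algebra_simps)

text \<open>Reflection exchanges the first and the last ray of the ear; adding \<open>4 * n\<close>
  returns the corners to the turn that starts at \<open>- v\<close>.\<close>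

lemma star_mirror:
  assumes "closed n T" "star n T v x y" shows "star n (mirror T) (- v) (4 * n - y) (4 * n - x)"
proof -
  have "(i, j - 4 * n) \<in> T" if "(i, j) \<in> T" for i j
    using closed_shift[OF assms(1) that, of 0 "- 1"] by simp
  from this[of "v - 1" x] this[of v x] this[of v y] this[of "v + 1" y] show ?thesis
    using assms(2) unfolding star_def by (simp add: add.commute)
qed

lemma star_exists:
  assumes "n \<ge> 3" "facet n T" obtains x y where "star n T v x y"
proof -
  obtain x y where "star n (transl v T) 0 x y"
    using star_exists_aux[OF assms(1) facet_transl[OF assms(2)]] .
  then show ?thesis using that by (simp add: star_transl)
qed

section \<open>Contraction of an ear\<close>

lemma eqv_mod:
  assumes "eqv n (i, j) (u, w)"
  shows "(w - u) mod (4 * n) = (j - i) mod (4 * n) \<or> (w - u) mod (4 * n) = (i - j) mod (4 * n)"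
  using assms
proof (cases rule: eqvE)
  case (direct k a)
  then have "w - u = (j - i) + 4 * n * a" by simp
  then show ?thesis by (metis mod_mult_self2)
next
  case (swap k a)
  then have "w - u = (i - j) + 4 * n * a" by simp
  then show ?thesis by (metis mod_mult_self2)
qed

lemma minus_mod_pos:
  fixes d m :: int
  assumes "0 < d" "d < m" shows "(- d) mod m = m - d"
  using assms mod_flip[of d m] by simp

lemma mod_diff_shift: "(j + n * k + 4 * n * a - (i + n * k)) mod (4 * n) = (j - i) mod (4 * n)"
  for i j n k a :: int
proof -
  have "j + n * k + 4 * n * a - (i + n * k) = (j - i) + 4 * n * a" by simp
  then show ?thesis by (metis mod_mult_self2)
qed

text \<open>Renumbers the integers after the multiples of \<open>n\<close> have been removed; a multiple of \<open>n\<close> gets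
  the number of its predecessor.\<close>

definition theta :: "int \<Rightarrow> int \<Rightarrow> int" where
  "theta n i = i - i div n - 1"

lemma theta_shift: "n > 0 \<Longrightarrow> theta n (i + n * k) = theta n i + (n - 1) * k"
  by (simp add: theta_def algebra_simps)

lemma theta_Suc: assumes "n > 0"
  shows "theta n (i + 1) = (if n dvd i + 1 then theta n i else theta n i + 1)"
proof -
  have m: "0 \<le> i mod n" "i mod n < n" "i = n * (i div n) + i mod n" using assms by simp_all
  show ?thesis
  proof (cases "i mod n = n - 1")
    case True
    then have e: "i + 1 = n * (i div n + 1)" using m(3) unfolding distrib_left by linarith
    then have "(i + 1) div n = i div n + 1" using assms by (metis nonzero_mult_div_cancel_left less_irrefl)
    moreover have "n dvd i + 1" using e by simp
    ultimately show ?thesis by (simp add: theta_def)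
  next
    case False
    then have "0 < i mod n + 1" "i mod n + 1 < n" using m by simp_all
    then have e': "i + 1 = n * (i div n) + (i mod n + 1)" "0 \<le> i mod n + 1" "i mod n + 1 < n"
      using m by linarith+
    have "(i + 1) div n = i div n" "(i + 1) mod n = i mod n + 1"
      by (rule int_div_pos_eq[OF e'], rule int_mod_pos_eq[OF e'])
    then show ?thesis using m by (auto simp: theta_def dvd_eq_mod_eq_0)
  qed
qed

lemma theta_mono: assumes "n > 0" "i \<le> j" shows "theta n i \<le> theta n j"
  using assms(2)
proof (induct j rule: int_ge_induct)
  case (step j)
  then show ?case using theta_Suc[OF assms(1), of j] by (auto split: if_splits)
qed simp

lemma theta_diff_le: assumes "n > 0" "i \<le> j" shows "theta n j - theta n i \<le> j - i"
  using assms(2)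
proof (induct j rule: int_ge_induct)
  case (step j)
  then show ?case using theta_Suc[OF assms(1), of j] by (auto split: if_splits)
qed simp

lemma theta_surj: assumes "n \<ge> 2" obtains i where "theta n i = k" "\<not> n dvd i"
proof -
  define q r where "q = k div (n - 1)" and "r = k mod (n - 1)"
  have k: "k = q * (n - 1) + r" "0 \<le> r" "r < n - 1"
    unfolding q_def r_def using assms by (simp_all only: div_mult_mod_eq) simp_all
  have "(r + 1 + q * n) div n = q" "(r + 1 + q * n) mod n = r + 1" using k by simp_all
  then have "theta n (r + 1 + q * n) = k" "\<not> n dvd r + 1 + q * n"
    using k by (auto simp: theta_def algebra_simps dvd_eq_mod_eq_0)
  then show ?thesis by (rule that)
qed

lemma not_dvd_near:
  fixes n i :: int
  assumes "n \<ge> 3" "n dvd i" shows "\<not> n dvd i + 1" "\<not> n dvd i - 1" "\<not> n dvd i + 2" "\<not> n dvd i - 2"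
proof -
  have *: "\<not> n dvd 1" "\<not> n dvd 2" using assms(1) by (auto dest: zdvd_imp_le)
  show "\<not> n dvd i + 1" "\<not> n dvd i - 1" "\<not> n dvd i + 2" "\<not> n dvd i - 2"
    using * assms(2) by (simp_all add: dvd_add_right_iff dvd_diff_right_iff)
qed

lemma not_dvd_near':
  fixes n i :: int
  assumes "n \<ge> 3"
  shows "n dvd i + 1 \<Longrightarrow> \<not> n dvd i" "n dvd i - 1 \<Longrightarrow> \<not> n dvd i" "n dvd i + 1 \<Longrightarrow> \<not> n dvd i - 1"
    "n dvd i + 1 \<Longrightarrow> \<not> n dvd i + 2" "n dvd i - 1 \<Longrightarrow> \<not> n dvd i + 1" "n dvd i + 2 \<Longrightarrow> \<not> n dvd i + 1"
  using not_dvd_near(1,2)[OF assms, of i] not_dvd_near(4,1)[OF assms, of "i + 1"]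
    not_dvd_near(3)[OF assms, of "i - 1"] not_dvd_near(2)[OF assms, of "i + 2"]
  by (blast, blast, simp_all add: diff_add_eq[symmetric] add.assoc) fastforce+

text \<open>Only the numerical data of an ear are fixed here, not a chord set, so that a flip can
  instantiate the same maps with a different first ray.\<close>

locale flattening =
  fixes n x y :: int
  assumes n3: "n \<ge> 3" and x1: "1 < x" and xy: "x < y" and y4: "y < 4 * n - 1"
begin

text \<open>The new number of the end \<open>i\<close> of the chord \<open>(i, j)\<close>, for the ear with parameters \<open>x, y\<close> at
  the multiples of \<open>n\<close>.\<close>

definition kappa :: "int \<Rightarrow> int \<Rightarrow> int" where
  "kappa i j = theta n i + (if n dvd i \<and> x < (j - i) mod (4 * n) then 1 else 0)"

text \<open>The restriction that this ear imposes on the chord \<open>(i, j)\<close> at its end \<open>i\<close>.\<close>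

definition allowed :: "int \<Rightarrow> int \<Rightarrow> bool" where
  "allowed i j \<longleftrightarrow> (n dvd i + 1 \<longrightarrow> x + 1 \<le> (j - i) mod (4 * n)) \<and>
     (n dvd i - 1 \<longrightarrow> (j - i) mod (4 * n) \<le> y - 1) \<and>
     (n dvd i \<longrightarrow> (j - i) mod (4 * n) \<le> x \<or> y \<le> (j - i) mod (4 * n))"

definition key :: "int \<times> int \<Rightarrow> int \<times> int" where
  "key c = (kappa (fst c) (snd c), kappa (snd c) (fst c))"

text \<open>Taking every preimage that respects the ear at both ends makes the expansion of a
  contracted facet large enough to contain that facet.\<close>

definition lifts :: "(int \<times> int) set \<Rightarrow> (int \<times> int) set" where
  "lifts S = {c \<in> chords n. allowed (fst c) (snd c) \<and> allowed (snd c) (fst c) \<and> key c \<in> S}"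

text \<open>The chords (v - 1, v + 1): their ends become adjacent under contraction, so they are
  split off before and restored after.\<close>

definition ear :: "(int \<times> int) set" where
  "ear = orb n (- 1, 1)"

definition flat :: "(int \<times> int) set \<Rightarrow> (int \<times> int) set" where
  "flat T = key ` (T - ear)"

definition unflat :: "(int \<times> int) set \<Rightarrow> (int \<times> int) set" where
  "unflat S = lifts S \<union> ear"

lemma n0: "n > 0" "n \<ge> 2" "n \<noteq> 0" using n3 by simp_all

lemma dvd_shift: "n dvd i + n * k \<longleftrightarrow> n dvd i"
  by (simp add: dvd_add_left_iff)

lemma theta_step:
  "theta n (k + 1) = (if n dvd k + 1 then theta n k else theta n k + 1)"
  "theta n (k + 2) = (if n dvd k + 2 then theta n (k + 1) else theta n (k + 1) + 1)"
  "theta n (k + 3) = (if n dvd k + 3 then theta n (k + 2) else theta n (k + 2) + 1)"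
  using theta_Suc[OF n0(1), of k] theta_Suc[OF n0(1), of "k + 1"] theta_Suc[OF n0(1), of "k + 2"]
  by (simp_all add: add.assoc)

lemma kappa_shift: "kappa (i + n * k) (j + n * k + 4 * n * a) = kappa i j + (n - 1) * k"
  unfolding kappa_def mod_diff_shift theta_shift[OF n0(1)] dvd_shift by simp

lemma kappa_shift': "kappa (j + n * k + 4 * n * a) (i + n * k) = kappa j i + (n - 1) * k + 4 * (n - 1) * a"
  using kappa_shift[of j "k + 4 * a" i "- a"] by (simp add: algebra_simps)

lemma kappa_turn: "kappa (i + 4 * n) j = kappa i j + 4 * (n - 1)" "kappa i (j + 4 * n) = kappa i j"
  using kappa_shift'[of i 0 1 j] kappa_shift[of i 0 j 1] by simp_all

lemma allowed_shift: "allowed (i + n * k) (j + n * k + 4 * n * a) = allowed i j"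
proof -
  have "n dvd i + n * k + 1 \<longleftrightarrow> n dvd i + 1" "n dvd i + n * k - 1 \<longleftrightarrow> n dvd i - 1"
    using dvd_shift[of "i + 1" k] dvd_shift[of "i - 1" k] by (simp_all add: algebra_simps)
  then show ?thesis unfolding allowed_def mod_diff_shift dvd_shift by simp
qed

lemma allowed_shift': "allowed (j + n * k + 4 * n * a) (i + n * k) = allowed j i"
  using allowed_shift[of j "k + 4 * a" i "- a"] by (simp add: algebra_simps)

lemma key_eqv: assumes "eqv n c d" shows "eqv (n - 1) (key c) (key d)"
proof -
  obtain i j i' j' where cd: "c = (i, j)" "d = (i', j')" by (cases c; cases d) blast
  from assms have "eqv n (i, j) (i', j')" using cd by simp
  then show ?thesis
  proof (cases rule: eqvE)
    case (direct k a)
    then show ?thesis unfolding cd key_def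
      by (intro eqvI[of _ _ _ k _ _ a]) (simp_all add: kappa_shift kappa_shift')
  next
    case (swap k a)
    then show ?thesis unfolding cd key_def
      by (intro eqvI'[of _ _ _ k _ _ a]) (simp_all add: kappa_shift kappa_shift')
  qed
qed

lemma closed_lifts: assumes "closed (n - 1) S" shows "closed n (lifts S)"
proof -
  have "d \<in> lifts S" if "c \<in> lifts S" "eqv n c d" for c d
  proof -
    obtain i j i' j' where cd: "c = (i, j)" "d = (i', j')" by (cases c; cases d) blast
    have e: "eqv n (i, j) (i', j')" using that(2) cd by simp
    have "c \<in> chords n" using that(1) by (simp add: lifts_def)
    then have "d \<in> chords n" using closedD[OF closed_chords[OF n0(1)] _ that(2)] by blast
    moreover have "key d \<in> S" using closedD[OF assms _ key_eqv[OF that(2)]] that(1) by (simp add: lifts_def)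
    moreover have "allowed i' j' \<and> allowed j' i'"
      using e that(1) unfolding cd lifts_def
      by (cases rule: eqvE) (simp_all add: allowed_shift allowed_shift')
    ultimately show ?thesis by (simp add: lifts_def cd)
  qed
  then show ?thesis unfolding closed_def orb_def by blast
qed

lemma dmod: "i < j \<Longrightarrow> j < i + 4 * n \<Longrightarrow> (j - i) mod (4 * n) = j - i"
  "i < j \<Longrightarrow> j < i + 4 * n \<Longrightarrow> (i - j) mod (4 * n) = 4 * n - (j - i)"
  using minus_mod_pos[of "j - i" "4 * n"] by simp_all

text \<open>With v a multiple of \<open>n\<close>, an end at v can collide with v - 1 only if its
  chord ends by \<open>v + x\<close>, and with v + 1 only if its chord ends at or after
  \<open>v + y\<close>. The rule \<open>allowed\<close> keeps chords at v - 1 from ending before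
  \<open>v + x\<close> and chords at v + 1 from ending after \<open>v + y\<close>, so a collision
  contradicts \<open>j < j'\<close>.\<close>

lemma kappa_strict:
  assumes ij: "i < j" "j < i + 4 * n" and ij': "i' < j'" "j' < i' + 4 * n"
    and lt: "i < i'" "j < j'" and al: "allowed i j" "allowed i' j'"
  shows "kappa i j < kappa i' j'"
proof -
  note d = dmod(1)[OF ij] dmod(1)[OF ij']
  have ge: "theta n i' \<le> kappa i' j'" by (simp add: kappa_def)
  show ?thesis
  proof (cases "n dvd i \<and> x < j - i")
    case True
    then have hi: "y \<le> j - i" using al(1) d unfolding allowed_def by auto
    have nd: "\<not> n dvd i + 1" "\<not> n dvd i + 2" using not_dvd_near[OF n3] True by blast+
    have "i' \<noteq> i + 1"
    proof
      assume e: "i' = i + 1"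
      then have "j' - i' \<le> y - 1" using al(2) d True unfolding allowed_def by simp
      then show False using e lt hi by simp
    qed
    then have "theta n (i + 2) \<le> theta n i'" using lt by (intro theta_mono n0) simp
    moreover have "theta n (i + 2) = theta n i + 2"
      using theta_Suc[OF n0(1), of i] theta_Suc[OF n0(1), of "i + 1"] nd by (simp add: add.assoc)
    ultimately show ?thesis using ge True d by (simp add: kappa_def)
  next
    case False
    then have k: "kappa i j = theta n i" using d by (simp add: kappa_def)
    have m: "theta n (i + 1) \<le> theta n i'" using lt by (intro theta_mono n0) simp
    show ?thesis
    proof (cases "n dvd i + 1")
      case False
      then show ?thesis using k m ge theta_Suc[OF n0(1), of i] by simp
    next
      case True
      then have lo: "x + 1 \<le> j - i" using al(1) d unfolding allowed_def by simp
      show ?thesis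
      proof (cases "i' = i + 1")
        case e: True
        then have "x < j' - i'" using lo lt by simp
        then have "kappa i' j' = theta n i' + 1" using True e d by (simp add: kappa_def)
        then show ?thesis using k m theta_Suc[OF n0(1), of i] True by simp
      next
        case False
        then have "theta n (i + 2) \<le> theta n i'" using lt by (intro theta_mono n0) simp
        moreover have "\<not> n dvd i + 2" using not_dvd_near'(4)[OF n3 True] .
        ultimately show ?thesis using k ge theta_Suc[OF n0(1), of i] theta_Suc[OF n0(1), of "i + 1"] True by (simp add: add.assoc)
      qed
    qed
  qed
qed

lemma ear_mod: "(u, w) \<in> ear \<Longrightarrow> (w - u) mod (4 * n) = 2 \<or> (w - u) mod (4 * n) = 4 * n - 2"
  using eqv_mod[of n "-1" 1 u w] n3 minus_mod_pos[of 2 "4 * n"] unfolding ear_def by auto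

lemma ear_iff: "(u, w) \<in> ear \<longleftrightarrow> n dvd u + 1 \<and> (w - u) mod (4 * n) = 2 \<or> n dvd w + 1 \<and> (u - w) mod (4 * n) = 2"
proof
  assume "(u, w) \<in> ear"
  then have "eqv n (-1, 1) (u, w)" by (simp add: ear_def)
  then show "n dvd u + 1 \<and> (w - u) mod (4 * n) = 2 \<or> n dvd w + 1 \<and> (u - w) mod (4 * n) = 2"
  proof (cases rule: eqvE)
    case (direct k a)
    then have "w - u = 2 + 4 * n * a" "u + 1 = n * k" by simp_all
    moreover have "(2 + 4 * n * a) mod (4 * n) = 2" using n3 by simp
    ultimately show ?thesis by simp
  next
    case (swap k a)
    then have "u - w = 2 + 4 * n * (- a)" "w + 1 = n * (k + 4 * a)" by (simp_all add: algebra_simps)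
    moreover have "(2 + 4 * n * (- a)) mod (4 * n) = 2" using n3 mod_mult_self2[of 2 "4 * n" "- a"] by simp
    ultimately show ?thesis by (metis dvd_triv_left)
  qed
next
  have *: "eqv n (-1, 1) (u, w)" if "n dvd u + 1" "(w - u) mod (4 * n) = 2" for u w
  proof -
    obtain k where "u + 1 = n * k" using \<open>n dvd u + 1\<close> by blast
    moreover have "w - u = 2 + 4 * n * ((w - u) div (4 * n))"
      using that(2) by (metis add.commute mult_div_mod_eq)
    ultimately show ?thesis by (intro eqvI[of _ _ _ k _ _ "(w - u) div (4 * n)"]) linarith+
  qed
  assume "n dvd u + 1 \<and> (w - u) mod (4 * n) = 2 \<or> n dvd w + 1 \<and> (u - w) mod (4 * n) = 2"
  then have "eqv n (-1, 1) (u, w) \<or> eqv n (-1, 1) (w, u)" using * by blast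
  then show "(u, w) \<in> ear"
    using eqv_trans[OF _ eqv_swap, of n "(-1, 1)" w u] unfolding ear_def mem_orb by blast
qed

lemma ear_chords: "ear \<subseteq> chords n"
  using closedD[OF closed_chords[OF n0(1)] chordsI[of "-1" 1 n]] n3 by (auto simp: ear_def)

lemma hexa_ear: "hexa n E a b c a' b' c' \<Longrightarrow> (a, a') \<notin> ear \<and> (b, b') \<notin> ear \<and> (c, c') \<notin> ear"
  unfolding hexa_def using ear_mod[of a a'] ear_mod[of b b'] ear_mod[of c c']
  by (auto simp: dmod)

text \<open>Chords of the ear are too short to occur in a crossing, and by
  \<open>kappa_strict\<close> a crossing of the other chords would give one of
  \<open>S\<close>.\<close>

lemma free_unflat: assumes S: "free (n - 1) S" shows "free n (unflat S)"
proof -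
  have cl: "closed n (lifts S)" using S by (simp add: closed_lifts free_closed)
  have "\<not> hexa n (unflat S) a b c a' b' c'" for a b c a' b' c'
  proof
    assume "hexa n (unflat S) a b c a' b' c'"
    then have h: "hexa n (lifts S) a b c a' b' c'"
      using hexa_ear unfolding hexa_def unflat_def by blast
    have "hexa (n - 1) S (kappa a a') (kappa b b') (kappa c c') (kappa a' a) (kappa b' b) (kappa c' c)"
    proof (rule hexa_map[where m = kappa and n' = "n - 1", OF cl _ _ _ _ h])
      fix a b c a' b' c' assume h: "hexa n (lifts S) a b c a' b' c'"
      have "kappa c' (c + 4 * n) < kappa (a + 4 * n) (a' + 4 * n)"
      proof (rule kappa_strict)
        show "allowed c' (c + 4 * n)" "allowed (a + 4 * n) (a' + 4 * n)"
          using h allowed_shift[of c' 0 c 1] allowed_shift[of a 4 a' 0]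
          unfolding hexa_def lifts_def mult.commute[of n 4] by simp_all
      qed (use h in \<open>auto simp: hexa_def\<close>)
      then show "kappa c' c < kappa a a' + 4 * (n - 1)" by (simp add: kappa_turn)
    qed (auto simp: lifts_def key_def kappa_turn)
    then show False using free_hexa[OF S] by blast
  qed
  then show ?thesis using cl ear_chords by (auto simp: free_def unflat_def closed_Un ear_def lifts_def)
qed

end

section \<open>Lifting chords of the smaller polygon\<close>

context flattening
begin

lemma near: "n dvd i + 1 \<Longrightarrow> \<not> n dvd i - 1" "n dvd i + 1 \<Longrightarrow> \<not> n dvd i" "n dvd i \<Longrightarrow> \<not> n dvd i - 1"
   "n dvd i \<Longrightarrow> \<not> n dvd i + 1" "n dvd i - 1 \<Longrightarrow> \<not> n dvd i"
  using not_dvd_near'[OF n3, of i] by blast+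

lemma allowedI0: "n dvd i \<Longrightarrow> (j - i) mod (4 * n) \<le> x \<or> y \<le> (j - i) mod (4 * n) \<Longrightarrow> allowed i j"
  unfolding allowed_def using near(3,4)[of i] by blast

text \<open>The ends start at vertices that are not removed. An end at v - 1 or v + 1 that breaks
  its rule is pushed to v, where it keeps its number and satisfies the rule of v. If the rule at the
  other end then fails, that end is pushed in the same way.\<close>

lemma lift_aux:
  assumes nd: "\<not> n dvd i" "\<not> n dvd j" and ij: "i < j" "j < i + 4 * n"
    and th: "theta n i + 2 \<le> theta n j" "theta n j + 2 \<le> theta n i + 4 * (n - 1)"
    and na: "\<not> allowed i j"
  shows "\<exists>i' j'. (i', j') \<in> chords n \<and> allowed i' j' \<and> allowed j' i' \<and>
    kappa i' j' = theta n i \<and> kappa j' i' = theta n j"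
proof -
  note step = theta_step(1) and s2 = theta_step(2)
  have tj: "theta n (j - 1) = theta n j - 1" "theta n (i - 1) = theta n i - 1"
    using step[of "j - 1"] step[of "i - 1"] nd by simp_all
  \<comment> \<open>This would be a chord of the ear, whose ends get numbers only 1 apart;
    \<open>far'\<close> is the same exclusion seen from the other end.\<close>
  have far: "j \<noteq> i + 2" if "n dvd i + 1" using th step[of i] s2[of i] that by (auto split: if_splits)
  have far': "j \<noteq> i + 4 * n - 2" if "n dvd i - 1"
  proof
    assume "j = i + 4 * n - 2"
    moreover have "theta n (i + 4 * n) = theta n i + 4 * (n - 1)"
      using theta_shift[OF n0(1), of i 4] by (simp add: mult.commute)
    moreover have "n dvd i - 1 + n * 4" using that by (simp only: dvd_shift)
    then have "n dvd i + 4 * n - 1" by (simp add: algebra_simps)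
    ultimately show False using th step[of "i + 4 * n - 2"] step[of "i + 4 * n - 1"] by (auto split: if_splits)
  qed
  have ge2: "i + 2 \<le> j" "j + 2 \<le> i + 4 * n"
    using th theta_diff_le[OF n0(1), of i j] ij theta_diff_le[OF n0(1), of j "i + 4 * n"]
      theta_shift[OF n0(1), of i 4] by (simp_all add: mult.commute)
  have d: "(j - i) mod (4 * n) = j - i" using dmod(1)[OF ij] .
  from na consider "n dvd i + 1" "j - i \<le> x" | "n dvd i - 1" "y \<le> j - i"
    using nd unfolding allowed_def d by force
  then show ?thesis
  proof cases
    case 1
    have j3: "i + 3 \<le> j" using far[OF 1(1)] ge2 by simp
    have d1: "(j - (i + 1)) mod (4 * n) = j - i - 1" "(i + 1 - j) mod (4 * n) = 4 * n - (j - i - 1)"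
      using dmod[of "i + 1" j] j3 ij by simp_all
    have ki: "kappa (i + 1) j = theta n i" "allowed (i + 1) j"
      using 1 d1 step[of i] by (simp_all add: kappa_def allowedI0)
    show ?thesis
    proof (cases "allowed j (i + 1)")
      case True
      then show ?thesis using ki nd j3 ge2 chordsI[of "i + 1" j n]
        by (intro exI[of _ "i + 1"] exI[of _ j]) (simp add: kappa_def)
    next
      case False
      then consider "n dvd j + 1" "4 * n - (j - i - 1) \<le> x" | "n dvd j - 1" "y \<le> 4 * n - (j - i - 1)"
        using nd unfolding allowed_def d1 by force
      then show ?thesis
      proof cases
        case j1: 1
        have d2: "(j + 1 - (i + 1)) mod (4 * n) = j - i" "(i + 1 - (j + 1)) mod (4 * n) = 4 * n - (j - i)"
          using dmod[of "i + 1" "j + 1"] ij by simp_all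
        have "kappa (i + 1) (j + 1) = theta n i" "kappa (j + 1) (i + 1) = theta n j"
          using 1 j1 step[of i] step[of j] unfolding kappa_def d2 by simp_all
        moreover have "allowed (i + 1) (j + 1)" "allowed (j + 1) (i + 1)"
          using 1 j1 d2 by (auto intro!: allowedI0)
        ultimately show ?thesis using chordsI[of "i + 1" "j + 1" n] ge2 by auto
      next
        case j1: 2
        have d2: "(j - 1 - (i + 1)) mod (4 * n) = j - i - 2" "(i + 1 - (j - 1)) mod (4 * n) = 4 * n - (j - i - 2)"
          using dmod[of "i + 1" "j - 1"] ij j3 by simp_all
        \<comment> \<open>Both new ends are multiples of \<open>n\<close>, so they are at least
          \<open>n\<close> apart and still span a chord.\<close>
        have "n dvd j - 1 - (i + 1)" using 1(1) j1(1) by (rule dvd_diff[rotated])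
        then have "n \<le> j - 1 - (i + 1)" using j3 by (intro zdvd_imp_le) auto
        then have c: "(i + 1, j - 1) \<in> chords n" using n3 ge2 by (intro chordsI) auto
        have "x < 4 * n - (j - i - 2)" using j1 xy by simp
        then have "kappa (i + 1) (j - 1) = theta n i" "kappa (j - 1) (i + 1) = theta n j"
          using 1 j1 step[of i] tj unfolding kappa_def d2 by simp_all
        moreover have "allowed (i + 1) (j - 1)" "allowed (j - 1) (i + 1)"
          using 1 j1 d2 by (auto intro!: allowedI0)
        ultimately show ?thesis using c by blast
      qed
    qed
  next
    case 2
    have j3: "j + 3 \<le> i + 4 * n" using far'[OF 2(1)] ge2 by simp
    have d1: "(j - (i - 1)) mod (4 * n) = j - i + 1" "(i - 1 - j) mod (4 * n) = 4 * n - (j - i + 1)"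
      using dmod[of "i - 1" j] j3 ij by simp_all
    have ki: "kappa (i - 1) j = theta n i" "allowed (i - 1) j"
      using 2 d1 xy tj by (simp_all add: kappa_def allowedI0)
    show ?thesis
    proof (cases "allowed j (i - 1)")
      case True
      then show ?thesis using ki nd j3 ge2 chordsI[of "i - 1" j n]
        by (intro exI[of _ "i - 1"] exI[of _ j]) (simp add: kappa_def)
    next
      case False
      then consider "n dvd j + 1" "4 * n - (j - i + 1) \<le> x" | "n dvd j - 1" "y \<le> 4 * n - (j - i + 1)"
        using nd unfolding allowed_def d1 by force
      then show ?thesis
      proof cases
        case j1: 1
        have d2: "(j + 1 - (i - 1)) mod (4 * n) = j - i + 2" "(i - 1 - (j + 1)) mod (4 * n) = 4 * n - (j - i + 2)"
          using dmod[of "i - 1" "j + 1"] ij j3 by simp_all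
        have "n dvd i - 1 + n * 4 - (j + 1)" using 2(1) j1(1) dvd_shift[of "i - 1" 4] by (intro dvd_diff) simp_all
        then have "n \<le> i - 1 + n * 4 - (j + 1)" using j3 by (intro zdvd_imp_le) auto
        then have c: "(i - 1, j + 1) \<in> chords n" using n3 ge2 by (intro chordsI) auto
        have "kappa (i - 1) (j + 1) = theta n i" "kappa (j + 1) (i - 1) = theta n j"
          using 2 j1 xy tj step[of j] unfolding kappa_def d2 by simp_all
        moreover have "allowed (i - 1) (j + 1)" "allowed (j + 1) (i - 1)"
          using 2 j1 d2 by (auto intro!: allowedI0)
        ultimately show ?thesis using c by blast
      next
        case j1: 2
        have d2: "(j - 1 - (i - 1)) mod (4 * n) = j - i" "(i - 1 - (j - 1)) mod (4 * n) = 4 * n - (j - i)"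
          using dmod[of "i - 1" "j - 1"] ij by simp_all
        have "kappa (i - 1) (j - 1) = theta n i" "kappa (j - 1) (i - 1) = theta n j"
          using 2 j1 xy tj unfolding kappa_def d2 by simp_all
        moreover have "allowed (i - 1) (j - 1)" "allowed (j - 1) (i - 1)"
          using 2 j1 d2 by (auto intro!: allowedI0)
        ultimately show ?thesis using chordsI[of "i - 1" "j - 1" n] ge2 by auto
      qed
    qed
  qed
qed

lemma lift_exists:
  assumes e: "e \<in> chords (n - 1)"
  obtains c where "c \<in> chords n" "allowed (fst c) (snd c)" "allowed (snd c) (fst c)" "key c = e"
proof -
  obtain k1 k2 where k: "e = (k1, k2)" by (cases e)
  define N' where "N' = 4 * (n - 1)"
  define a where "a = (k2 - k1) div N'"
  define k2' where "k2' = k1 + (k2 - k1) mod N'"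
  have k2: "k2 = k2' + 4 * (n - 1) * a"
    unfolding k2'_def a_def N'_def by (simp add: minus_mult_div_eq_mod[symmetric])
  have kk: "k1 + 2 \<le> k2'" "k2' + 2 \<le> k1 + 4 * (n - 1)"
    using e unfolding k chords_def k2'_def N'_def by auto
  obtain i where i: "theta n i = k1" "\<not> n dvd i" using theta_surj[OF n0(2)] .
  obtain j where j: "theta n j = k2'" "\<not> n dvd j" using theta_surj[OF n0(2)] .
  have i4: "theta n (i + 4 * n) = k1 + 4 * (n - 1)" "\<not> n dvd i + 4 * n"
    using theta_shift[OF n0(1), of i 4] dvd_shift[of i 4] i by (simp_all add: mult.commute)
  have ij: "i < j" "j < i + 4 * n"
    using theta_mono[OF n0(1), of j i] theta_mono[OF n0(1), of "i + 4 * n" j] i j i4 kk by linarith+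
  have "\<exists>i' j'. (i', j') \<in> chords n \<and> allowed i' j' \<and> allowed j' i' \<and> kappa i' j' = k1 \<and> kappa j' i' = k2'"
  proof (cases "allowed i j")
    case ai: True
    show ?thesis
    proof (cases "allowed j i")
      case True
      have "(i, j) \<in> chords n"
        using theta_diff_le[OF n0(1), of i j] theta_diff_le[OF n0(1), of j "i + 4 * n"] i j i4 ij kk
        by (intro chordsI) linarith+
      then show ?thesis using ai True i j by (intro exI[of _ i] exI[of _ j]) (simp add: kappa_def)
    next
      case False
      \<comment> \<open>Only the rule at \<open>j\<close> fails, so \<open>lift_aux\<close> is
        applied to the chord read from \<open>j\<close>, and the result is turned back.\<close>
      have "\<not> allowed j (i + 4 * n)" using False allowed_shift[of j 0 i 1] by simp
      then obtain j' i' where "(j', i') \<in> chords n" "allowed j' i'" "allowed i' j'"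
        "kappa j' i' = k2'" "kappa i' j' = k1 + 4 * (n - 1)"
        using lift_aux[OF j(2) i4(2)] ij kk i4 j by auto
      moreover have "allowed (i' - 4 * n) j'" "allowed j' (i' - 4 * n)"
        using calculation(2,3) allowed_shift[of i' "-4" j' 1] allowed_shift[of j' 0 i' "-1"]
        by (simp_all add: algebra_simps)
      moreover have "kappa (i' - 4 * n) j' = k1" "kappa j' (i' - 4 * n) = k2'"
        using calculation(4,5) kappa_turn(1)[of "i' - 4 * n" j'] kappa_turn(2)[of j' "i' - 4 * n"] by simp_all
      moreover have "(i' - 4 * n, j') \<in> chords n"
        using closedD[OF closed_chords[OF n0(1)] \<open>(j', i') \<in> chords n\<close>]
          eqvI'[of "i' - 4 * n" i' n "-4" j' j' 1] by (simp add: algebra_simps)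
      ultimately show ?thesis by blast
    qed
  next
    case False
    then show ?thesis using lift_aux[OF i(2) j(2) ij _ _ False] kk i j by auto
  qed
  then obtain i' j' where c: "(i', j') \<in> chords n" "allowed i' j'" "allowed j' i'" "kappa i' j' = k1" "kappa j' i' = k2'"
    by blast
  show ?thesis
  proof (rule that[of "(i', j' + 4 * n * a)"])
    show "(i', j' + 4 * n * a) \<in> chords n"
      using closed_shift[OF closed_chords[OF n0(1)] c(1), of 0 a] by simp
    show "allowed (fst (i', j' + 4 * n * a)) (snd (i', j' + 4 * n * a))"
      "allowed (snd (i', j' + 4 * n * a)) (fst (i', j' + 4 * n * a))"
      using c allowed_shift[of i' 0 j' a] allowed_shift'[of j' 0 a i'] by simp_all
    show "key (i', j' + 4 * n * a) = e"
      using c kappa_shift[of i' 0 j' a] kappa_shift'[of j' 0 a i'] k k2 by (simp add: key_def)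
  qed
qed

lemma ear_not_allowed: "(i, j) \<in> ear \<Longrightarrow> \<not> (allowed i j \<and> allowed j i)"
  using x1 unfolding ear_iff allowed_def by auto

end

section \<open>Facets with a given ear at 0\<close>

locale flattened = flattening +
  fixes T
  assumes T: "facet n T" and st: "star n T 0 x y"
begin

lemmas fr = facet_free[OF T] and cl = facet_closed[OF T]

lemma T_chords: "T \<subseteq> chords n" using free_chords[OF fr] .

lemma mem_norm: assumes "(i, j) \<in> T" "n dvd i - v" shows "(v, v + (j - i) mod (4 * n)) \<in> T"
proof -
  obtain k where k: "i - v = n * k" using assms(2) by blast
  have "j - i = (j - i) mod (4 * n) + 4 * n * ((j - i) div (4 * n))" by simp
  then have "v + (j - i) mod (4 * n) = j + n * (- k) + 4 * n * (- ((j - i) div (4 * n)))"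
    using k by (simp add: algebra_simps)
  moreover have "v = i + n * (- k)" using k by simp
  ultimately show ?thesis
    using closed_shift[OF cl assms(1), of "- k" "- ((j - i) div (4 * n))"] by (simp only:)
qed

lemma T_allowed: assumes "(i, j) \<in> T - ear" shows "allowed i j"
proof -
  let ?d = "(j - i) mod (4 * n)"
  have c: "2 \<le> ?d" "?d \<le> 4 * n - 2" using assms T_chords by (auto simp: chords_def)
  have "x + 1 \<le> ?d" if "n dvd i + 1"
  proof -
    have "(-1, -1 + ?d) \<in> T" using mem_norm[of i j "-1"] assms that by simp
    moreover have "?d \<noteq> 2" using assms that by (auto simp: ear_iff)
    ultimately show ?thesis using star_neighbours(1)[OF fr st, of "-1 + ?d"] c by simp
  qed
  moreover have "?d \<le> y - 1" if "n dvd i - 1"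
  proof -
    have "(1, 1 + ?d) \<in> T" using mem_norm[of i j 1] assms that by simp
    \<comment> \<open>A chord of length \<open>4 * n - 2\<close> from v + 1 is the chord (v - 1, v +
      1) of the ear, read from its other end.\<close>
    moreover have "?d \<noteq> 4 * n - 2"
    proof
      assume e: "?d = 4 * n - 2"
      then have "(i - j) mod (4 * n) = 2" using mod_flip[of "j - i" "4 * n"] n3 by simp
      moreover have "n dvd j + 1"
      proof -
        have "j + 1 = (i - 1) + 4 * n * ((j - i) div (4 * n) + 1)"
          using mult_div_mod_eq[of "4 * n" "j - i"] e by (simp add: algebra_simps)
        then show ?thesis using that by (metis dvd_add dvd_mult dvd_mult2 dvd_triv_right mult.assoc)
      qed
      ultimately show False using assms by (auto simp: ear_iff)
    qed
    ultimately show ?thesis using star_neighbours(3)[OF fr st, of "1 + ?d"] c by simp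
  qed
  moreover have "?d \<le> x \<or> y \<le> ?d" if "n dvd i"
    using mem_norm[of i j 0] assms that star_neighbours(2)[OF fr st, of ?d] by simp
  ultimately show ?thesis unfolding allowed_def by blast
qed

lemma T_ear: "ear \<subseteq> T"
  using facet_boundary[OF n0(2) T, of "-1"] closedD[OF cl] unfolding ear_def by auto

lemma cl_ear: "closed n (T - ear)"
  using closed_Diff[OF cl] by (simp add: ear_def)

lemma T_swap: "(i, j) \<in> T - ear \<Longrightarrow> (j, i) \<in> T - ear"
  by (rule closed_swap[OF cl_ear])

lemma T_lifts: "T - ear \<subseteq> lifts (flat T)"
proof
  fix c assume c: "c \<in> T - ear"
  moreover obtain i j where "c = (i, j)" by (cases c)
  ultimately show "c \<in> lifts (flat T)"
    using T_allowed[of i j] T_allowed[OF T_swap, of i j] T_chords unfolding lifts_def flat_def by auto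
qed

lemma closed_flat: "closed (n - 1) (flat T)"
proof (rule closedI)
  fix k1 k2 assume "(k1, k2) \<in> flat T"
  then obtain i j where ij: "(i, j) \<in> T - ear" "k1 = kappa i j" "k2 = kappa j i"
    by (auto simp: flat_def key_def)
  then have "(j, i) \<in> T - ear" using T_swap by blast
  then have "key (j, i) \<in> flat T" unfolding flat_def by (rule imageI)
  then show "(k2, k1) \<in> flat T" using ij by (simp add: key_def)
  fix k a
  have "(i + n * k, j + n * k + 4 * n * a) \<in> T - ear"
    using closed_shift[OF cl_ear ij(1)] .
  then have "key (i + n * k, j + n * k + 4 * n * a) \<in> flat T" unfolding flat_def by (rule imageI)
  then show "(k1 + (n - 1) * k, k2 + (n - 1) * k + 4 * (n - 1) * a) \<in> flat T"
    using ij by (simp add: key_def kappa_shift kappa_shift')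
qed

text \<open>The numbering stalls only at multiples of \<open>n\<close>, so only very short chords
  could lose their gap. Those of length 2 that would do so belong to the ear; for the others the
  extra unit in \<open>kappa\<close> has to be tracked.\<close>

lemma key_gap: assumes ij: "i < j" "j < i + 4 * n" "(i, j) \<in> T - ear"
  shows "kappa i j + 2 \<le> kappa j i"
proof -
  note step = theta_step(1) and s2 = theta_step(2)
  have c: "i + 2 \<le> j" "j \<le> i + 4 * n - 2" using ij T_chords chords_iff[OF ij(1,2)] by auto
  note d = dmod[OF ij(1,2)]
  have ge: "theta n j \<le> kappa j i" by (simp add: kappa_def)
  have nd: "\<not> n dvd k + 1" "\<not> n dvd k + 2" if "n dvd k" for k using not_dvd_near[OF n3 that] by blast+
  show ?thesis
  proof (cases "j = i + 2")
    case True
    have "\<not> n dvd i + 1" using ij(3) d True by (auto simp: ear_iff)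
    moreover have "kappa i j = theta n i" using d True x1 by (simp add: kappa_def)
    moreover have "kappa j i = theta n j + 1" if "n dvd j"
      using that d True x1 xy y4 by (simp add: kappa_def)
    ultimately show ?thesis using ge True step[of i] s2[of i] by (auto split: if_splits)
  next
    case False
    have s3: "theta n (i + 1 + 1 + 1) \<le> theta n j" using c False by (intro theta_mono n0) simp
    show ?thesis
    proof (cases "n dvd i \<and> x < j - i")
      case no: False
      then have "kappa i j = theta n i" using d by (simp add: kappa_def)
      moreover have "theta n i + 2 \<le> theta n (i + 1 + 1 + 1)"
        using step[of i] step[of "i + 1"] step[of "i + 1 + 1"] nd[of "i + 1"] nd[of "i + 1 + 1"] by (auto simp: add.assoc)
      ultimately show ?thesis using s3 ge by simp
    next
      case hi: True
      then have k: "kappa i j = theta n i + 1" using d by (simp add: kappa_def)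
      have t2: "theta n (i + 1 + 1) = theta n i + 2"
        using step[of i] s2[of i] nd[of i] hi by (auto simp: add.assoc)
      show ?thesis
      proof (cases "n dvd i + 3")
        case False
        then have "theta n (i + 1 + 1 + 1) = theta n i + 3" using step[of "i + 1 + 1"] t2 by (simp add: add.assoc)
        then show ?thesis using s3 ge k by simp
      next
        \<comment> \<open>Here \<open>n\<close> divides \<open>i\<close> and \<open>i + 3\<close>,
          so \<open>n = 3\<close>. If \<open>j = i + 3\<close>, the end \<open>j\<close> is itself
          removed and its number gets the missing unit.\<close>
        case 3: True
        show ?thesis
        proof (cases "j = i + 3")
          case True
          have "x + 1 < y \<or> y \<le> 3" using hi T_allowed[OF ij(3)] d True unfolding allowed_def by auto
          have "kappa j i = theta n j + 1"
            using 3 d True T_allowed[OF ij(3)] hi x1 xy y4 n3 unfolding allowed_def kappa_def by auto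
          then show ?thesis using k t2 s3 step[of "i + 1 + 1"] 3 True by (simp add: add.assoc)
        next
          case ne: False
          have "theta n (i + 1 + 1 + 1 + 1) \<le> theta n j" using c ne False by (intro theta_mono n0) simp
          then show ?thesis using k t2 ge step[of "i + 1 + 1"] step[of "i + 1 + 1 + 1"] nd[of "i + 3"] 3
            by (simp add: add.assoc)
        qed
      qed
    qed
  qed
qed

lemma flat_chords: "flat T \<subseteq> chords (n - 1)"
proof
  fix e assume "e \<in> flat T"
  then obtain i j where ij: "(i, j) \<in> T - ear" "e = key (i, j)" unfolding flat_def by auto
  obtain j' where j': "i + 2 \<le> j'" "j' \<le> i + 4 * n - 2" "(i, j') \<in> T - ear" "eqv n (i, j) (i, j')"
    using chord_rep[OF n0(1) cl_ear ij(1)] T_chords by blast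
  have "kappa i j' + 2 \<le> kappa j' i" using j' by (intro key_gap) auto
  moreover have "(j', i + 4 * n) \<in> T - ear"
    using closed_turn[OF cl_ear j'(3)] .
  then have "kappa j' (i + 4 * n) + 2 \<le> kappa (i + 4 * n) j'" using j' by (intro key_gap) auto
  ultimately have "key (i, j') \<in> chords (n - 1)"
    unfolding key_def by (intro chordsI) (simp_all add: kappa_turn)
  then show "e \<in> chords (n - 1)"
    using ij(2) closedD[OF closed_chords _ key_eqv[OF eqv_sym[OF j'(4)]]] n3 by simp
qed

end

section \<open>Collisions of ends under the renumbering\<close>

context flattening
begin

lemma theta_vals: "theta n 0 = - 1" "theta n 1 = 0" "theta n (- 1) = - 1" "theta n (4 * n - 1) = 4 * (n - 1) - 1"
proof -
  show 0: "theta n 0 = - 1" by (simp add: theta_def)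
  have "\<not> n dvd 1" using n3 by (auto dest: zdvd_imp_le)
  then show "theta n 1 = 0" using theta_Suc[OF n0(1), of 0] 0 by simp
  show m: "theta n (- 1) = - 1" using theta_Suc[OF n0(1), of "- 1"] 0 by simp
  show "theta n (4 * n - 1) = 4 * (n - 1) - 1" using theta_shift[OF n0(1), of "-1" 4] m by (simp add: algebra_simps)
qed

lemma kappa_bounds: "theta n i \<le> kappa i j" "kappa i j \<le> theta n i + 1" "kappa i j \<le> theta n (i + 1)"
  using theta_Suc[OF n0(1), of i] near(4)[of i] theta_mono[OF n0(1), of i "i + 1"] by (auto simp: kappa_def)

lemma kappa_le: "kappa i j < kappa i' j' \<Longrightarrow> i \<le> i'"
  using kappa_bounds(1)[of i j] kappa_bounds(3)[of i' j'] theta_mono[OF n0(1), of "i' + 1" i] by force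

lemma kappa_eq:
  assumes "kappa i j = kappa i' j'" "i < i'"
  shows "i' = i + 1" "n dvd i' \<and> \<not> x < (j' - i') mod (4 * n) \<or> n dvd i \<and> x < (j - i) mod (4 * n)"
proof -
  note step = theta_step(1) and s2 = theta_step(2)
  have nd: "\<not> n dvd k + 1" "\<not> n dvd k + 2" if "n dvd k" for k using not_dvd_near[OF n3 that] by blast+
  show i': "i' = i + 1"
  proof (rule ccontr)
    assume "i' \<noteq> i + 1"
    then have "theta n (i + 2) \<le> theta n i'" using assms(2) by (intro theta_mono n0) simp
    then show False
      using assms(1) kappa_bounds(1)[of i' j'] step[of i] s2[of i] nd[of i] not_dvd_near'(4)[OF n3, of i]
      by (auto simp: kappa_def split: if_splits)
  qed
  show "n dvd i' \<and> \<not> x < (j' - i') mod (4 * n) \<or> n dvd i \<and> x < (j - i) mod (4 * n)"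
    using assms(1) step[of i] unfolding kappa_def i' by (auto split: if_splits)
qed

end

section \<open>The contraction of a facet is a facet\<close>

context flattened
begin

text \<open>A crossing of the contracted set whose lifts may have collided at a contracted vertex. Such a
  collision is removed by replacing the two colliding chords by two sides of the ear.\<close>

definition weak :: "int \<Rightarrow> int \<Rightarrow> int \<Rightarrow> int \<Rightarrow> int \<Rightarrow> int \<Rightarrow> bool" where
  "weak a b c a' b' c' \<longleftrightarrow> (a, a') \<in> T - ear \<and> (b, b') \<in> T - ear \<and> (c, c') \<in> T - ear \<and>
     a \<le> b \<and> b \<le> c \<and> c \<le> a' \<and> a' \<le> b' \<and> b' \<le> c' \<and> c' \<le> a + 4 * n \<and>
     kappa a a' < kappa b b' \<and> kappa b b' < kappa c c' \<and> kappa c c' < kappa a' a \<and>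
     kappa a' a < kappa b' b \<and> kappa b' b < kappa c' c \<and> kappa c' c < kappa a a' + 4 * (n - 1)"

lemma weak_turn: "weak a b c a' b' c' \<Longrightarrow> weak b c a' b' c' (a + 4 * n)"
  unfolding weak_def by (simp add: kappa_turn closed_turn[OF cl_ear] del: Diff_iff)

lemma weak_shift:
  assumes "weak a b c a' b' c'"
  shows "weak (a + n * k) (b + n * k) (c + n * k) (a' + n * k) (b' + n * k) (c' + n * k)"
proof -
  have "kappa (i + n * k) (j + n * k) = kappa i j + (n - 1) * k" for i j
    using kappa_shift[of i k j 0] by simp
  moreover have "(i + n * k, j + n * k) \<in> T - ear" if "(i, j) \<in> T - ear" for i j
    using closed_shift[OF cl_ear that, of k 0] by simp
  ultimately show ?thesis using assms unfolding weak_def by (simp del: Diff_iff)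
qed

lemma pos_of_chord: "(i, j) \<in> T \<Longrightarrow> i \<noteq> j" "(i, j) \<in> T \<Longrightarrow> j \<noteq> i + 4 * n"
proof -
  assume "(i, j) \<in> T"
  then have "2 \<le> (j - i) mod (4 * n)" using T_chords by (auto simp: chords_def)
  then show "i \<noteq> j" "j \<noteq> i + 4 * n" by auto
qed

lemma T_turn: "(i, j) \<in> T \<Longrightarrow> (j, i + 4 * n) \<in> T"
  by (rule closed_turn[OF cl])

lemma T_shift: "(i, j) \<in> T \<Longrightarrow> (i + n * k, j + n * k) \<in> T"
  using closed_shift[OF cl, of i j k 0] by simp

lemma star_at:
  assumes "n dvd w" shows "(w - 1, w + x) \<in> T" "(w, w + x) \<in> T" "(w, w + y) \<in> T" "(w + 1, w + y) \<in> T"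
proof -
  obtain k where k: "w = n * k" using assms by blast
  have s: "(-1, x) \<in> T" "(0, x) \<in> T" "(0, y) \<in> T" "(1, y) \<in> T" using st by (auto simp: star_def)
  show "(w - 1, w + x) \<in> T" "(w, w + x) \<in> T" "(w, w + y) \<in> T" "(w + 1, w + y) \<in> T"
    using T_shift[OF s(1), of k] T_shift[OF s(2), of k] T_shift[OF s(3), of k] T_shift[OF s(4), of k] k
    by (simp_all add: add.commute)
qed

lemma hexaI:
  assumes "a < b" "b < c" "c < a'" "a' < b'" "b' < c'" "c' < a + 4 * n"
    and "(a, a') \<in> T" "(b, b') \<in> T" "(c, c') \<in> T" shows False
  using free_hexa[OF fr, of a b c a' b' c'] assms unfolding hexa_def by blast

text \<open>The two chords at 0 lie on different sides of the ear: \<open>a' \<le> x\<close> and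
  \<open>y \<le> b'\<close>. Either \<open>(c, c')\<close> crosses the sides \<open>(-1, x)\<close>
  and \<open>(0, y)\<close> properly, or there is a second collision at \<open>x\<close> or at
  \<open>y\<close>. That corner is then a multiple of \<open>n\<close>, and the ear at that corner
  supplies the crossing.\<close>

lemma no_collision_0: assumes w: "weak 0 0 c a' b' c'" shows False
proof -
  have m: "(0, a') \<in> T" "(0, b') \<in> T" "(c, c') \<in> T" "allowed 0 b'" "(0, a') \<in> T - ear" "(0, b') \<in> T - ear"
    "(c, c') \<in> T - ear"
    and le: "0 \<le> c" "c \<le> a'" "a' \<le> b'" "b' \<le> c'" "c' \<le> 4 * n"
    and k: "kappa 0 a' < kappa 0 b'" "kappa 0 b' < kappa c c'" "kappa c c' < kappa a' 0"
     "kappa a' 0 < kappa b' 0" "kappa b' 0 < kappa c' c" "kappa c' c < kappa 0 a' + 4 * (n - 1)"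
    using w T_allowed unfolding weak_def by auto
  have a4: "0 < a'" "a' < 4 * n" "0 < b'" "b' < 4 * n"
    using le pos_of_chord[OF m(1)] pos_of_chord[OF m(2)] by auto
  have lo: "a' \<le> x" "x < b'" and k0: "kappa 0 b' = 0" "kappa 0 a' = - 1"
    using k(1) a4 theta_vals unfolding kappa_def by (auto split: if_splits)
  have hi: "y \<le> b'" using m(4) a4 lo unfolding allowed_def by auto
  have c2: "2 \<le> c"
  proof (rule ccontr)
    assume "\<not> 2 \<le> c"
    then have "c = 0 \<or> c = 1" using le by auto
    then show False using k(2) k0 theta_vals near(4)[of 0] unfolding kappa_def by (auto split: if_splits)
  qed
  have c'4: "c' \<le> 4 * n - 2"
    using k(6) k0 theta_vals kappa_bounds(1)[of c' c] theta_mono[OF n0(1), of "4 * n - 1" c'] by force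
  have s: "(-1, x) \<in> T" "(0, x) \<in> T" "(0, y) \<in> T" "(1, y) \<in> T" using st by (auto simp: star_def)
  consider "c < x" "y < c'" | "c = x" | "c < x" "c' = y" using le lo hi by linarith
  then show False
  proof cases
    case 1
    show False by (rule hexaI[of "-1" 0 c x y c']) (use 1 c2 c'4 x1 xy s m in auto)
  next
    case 2
    then have a': "a' = x" using le lo by simp
    have cx: "x < c'" "c' < x + 4 * n" using le 2 a' lo hi xy x1 c'4 by auto
    have dx: "n dvd x" "c' - x \<le> x" "x < 4 * n - x"
      using k(3) dmod[OF cx] dmod[of 0 x] a4 a' x1 unfolding 2 kappa_def by (auto split: if_splits)
    have al: "allowed x 0" using T_allowed[OF T_swap[OF m(5)]] a' by simp
    then have yx: "y \<le> 4 * n - x" using dx dmod[of 0 x] a4 a' unfolding allowed_def by auto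
    have x3: "x = n \<or> x = 2 * n \<or> x = 3 * n" using dvd_cases[OF dx(1)] a4 a' by simp
    show False
    \<comment> \<open>The two exceptional positions are those in which the hexagon built from the
      ear at \<open>x\<close> has coinciding corners; the case of the corner \<open>y\<close> below
      is organised in the same way.\<close>
    proof (cases "x + y = 4 * n")
      case True
      then show False using x3 xy le hi dx by auto
    next
      case sum: False
      show False
      proof (cases "b' = x + x")
        case True
        then have "c' = x + x" using le dx by simp
        then have "kappa (x + x) 0 < kappa (x + x) x" using k(5) True 2 by simp
        then have "\<not> x < 4 * n - (x + x)"
          using dmod[of 0 "x + x"] a4 True unfolding kappa_def by (auto split: if_splits)
        then show False using x3 dx n0 by auto
      next
        case False
        show False
          by (rule hexaI[of "x - 1" x b' "x + x" "x + y" "4 * n"])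
            (use False sum star_at[OF dx(1)] T_turn[OF m(2)] le lo hi dx yx xy x1 in auto)
      qed
    qed
  next
    case 3
    then have b': "b' = y" using le hi by simp
    have cy: "c < y" "y < c + 4 * n" using 3 xy c2 y4 by auto
    have dy: "n dvd y" "4 * n - y \<le> x" "x < 4 * n - (y - c)"
      using k(5) dmod[OF cy] dmod[of 0 y] a4 x1 unfolding 3 b' kappa_def by (auto split: if_splits)
    have "allowed y c" using T_allowed[OF T_swap[OF m(7)]] 3 by simp
    then have yc: "y \<le> 4 * n - (y - c)" using dy dmod[OF cy] unfolding allowed_def by auto
    have y3: "y = n \<or> y = 2 * n \<or> y = 3 * n" using dvd_cases[OF dy(1)] a4 b' by simp
    have "a' \<noteq> y - 1"
    proof
      assume "a' = y - 1"
      then have "theta n (y - 1) < theta n y"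
        using k(4) b' kappa_bounds(1)[of a' 0] dy dmod[of 0 y] a4 unfolding kappa_def by (auto split: if_splits)
      then show False using theta_Suc[OF n0(1), of "y - 1"] dy by simp
    qed
    then have a'y: "a' < y - 1" using lo xy by simp
    show False
    proof (cases "x + y = 4 * n")
      case True
      then show False using y3 xy 3 yc by auto
    next
      case sum: False
      show False
      proof (cases "y + y = 4 * n + a'")
        case True
        then have ca: "c = a'" using yc le by simp
        have "y = 3 * n" using y3 True a4 by auto
        then have a2: "a' = 2 * n" using True by simp
        have "kappa (2 * n) y < kappa (2 * n) 0" using k(3) 3 ca a2 by simp
        then have "x < 2 * n" using dmod[of 0 "2 * n"] n0 unfolding kappa_def by (auto split: if_splits)
        moreover have "allowed (2 * n) 0" using T_allowed[OF T_swap[OF m(5)]] a2 by simp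
        ultimately show False using dmod[of 0 "2 * n"] n0 \<open>y = 3 * n\<close> unfolding allowed_def by auto
      next
        case False
        show False
          by (rule hexaI[of "y - 1" y "4 * n" "y + x" "y + y" "4 * n + a'"])
            (use False sum star_at[OF dy(1)] T_shift[OF m(1), of 4] le a'y a4 b' dy yc xy x1
              in \<open>auto simp: algebra_simps\<close>)
      qed
    qed
  qed
qed

lemma no_collision: assumes w: "weak a b c a' b' c'" shows "a \<noteq> b"
proof
  assume e: "a = b"
  have "kappa a a' < kappa a b'" using w e unfolding weak_def by simp
  then have "n dvd a" unfolding kappa_def by (auto split: if_splits)
  then obtain k where k: "a = n * k" by blast
  show False using weak_shift[OF w, of "- k"] no_collision_0 e k by simp
qed

lemma free_flat: "free (n - 1) (flat T)"
proof -
  have "\<not> hexa (n - 1) (flat T) p q r p' q' r'" for p q r p' q' r'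
  proof
    assume h: "hexa (n - 1) (flat T) p q r p' q' r'"
    have ex: "\<exists>i j. (i, j) \<in> T - ear \<and> kappa i j = k1 \<and> kappa j i = k2" if "(k1, k2) \<in> flat T" for k1 k2
      using that unfolding flat_def key_def by fastforce
    obtain a a' where a: "(a, a') \<in> T - ear" "kappa a a' = p" "kappa a' a = p'"
      using ex h unfolding hexa_def by meson
    obtain b b' where b: "(b, b') \<in> T - ear" "kappa b b' = q" "kappa b' b = q'"
      using ex h unfolding hexa_def by meson
    obtain c c' where c: "(c, c') \<in> T - ear" "kappa c c' = r" "kappa c' c = r'"
      using ex h unfolding hexa_def by meson
    have lt: "kappa a a' < kappa b b'" "kappa b b' < kappa c c'" "kappa c c' < kappa a' a"
     "kappa a' a < kappa b' b" "kappa b' b < kappa c' c" "kappa c' c < kappa (a + 4 * n) a'"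
      using h a b c unfolding hexa_def kappa_turn by auto
    \<comment> \<open>Strictly ordered numbers give weakly ordered ends. Equality is then excluded
      at each of the six places by turning, which leaves a genuine crossing in
      \<open>T\<close>.\<close>
    have w: "weak a b c a' b' c'"
      unfolding weak_def using a b c lt lt[THEN kappa_le] by (simp add: kappa_turn del: Diff_iff)
    note w1 = weak_turn[OF w] note w2 = weak_turn[OF w1] note w3 = weak_turn[OF w2]
    note w4 = weak_turn[OF w3] note w5 = weak_turn[OF w4]
    show False
      by (rule hexaI[of a b c a' b' c'])
        (use w no_collision[OF w] no_collision[OF w1] no_collision[OF w2] no_collision[OF w3]
          no_collision[OF w4] no_collision[OF w5] in \<open>auto simp: weak_def\<close>)
  qed
  then show ?thesis using closed_flat flat_chords by (simp add: free_def)
qed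

text \<open>The expansion is free and contains \<open>T\<close>, so maximality of \<open>T\<close>
  gives equality.\<close>

lemma unflat_flat: "unflat (flat T) = T"
  by (rule facet_max[OF T free_unflat[OF free_flat]]) (use T_lifts in \<open>auto simp: unflat_def\<close>)

text \<open>A free set \<open>S\<close> above the contraction expands to a free set above
  \<open>T\<close>, hence to \<open>T\<close> itself. As each chord of \<open>S\<close> has a lift
  that obeys the ear, it is the contraction of a chord of \<open>T\<close>.\<close>

lemma facet_flat: "facet (n - 1) (flat T)"
  unfolding facet_def
proof (intro conjI allI impI free_flat)
  fix S assume S: "free (n - 1) S \<and> flat T \<subseteq> S"
  have "T \<subseteq> unflat S" using T_lifts S unfolding unflat_def lifts_def by blast
  then have U: "unflat S = T" using facet_max[OF T free_unflat] S by blast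
  have "e \<in> flat T" if "e \<in> S" for e
  proof -
    have "e \<in> chords (n - 1)" using free_chords S that by blast
    then obtain c where c: "c \<in> chords n" "allowed (fst c) (snd c)" "allowed (snd c) (fst c)" "key c = e"
      by (rule lift_exists)
    then have "c \<in> lifts S" using that by (simp add: lifts_def)
    then have "c \<in> T" using U unfolding unflat_def by blast
    moreover have "c \<notin> ear" using ear_not_allowed[of "fst c" "snd c"] c by auto
    ultimately show ?thesis using c(4) unfolding flat_def by blast
  qed
  then show "S = flat T" using S by blast
qed

end

section \<open>Orbits lost by the contraction\<close>

context flattened
begin

text \<open>The orbits of the two outer sides of the ear (\<open>Q\<close> is the other one).
  Contraction identifies each with the ray to the same corner, so they are left out of a system of
  representatives.\<close>

definition P where "P = orb n (- 1, x)"
definition Q where "Q = orb n (1, y)"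

lemma st': "(-1, x) \<in> T" "(0, x) \<in> T" "(0, y) \<in> T" "(1, y) \<in> T"
  using st by (auto simp: star_def)

lemma not_dvd_small: "\<not> n dvd 1" "\<not> n dvd 2" "\<not> n dvd - 1" "\<not> n dvd - 2"
  using n3 by (auto dest: zdvd_imp_le)

lemma clP: "closed n P" and clQ: "closed n Q"
  by (simp_all add: P_def Q_def)

text \<open>In this position the rays \<open>(0, n)\<close> and \<open>(0, 3 * n)\<close> lie in a
  single orbit; it is a leftover case of \<open>fibre_low\<close> and
  \<open>fibre_high\<close>.\<close>

lemma extra_hexa:
  assumes "x = n" "y = 3 * n" "(-1, n + 1) \<in> T" shows False
proof (rule hexaI[of "-1" 0 "n - 1" n "n + 1" "2 * n + 1"])
  show "(-1, n) \<in> T" using st' assms by simp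
  show "(0, n + 1) \<in> T"
    using closed_swap[OF cl closed_shift[OF cl st'(4), of 1 "-1"]] assms by (simp add: algebra_simps)
  show "(n - 1, 2 * n + 1) \<in> T" using T_shift[OF assms(3), of 1] by (simp add: algebra_simps)
qed (use n3 in auto)

text \<open>Treats a collision of the ends -1 and 0. If the far ends agree, the ear forces them to
  be \<open>x\<close>. Otherwise they are adjacent and collide as well, one of them being a multiple
  of \<open>n\<close>; the bounds of \<open>allowed\<close> then leave a pair of equivalent chords,
  an outer side of an ear, or the position of \<open>extra_hexa\<close>.\<close>

lemma fibre_low:
  assumes c: "(-1, j) \<in> T - ear" "(0, j') \<in> T - ear" and j: "-1 < j" "j < 4 * n - 1"
    and k: "\<not> x < (j' - 0) mod (4 * n)" "kappa j (- 1) = kappa j' 0"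
  shows "eqv n (-1, j) (0, j') \<or> (-1, j) \<in> P \<or> (-1, j) \<in> Q"
proof -
  have diff: "j' = j \<or> j = j' + 1 \<or> j' = j + 1"
    using kappa_eq(1)[OF k(2)] kappa_eq(1)[OF k(2)[symmetric]] by linarith
  have ch: "1 \<le> j" "j \<le> 4 * n - 3" using c T_chords chords_iff[of "-1" j n] j by auto
  have j': "0 < j'" "j' < 4 * n" using diff ch pos_of_chord[of 0 j'] c by auto
  have al: "x \<le> j" using T_allowed[OF c(1)] dmod(1)[of "-1" j] j unfolding allowed_def by simp
  have lo: "j' \<le> x" using k(1) j' by simp
  show ?thesis
  proof (cases "j = j'")
    case True
    then show ?thesis using al lo unfolding P_def by simp
  next
    case False
    then have jj: "j = j' + 1" using diff al lo by auto
    have dj: "(-1 - j) mod (4 * n) = 4 * n - 1 - j" "(0 - j') mod (4 * n) = 4 * n - j'"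
      using dmod(2)[of "-1" j] dmod(2)[of 0 j'] j j' by simp_all
    have al': "allowed j (-1)" "allowed j' 0" using T_allowed[OF T_swap] c by blast+
    from kappa_eq(2)[OF k(2)[symmetric]] jj
    consider "n dvd j" "4 * n - 1 - j \<le> x" | "n dvd j'" "x < 4 * n - j'"
      using dj by fastforce
    then show ?thesis
    proof cases
      case 1
      have "x + 1 \<le> 4 * n - j'" using al'(2) 1 jj unfolding allowed_def dj by simp
      then have "j = 2 * n" using 1 al lo jj by linarith
      then show ?thesis
        using eqvI'[of 0 j n "-2" j' "-1" 1] jj by simp
    next
      case 2
      have h: "y \<le> 4 * n - j'" using al'(2) 2 unfolding allowed_def dj by auto
      have h': "4 * n - 1 - j \<le> y - 1" using al'(1) 2 jj unfolding allowed_def dj by simp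
      have "j' = n \<or> j' = 2 * n \<or> j' = 3 * n" using dvd_cases[OF 2(1) j'] .
      then have jn: "j' = n" using h xy lo n0(1) by auto
      consider "x = j" | "x = n" "y = 3 * n - 1" | "x = n" "y = 3 * n"
        using h h' al lo jj jn by linarith
      then show ?thesis
      proof cases
        case 1 then show ?thesis unfolding P_def by simp
      next
        case 2
        then show ?thesis using eqvI'[of "-1" y n "-3" j 1 1] jj jn unfolding Q_def by simp
      next
        case 3
        then show ?thesis using extra_hexa c jj jn by auto
      qed
    qed
  qed
qed

text \<open>Counterpart for a collision of the ends 0 and 1, with \<open>Q\<close> in place of
  \<open>P\<close> when the far ends agree. It is argued directly, since the threshold in
  \<open>kappa\<close> is \<open>x\<close> on both sides.\<close>

lemma fibre_high:
  assumes c: "(0, j) \<in> T - ear" "(1, j') \<in> T - ear" and j: "0 < j" "j < 4 * n"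
    and k: "x < (j - 0) mod (4 * n)" "kappa j 0 = kappa j' 1"
  shows "eqv n (0, j) (1, j') \<or> (1, j') \<in> P \<or> (1, j') \<in> Q"
proof -
  have diff: "j' = j \<or> j = j' + 1 \<or> j' = j + 1"
    using kappa_eq(1)[OF k(2)] kappa_eq(1)[OF k(2)[symmetric]] by linarith
  have ch: "2 \<le> j" "j \<le> 4 * n - 2" using c T_chords chords_iff[of 0 j n] j by auto
  have j': "1 < j'" "j' < 4 * n" using diff ch pos_of_chord[of 1 j'] c by auto
  have al: "y \<le> j" using T_allowed[OF c(1)] k(1) j unfolding allowed_def by auto
  have lo: "j' \<le> y" using T_allowed[OF c(2)] dmod(1)[of 1 j'] j' unfolding allowed_def by auto
  show ?thesis
  proof (cases "j = j'")
    case True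
    then show ?thesis using al lo unfolding Q_def by simp
  next
    case False
    then have jj: "j = j' + 1" using diff al lo by auto
    have dj: "(0 - j) mod (4 * n) = 4 * n - j" "(1 - j') mod (4 * n) = 4 * n + 1 - j'"
      using dmod(2)[of 0 j] dmod(2)[of 1 j'] j j' by simp_all
    have al': "allowed j 0" "allowed j' 1" using T_allowed[OF T_swap] c by blast+
    from kappa_eq(2)[OF k(2)[symmetric]] jj
    consider "n dvd j" "4 * n - j \<le> x" | "n dvd j'" "x < 4 * n + 1 - j'"
      using dj by fastforce
    then show ?thesis
    proof cases
      case 1
      have h: "x + 1 \<le> 4 * n + 1 - j'" using al'(2) 1 jj unfolding allowed_def dj by simp
      have "j = n \<or> j = 2 * n \<or> j = 3 * n" using dvd_cases[OF 1(1) j] .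
      then have jn: "j = 3 * n" using 1 h xy lo al jj n0(1) by auto
      consider "y = j'" | "x = n + 1" "y = 3 * n" | "x = n" "y = 3 * n"
        using h 1 al lo jj jn by linarith
      then show ?thesis
      proof cases
        case 1 then show ?thesis unfolding Q_def by simp
      next
        case 2
        then show ?thesis using eqvI'[of 1 x n "-1" j' "-1" 1] jj jn unfolding P_def by simp
      next
        case 3
        have "(-1, n + 1) \<in> T"
          using closed_swap[OF cl closed_shift[OF cl, of 1 j' "1" "-1"]] c(2) jj jn by (simp add: algebra_simps)
        then show ?thesis using extra_hexa 3 by auto
      qed
    next
      case 2
      have h: "y \<le> 4 * n + 1 - j'" using al'(2) 2 unfolding allowed_def dj by auto
      have h': "4 * n - j \<le> y - 1" using al'(1) 2 jj unfolding allowed_def dj by simp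
      then have "j' = 2 * n" using h al lo jj by linarith
      then show ?thesis
        using eqvI'[of 1 j n "-2" j' 0 1] jj by simp
    qed
  qed
qed

text \<open>Colliding ends are consecutive and one of them is a multiple of \<open>n\<close>, so a
  rotation moves them to -1, 0 or to 0, 1; a number of full turns then brings \<open>j\<close> into
  the window after its partner.\<close>

lemma fibre_first:
  assumes c: "(i, j) \<in> T - ear" "(i', j') \<in> T - ear" "i < i'"
    and k: "kappa i j = kappa i' j'" "kappa j i = kappa j' i'"
  shows "eqv n (i, j) (i', j') \<or> (i, j) \<in> P \<union> Q \<or> (i', j') \<in> P \<union> Q"
proof -
  note ke = kappa_eq[OF k(1) c(3)]
  define v where "v = (if n dvd i' \<and> \<not> x < (j' - i') mod (4 * n) then - 1 else 0 :: int)"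
  have "n dvd i - v" using ke unfolding v_def by auto
  then obtain l where l: "i = v + n * l" by (metis add.commute diff_add_cancel dvdE)
  define a where "a = (j - i) div (4 * n)"
  let ?j = "j + n * (- l) + 4 * n * (- a)" and ?j' = "j' + n * (- l) + 4 * n * (- a)"
  have iv: "i + n * (- l) = v" "i' + n * (- l) = v + 1" using l ke by simp_all
  have jv: "?j - v = (j - i) mod (4 * n)"
    using mult_div_mod_eq[of "4 * n" "j - i"] l unfolding a_def by (simp add: algebra_simps)
  have ch: "2 \<le> (j - i) mod (4 * n)" "(j - i) mod (4 * n) \<le> 4 * n - 2"
    using c(1) T_chords by (auto simp: chords_def)
  have m: "(v, ?j) \<in> T - ear" "(v + 1, ?j') \<in> T - ear"
    using closed_shift[OF cl_ear c(1), of "- l" "- a"] closed_shift[OF cl_ear c(2), of "- l" "- a"]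
    unfolding iv .
  have e: "eqv n (i, j) (v, ?j)" "eqv n (i', j') (v + 1, ?j')"
    using eqv_shift[of n i j "- l" "- a"] eqv_shift[of n i' j' "- l" "- a"] unfolding iv .
  have kv: "kappa ?j v = kappa ?j' (v + 1)"
    using kappa_shift'[of j "- l" "- a" i] kappa_shift'[of j' "- l" "- a" i'] k(2) unfolding iv by simp
  have d: "(?j - v) mod (4 * n) = (j - i) mod (4 * n)" "(?j' - (v + 1)) mod (4 * n) = (j' - i') mod (4 * n)"
    using mod_diff_shift[of j n "- l" "- a" i] mod_diff_shift[of j' n "- l" "- a" i'] unfolding iv .
  have "eqv n (v, ?j) (v + 1, ?j') \<or> (v, ?j) \<in> P \<union> Q \<or> (v + 1, ?j') \<in> P \<union> Q"
  proof (cases "n dvd i' \<and> \<not> x < (j' - i') mod (4 * n)")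
    case True
    then have v: "v = - 1" by (simp add: v_def)
    show ?thesis
      using fibre_low[of ?j ?j'] m kv d(2) True jv ch unfolding v by auto
  next
    case False
    then have v: "v = 0" by (simp add: v_def)
    have "x < (?j - 0) mod (4 * n)" using ke False d(1) unfolding v by auto
    then show ?thesis
      using fibre_high[of ?j ?j'] m kv jv ch unfolding v by auto
  qed
  then show ?thesis
    using e closed_iff[OF closed_Un[OF clP clQ]] eqv_trans eqv_sym by meson
qed

lemma fibre:
  assumes "c \<in> T - ear" "d \<in> T - ear" "key c = key d"
  shows "eqv n c d \<or> c \<in> P \<union> Q \<or> d \<in> P \<union> Q"
proof -
  obtain i j i' j' where cd: "c = (i, j)" "d = (i', j')" by (cases c; cases d) blast
  have k: "kappa i j = kappa i' j'" "kappa j i = kappa j' i'" using assms(3) cd by (simp_all add: key_def)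
  have m: "(i, j) \<in> T - ear" "(i', j') \<in> T - ear" using assms unfolding cd by blast+
  note m = m T_swap[OF m(1)] T_swap[OF m(2)]
  have sw: "(j, i) \<in> P \<union> Q \<longleftrightarrow> (i, j) \<in> P \<union> Q" "(j', i') \<in> P \<union> Q \<longleftrightarrow> (i', j') \<in> P \<union> Q"
    by (rule closed_iff[OF closed_Un[OF clP clQ] eqv_swap])+
  have sw': "eqv n (j, i) (j', i') \<Longrightarrow> eqv n (i, j) (i', j')"
    by (rule eqv_trans[OF eqv_trans[OF eqv_swap _] eqv_swap])
  consider "i = i'" "j = j'" | "i < i'" | "i' < i" | "j < j'" | "j' < j" by linarith
  then show ?thesis unfolding cd
  proof cases
    case 2 then show "eqv n (i, j) (i', j') \<or> (i, j) \<in> P \<union> Q \<or> (i', j') \<in> P \<union> Q"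
      using fibre_first[OF m(1,2)] k by blast
  next
    case 3 then show "eqv n (i, j) (i', j') \<or> (i, j) \<in> P \<union> Q \<or> (i', j') \<in> P \<union> Q"
      using fibre_first[OF m(2,1)] k eqv_sym by metis
  next
    case 4 then show "eqv n (i, j) (i', j') \<or> (i, j) \<in> P \<union> Q \<or> (i', j') \<in> P \<union> Q"
      using fibre_first[OF m(3,4)] k sw sw' by metis
  next
    case 5 then show "eqv n (i, j) (i', j') \<or> (i, j) \<in> P \<union> Q \<or> (i', j') \<in> P \<union> Q"
      using fibre_first[OF m(4,3)] k sw sw' eqv_sym by metis
  qed simp
qed

text \<open>An equivalence between keys lifts to one between chords, so \<open>c\<close> can be
  replaced by an equivalent chord with exactly the key of \<open>d\<close>; then
  \<open>fibre\<close> applies.\<close>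

lemma key_inj:
  assumes "c \<in> T - ear - P - Q" "d \<in> T - ear - P - Q" "eqv (n - 1) (key c) (key d)"
  shows "eqv n c d"
proof -
  obtain i j where c: "c = (i, j)" by (cases c)
  have cl0: "closed n (T - ear - P - Q)" using cl_ear clP clQ by (simp add: closed_Diff)
  obtain c' where c': "eqv n c c'" "key c' = key d"
  proof -
    have "eqv (n - 1) (kappa i j, kappa j i) (fst (key d), snd (key d))"
      using assms(3) unfolding c key_def by simp
    then show ?thesis
    proof (cases rule: eqvE)
      case (direct k a)
      show ?thesis by (rule that[of "(i + n * k, j + n * k + 4 * n * a)"])
          (use direct in \<open>simp_all add: c key_def kappa_shift kappa_shift'\<close>)
    next
      case (swap k a)
      show ?thesis
      proof (rule that[of "(j + n * k, i + n * k + 4 * n * a)"])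
        show "eqv n c (j + n * k, i + n * k + 4 * n * a)" unfolding c by (rule eqvI') simp_all
      qed (use swap in \<open>simp add: key_def kappa_shift kappa_shift' prod_eq_iff\<close>)
    qed
  qed
  have "c' \<in> T - ear - P - Q" using closedD[OF cl0 assms(1) c'(1)] .
  then have "eqv n c' d" using fibre[of c' d] assms(2) c'(2) by blast
  then show ?thesis using eqv_trans c'(1) by blast
qed

lemma x_range: "2 \<le> x" "x \<le> 4 * n - 3" "y \<le> 4 * n - 2"
  using x1 xy y4 by simp_all

lemma P_facts: "(-1, x) \<in> P" "(0, x) \<notin> P" "(0, y) \<in> P \<Longrightarrow> n dvd y + 1 \<and> n dvd x" "(-1, x) \<notin> ear" "(0, x) \<notin> ear"
proof -
  show "(-1, x) \<in> P" by (simp add: P_def)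
  show "(0, x) \<notin> P"
    using eqv_class'[of n "-1" x 0 x] not_dvd_small near(2)[of x] by (auto simp: P_def)
  show "n dvd y + 1 \<and> n dvd x" if "(0, y) \<in> P"
    using that eqv_class'[of n "-1" x 0 y] not_dvd_small by (auto simp: P_def)
  show "(-1, x) \<notin> ear"
  proof
    assume "(-1, x) \<in> ear"
    then have "n dvd x + 1 \<and> (4 * n - (x - (- 1))) = 2"
      using dmod[of "-1" x] x_range x1 unfolding ear_iff by auto
    then have "n dvd 4 * n - 2" by (simp add: algebra_simps)
    then show False using not_dvd_small by (simp add: dvd_diff_right_iff)
  qed
  show "(0, x) \<notin> ear"
    using dmod[of 0 x] x_range not_dvd_small unfolding ear_iff by auto
qed

lemma Q_facts: "(1, y) \<in> Q" "(0, y) \<notin> Q" "(0, x) \<in> Q \<Longrightarrow> n dvd x - 1 \<and> n dvd y" "(1, y) \<notin> ear" "(0, y) \<notin> ear"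
proof -
  show "(1, y) \<in> Q" by (simp add: Q_def)
  show "(0, y) \<notin> Q"
    using eqv_class'[of n 1 y 0 y] not_dvd_small near(5)[of y] by (auto simp: Q_def)
  show "n dvd x - 1 \<and> n dvd y" if "(0, x) \<in> Q"
    using that eqv_class'[of n 1 y 0 x] not_dvd_small by (auto simp: Q_def)
  show "(1, y) \<notin> ear"
    using dmod[of 1 y] x_range xy x1 not_dvd_small unfolding ear_iff by auto
  show "(0, y) \<notin> ear"
  proof
    assume "(0, y) \<in> ear"
    then have "n dvd y + 1 \<and> (4 * n - y) = 2"
      using dmod[of 0 y] x_range xy x1 not_dvd_small unfolding ear_iff by auto
    then have "n dvd 4 * n - 1" by (simp add: algebra_simps)
    then show False using not_dvd_small by (simp add: dvd_diff_right_iff)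
  qed
qed

lemma P_Q_disjoint: "(-1, x) \<notin> Q"
proof
  assume "(-1, x) \<in> Q"
  then have "eqv n (1, y) (-1, x)" by (simp add: Q_def)
  then show False
  proof (cases rule: eqvE)
    case (direct k a)
    then have "- 2 = n * k" by simp
    then show False using not_dvd_small(4) by (metis dvd_triv_left)
  next
    case (swap k a)
    have y1: "y + 1 = n * (- k)" using swap by simp
    have x1': "x - 1 = n * (k + 4 * a)" using swap by (simp add: algebra_simps)
    have sum: "(x - 1) + (y + 1) = 4 * n * a" using swap by simp
    have d: "n dvd y + 1" "n dvd x - 1" using y1 x1' by simp_all
    have "y + 1 = n \<or> y + 1 = 2 * n \<or> y + 1 = 3 * n"
      by (rule dvd_cases[OF d(1)]) (use x_range xy in linarith)+
    moreover have "x - 1 = n \<or> x - 1 = 2 * n \<or> x - 1 = 3 * n"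
      by (rule dvd_cases[OF d(2)]) (use x_range in linarith)+
    moreover have "4 * n dvd (x - 1) + (y + 1)" using sum by simp
    then have "(x - 1) + (y + 1) \<noteq> 3 * n" "(x - 1) + (y + 1) \<noteq> 5 * n"
      using dvd4[of n 3] dvd4[of n 5] n0 by auto
    ultimately have xy': "x = n + 1" "y = 3 * n - 1" using xy n0 by linarith+
    \<comment> \<open>In the one remaining position a rotation of the ray \<open>(0, y)\<close> is a
      neighbour of -1 that comes before \<open>x = n + 1\<close>.\<close>
    have "(-1, n) \<in> T"
      using closed_swap[OF cl closed_shift[OF cl st'(3), of 1 "-1"]] xy' by (simp add: algebra_simps)
    then show False using star_neighbours(1)[OF fr st, of n] xy' n3 by simp
  qed
qed

lemma key_merge: "key (-1, x) = key (0, x)" "key (1, y) = key (0, y)"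
proof -
  have r: "0 < x" "x < 4 * n - 1" "0 < y" "1 < y" "y < 4 * n" using x_range xy by auto
  have "kappa (-1) x = kappa 0 x" using r theta_vals near(2)[of "-1"] unfolding kappa_def by simp
  moreover have "kappa x (-1) = kappa x 0"
    using dmod(2)[of "-1" x] dmod(2)[of 0 x] r unfolding kappa_def by simp
  ultimately show "key (-1, x) = key (0, x)" by (simp add: key_def)
  have "kappa 1 y = kappa 0 y" using r theta_vals not_dvd_small xy unfolding kappa_def by simp
  moreover have "kappa y 1 = kappa y 0"
  proof -
    \<comment> \<open>The numbers of the far end differ only if the threshold falls between the two
      chords, that is if \<open>4 * n - y = x\<close>. The rule at \<open>y\<close> then gives
      \<open>y \<le> x + 1\<close>, so \<open>y = x + 1\<close>, and \<open>x + y = 4 * n\<close>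
      fails by parity.\<close>
    have "4 * n - y \<noteq> x" if "n dvd y"
    proof
      assume e: "4 * n - y = x"
      have "allowed y 1" using T_allowed[OF T_swap[of 1 y]] st'(4) Q_facts by simp
      then have "y \<le> x + 1" using that dmod(2)[of 1 y] r e unfolding allowed_def by auto
      then show False using e xy by presburger
    qed
    then show ?thesis
      using dmod(2)[of 1 y] dmod(2)[of 0 y] r unfolding kappa_def by auto
  qed
  ultimately show "key (1, y) = key (0, y)" by (simp add: key_def)
qed

text \<open>A ray may be a rotation of the outer side that belongs to the other ray. The residues
  modulo \<open>n\<close> show that this cannot happen to both rays, so one of them always
  represents the merged class.\<close>

lemma core_x: "(0, x) \<in> T - ear - P - Q \<or> (0, x) \<in> Q \<and> (0, y) \<in> T - ear - P - Q"
  and core_y: "(0, y) \<in> T - ear - P - Q \<or> (0, y) \<in> P \<and> (0, x) \<in> T - ear - P - Q"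
proof -
  have "\<not> ((0, x) \<in> Q \<and> (0, y) \<in> P)"
    using P_facts(3) Q_facts(3) near(3)[of x] by blast
  then show "(0, x) \<in> T - ear - P - Q \<or> (0, x) \<in> Q \<and> (0, y) \<in> T - ear - P - Q"
    "(0, y) \<in> T - ear - P - Q \<or> (0, y) \<in> P \<and> (0, x) \<in> T - ear - P - Q"
    using P_facts Q_facts st' by auto
qed

lemma key_core:
  assumes "c \<in> T - ear"
  obtains d where "d \<in> T - ear - P - Q" "eqv (n - 1) (key c) (key d)"
    "c = d \<or> d = (0, x) \<or> d = (0, y)"
proof -
  have PQ: "eqv (n - 1) (key e) (key (0, x))" if "e \<in> P" for e
    using key_eqv[of "(-1, x)" e] key_merge(1) that eqv_sym unfolding P_def mem_orb by metis
  have QQ: "eqv (n - 1) (key e) (key (0, y))" if "e \<in> Q" for e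
    using key_eqv[of "(1, y)" e] key_merge(2) that eqv_sym unfolding Q_def mem_orb by metis
  have X: "\<exists>d \<in> T - ear - P - Q. eqv (n - 1) (key (0, x)) (key d) \<and> (d = (0, x) \<or> d = (0, y))"
    using core_x QQ[of "(0, x)"] eqv_refl by blast
  have Y: "\<exists>d \<in> T - ear - P - Q. eqv (n - 1) (key (0, y)) (key d) \<and> (d = (0, x) \<or> d = (0, y))"
    using core_y PQ[of "(0, y)"] eqv_refl by blast
  consider "c \<in> P" | "c \<in> Q" | "c \<in> T - ear - P - Q" using assms by blast
  then show ?thesis
  proof cases
    case 1
    then show ?thesis using PQ[OF 1] X that eqv_trans by metis
  next
    case 2
    then show ?thesis using QQ[OF 2] Y that eqv_trans by metis
  next
    case 3 then show ?thesis using that[of c] by simp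
  qed
qed

text \<open>The orbits \<open>ear\<close>, \<open>P\<close> and \<open>Q\<close> are distinct and
  account for the 3; on the remaining ones the key is injective by \<open>key_inj\<close>, and by
  \<open>key_core\<close> they still reach every orbit of the contraction.\<close>

lemma card_orbs_flat: "card (orb n ` T) = card (orb (n - 1) ` flat T) + 3"
proof -
  let ?T0 = "T - ear - P - Q"
  have cl0: "closed n ?T0" using cl_ear clP clQ by (simp add: closed_Diff)
  have sub: "ear \<subseteq> T" "P \<subseteq> T" "Q \<subseteq> T"
    using T_ear st' closedD[OF cl] unfolding P_def Q_def by auto
  have im: "orb n ` ear = {ear}" "orb n ` P = {P}" "orb n ` Q = {Q}"
    unfolding ear_def P_def Q_def using orb_eq_iff eqv_refl by (auto simp: image_iff) (metis orb_eq_iff)+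
  have T: "orb n ` T = orb n ` ?T0 \<union> {ear, P, Q}"
  proof -
    have "T = ?T0 \<union> (ear \<union> P \<union> Q)" using sub by blast
    then have "orb n ` T = orb n ` ?T0 \<union> (orb n ` ear \<union> orb n ` P \<union> orb n ` Q)" by (metis image_Un)
    then show ?thesis unfolding im by auto
  qed
  have "ear \<noteq> P" "ear \<noteq> Q" "P \<noteq> Q" using P_facts Q_facts P_Q_disjoint by blast+
  moreover have "c \<in> orb n c" for c by simp
  then have "ear \<notin> orb n ` ?T0" "P \<notin> orb n ` ?T0" "Q \<notin> orb n ` ?T0" by blast+
  moreover have "finite (orb n ` ?T0)"
    using finite_orbs[OF n0(1) cl] T_chords by (metis Diff_subset finite_subset image_mono)
  ultimately have "card (orb n ` T) = card (orb n ` ?T0) + 3"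
    unfolding T by (subst card_Un_disjoint) auto
  also have "card (orb n ` ?T0) = card ((\<lambda>c. orb (n - 1) (key c)) ` ?T0)"
    by (rule card_image_cong) (use key_inj key_eqv in \<open>auto simp: orb_eq_iff\<close>)
  also have "(\<lambda>c. orb (n - 1) (key c)) ` ?T0 = orb (n - 1) ` flat T"
  proof (intro equalityI subsetI)
    fix z assume "z \<in> orb (n - 1) ` flat T"
    then obtain c where c: "c \<in> T - ear" "z = orb (n - 1) (key c)" unfolding flat_def by blast
    obtain d where "d \<in> ?T0" "eqv (n - 1) (key c) (key d)" using key_core[OF c(1)] by blast
    then have "d \<in> ?T0" "z = orb (n - 1) (key d)" using c(2) orb_eq_iff by auto
    then show "z \<in> (\<lambda>c. orb (n - 1) (key c)) ` ?T0" by blast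
  qed (auto simp: flat_def)
  finally show ?thesis .
qed

end

section \<open>Flips\<close>

definition relevant :: "int \<Rightarrow> int \<times> int \<Rightarrow> bool" where
  "relevant n f \<longleftrightarrow> 3 \<le> (snd f - fst f) mod (4 * n) \<and> (snd f - fst f) mod (4 * n) \<le> 4 * n - 3"

text \<open>The other facets through the ridge left by deleting the orbit of \<open>f\<close>; the
  pseudomanifold property amounts to this being a singleton for each relevant
  \<open>f\<close>.\<close>

definition flips :: "int \<Rightarrow> (int \<times> int) set \<Rightarrow> int \<times> int \<Rightarrow> (int \<times> int) set set" where
  "flips n T f = {T'. facet n T' \<and> T' \<noteq> T \<and> T - orb n f \<subseteq> T'}"

lemma relevant_eqv: assumes "n > 0" "eqv n c d" "relevant n c" shows "relevant n d"
proof -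
  obtain i j i' j' where cd: "c = (i, j)" "d = (i', j')" by (cases c; cases d) blast
  have "(j' - i') mod (4 * n) = (j - i) mod (4 * n) \<or> (j' - i') mod (4 * n) = (i - j) mod (4 * n)"
    using eqv_mod[of n i j i' j'] assms(2) cd by simp
  moreover have "(i - j) mod (4 * n) = 4 * n - (j - i) mod (4 * n)"
    using mod_flip[of "j - i" "4 * n"] assms(1,3) cd by (simp add: relevant_def)
  ultimately show ?thesis using assms(3) unfolding cd relevant_def by auto
qed

lemma last_neighbour:
  fixes lo hi :: int
  assumes "R z" "z < hi"
  obtains w where "R w" "w < hi" "z \<le> w" "\<And>j. w < j \<Longrightarrow> j < hi \<Longrightarrow> \<not> R j"
proof -
  obtain u where u: "R (- u)" "- hi < u" "u \<le> - z" "\<And>j. - hi < j \<Longrightarrow> j < u \<Longrightarrow> \<not> R (- j)"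
    using first_neighbour[of "\<lambda>j. R (- j)" "- z" "- hi"] assms by auto
  have "\<not> R j" if "- u < j" "j < hi" for j using u(4)[of "- j"] that by simp
  then show ?thesis using that[of "- u"] u by simp
qed

lemma flip_from_free:
  assumes "n > 0" "free n U" "T - orb n f \<subseteq> U" "\<not> U \<subseteq> T"
  shows "flips n T f \<noteq> {}"
proof -
  obtain T' where "facet n T'" "U \<subseteq> T'" using free_extend[OF assms(1,2)] .
  then show ?thesis using assms(3,4) unfolding flips_def by blast
qed

section \<open>Flips before and after the contraction\<close>

context flattened
begin

text \<open>Needed in \<open>key_relevant\<close>: boundary chords of the smaller polygon already
  come from boundary chords, so a relevant chord cannot contract to one. Where
  \<open>(i, i + 2)\<close> is a chord of the ear, the start \<open>i + 1\<close> serves instead,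
  having the same number.\<close>

lemma boundary_key: obtains u where "(u, u + 2) \<notin> ear" "key (u, u + 2) = (k, k + 2)"
proof -
  obtain i where i: "theta n i = k" "\<not> n dvd i" using theta_surj[OF n0(2)] .
  note step = theta_step(1) and s2 = theta_step(2) and s3 = theta_step(3)
  have m: "(u + 2 - u) mod (4 * n) = 2" "(u - (u + 2)) mod (4 * n) = 4 * n - 2" for u
    using dmod[of u "u + 2"] n3 by simp_all
  show ?thesis
  proof (cases "n dvd i + 1")
    case True
    have nd: "\<not> n dvd i + 2" "\<not> n dvd i + 3"
      using not_dvd_near(1,3)[OF n3 True] by (simp_all add: add.assoc)
    show ?thesis
    proof (rule that[of "i + 1"])
      show "(i + 1, i + 1 + 2) \<notin> ear" using nd m[of "i + 1"] n3 unfolding ear_iff by (simp add: add.assoc)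
      show "key (i + 1, i + 1 + 2) = (k, k + 2)"
        using nd i step[of i] s2[of i] s3[of i] True m[of "i + 1"] x1
        unfolding key_def kappa_def by (simp add: add.assoc)
    qed
  next
    case False
    show ?thesis
    proof (rule that[of i])
      show "(i, i + 2) \<notin> ear" using False m[of i] n3 unfolding ear_iff by simp
      show "key (i, i + 2) = (k, k + 2)"
        using i step[of i] s2[of i] False m[of i] xy y4 unfolding key_def kappa_def by simp
    qed
  qed
qed

lemma core_class:
  assumes f: "f \<in> T - ear - P - Q" "\<not> eqv n f (0, x)" "\<not> eqv n f (0, y)"
    and c: "c \<in> T - ear" "eqv (n - 1) (key f) (key c)"
  shows "eqv n f c"
proof -
  obtain d where d: "d \<in> T - ear - P - Q" "eqv (n - 1) (key c) (key d)" "c = d \<or> d = (0, x) \<or> d = (0, y)"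
    using key_core[OF c(1)] .
  have "eqv n f d" using key_inj[OF f(1) d(1)] eqv_trans[OF c(2) d(2)] by blast
  then show ?thesis using d(3) f by blast
qed

lemma key_relevant:
  assumes f: "f \<in> T - ear - P - Q" "\<not> eqv n f (0, x)" "\<not> eqv n f (0, y)" and r: "relevant n f"
  shows "relevant (n - 1) (key f)"
proof -
  have *: False if "eqv n f g" "(snd (key g) - fst (key g)) mod (4 * (n - 1)) = 2" for g
  proof -
    define k where "k = fst (key g)"
    obtain u where u: "(u, u + 2) \<notin> ear" "key (u, u + 2) = (k, k + 2)" using boundary_key .
    have c: "(u, u + 2) \<in> T - ear" using u facet_boundary[OF n0(2) T] by blast
    define b where "b = (snd (key g) - fst (key g)) div (4 * (n - 1))"
    have s: "snd (key g) = k + 2 + 4 * (n - 1) * b"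
      using mult_div_mod_eq[of "4 * (n - 1)" "snd (key g) - fst (key g)"] that(2)
      unfolding b_def k_def by linarith
    have "eqv (n - 1) (k, k + 2) (fst (key g), snd (key g))"
      by (rule eqvI[of _ _ _ 0 _ _ b]) (simp_all add: k_def[symmetric] s)
    then have "eqv (n - 1) (key f) (key (u, u + 2))"
      unfolding u(2) using key_eqv[OF that(1)] eqv_sym eqv_trans by (metis prod.collapse)
    then have "eqv n f (u, u + 2)" using core_class[OF f c] by blast
    then have "relevant n (u, u + 2)" using relevant_eqv[OF n0(1) _ r] by blast
    then show False using n3 by (simp add: relevant_def)
  qed
  have "key f \<in> chords (n - 1)" using f flat_chords by (auto simp: flat_def)
  then have ch: "2 \<le> (snd (key f) - fst (key f)) mod (4 * (n - 1))"
    "(snd (key f) - fst (key f)) mod (4 * (n - 1)) \<le> 4 * (n - 1) - 2"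
    by (auto simp: chords_def)
  obtain i j where ij: "f = (i, j)" by (cases f)
  have "(snd (key f) - fst (key f)) mod (4 * (n - 1)) \<noteq> 2" using *[of f] by auto
  moreover have "(snd (key f) - fst (key f)) mod (4 * (n - 1)) \<noteq> 4 * (n - 1) - 2"
  proof
    assume e: "(snd (key f) - fst (key f)) mod (4 * (n - 1)) = 4 * (n - 1) - 2"
    have "(fst (key f) - snd (key f)) mod (4 * (n - 1)) = 2"
      using mod_flip[of "snd (key f) - fst (key f)" "4 * (n - 1)"] e n3 by simp
    then show False using *[of "(j, i)"] ij by (simp add: key_def)
  qed
  ultimately show ?thesis using ch unfolding relevant_def by linarith
qed

text \<open>The expansion of the flipped facet is free and contains the ridge. It is not contained
  in \<open>T\<close>: otherwise lifting its chords would give \<open>S \<subseteq> flat T\<close>,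
  hence equality by maximality.\<close>

lemma flip_lift:
  assumes f: "f \<in> T - ear - P - Q" "\<not> eqv n f (0, x)" "\<not> eqv n f (0, y)"
    and S: "S \<in> flips (n - 1) (flat T) (key f)"
  shows "flips n T f \<noteq> {}"
proof (rule flip_from_free[OF n0(1)])
  have S': "facet (n - 1) S" "S \<noteq> flat T" "flat T - orb (n - 1) (key f) \<subseteq> S"
    using S unfolding flips_def by auto
  show "free n (unflat S)" by (rule free_unflat[OF facet_free[OF S'(1)]])
  show "T - orb n f \<subseteq> unflat S"
  proof
    fix c assume c: "c \<in> T - orb n f"
    show "c \<in> unflat S"
    proof (cases "c \<in> ear")
      case False
      then have "c \<in> T - ear" using c by blast
      moreover then have "key c \<in> flat T" by (auto simp: flat_def)
      moreover have "key c \<notin> orb (n - 1) (key f)"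
        using core_class[OF f \<open>c \<in> T - ear\<close>] c by auto
      ultimately have "c \<in> lifts S" using S'(3) T_lifts unfolding lifts_def by blast
      then show ?thesis by (simp add: unflat_def)
    qed (simp add: unflat_def)
  qed
  show "\<not> unflat S \<subseteq> T"
  proof
    assume sub: "unflat S \<subseteq> T"
    have "e \<in> flat T" if "e \<in> S" for e
    proof -
      have "e \<in> chords (n - 1)" using free_chords[OF facet_free[OF S'(1)]] that by blast
      then obtain c where c: "c \<in> chords n" "allowed (fst c) (snd c)" "allowed (snd c) (fst c)" "key c = e"
        by (rule lift_exists)
      then have "c \<in> T" using that sub by (auto simp: lifts_def unflat_def)
      moreover have "c \<notin> ear" using ear_not_allowed[of "fst c" "snd c"] c by auto
      ultimately show ?thesis using c(4) unfolding flat_def by blast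
    qed
    then have "flat T = S" using facet_max[OF S'(1) free_flat] by blast
    then show False using S'(2) by simp
  qed
qed

text \<open>The whole ear lies in the ridge, so it is an ear of \<open>T'\<close> as well, and both
  facets contract with the same parameters.\<close>

lemma flip_flat:
  assumes f: "\<not> eqv n f (-1, x)" "\<not> eqv n f (0, x)" "\<not> eqv n f (0, y)" "\<not> eqv n f (1, y)"
    and T': "T' \<in> flips n T f"
  shows "flat T' \<in> flips (n - 1) (flat T) (key f)" "unflat (flat T') = T'"
proof -
  have T'': "facet n T'" "T' \<noteq> T" "T - orb n f \<subseteq> T'" using T' unfolding flips_def by auto
  have "star n T' 0 x y" using st T''(3) f unfolding star_def by auto
  then interpret A: flattened n x y T' using T''(1) by unfold_locales
  show u: "unflat (flat T') = T'" by (rule A.unflat_flat)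
  then have "flat T' \<noteq> flat T" using T''(2) unflat_flat by metis
  moreover have "flat T - orb (n - 1) (key f) \<subseteq> flat T'"
  proof
    fix e assume e: "e \<in> flat T - orb (n - 1) (key f)"
    then obtain c where c: "c \<in> T - ear" "e = key c" by (auto simp: flat_def)
    then have "c \<notin> orb n f" using e key_eqv[of f c] by auto
    then show "e \<in> flat T'" using c T''(3) by (auto simp: flat_def)
  qed
  ultimately show "flat T' \<in> flips (n - 1) (flat T) (key f)"
    using A.facet_flat unfolding flips_def by blast
qed

text \<open>Moving the first ray of the ear at 0 back to the previous neighbour \<open>w\<close> of 0 (in the
  ridge) flips the chord \<open>(0, x)\<close>.\<close>

lemma flip_ray:
  assumes r: "relevant n (0, x)" and nQ: "(0, x) \<notin> Q"
  shows "flips n T (0, x) \<noteq> {}"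
proof -
  let ?R = "T - orb n (0, x)"
  have clR: "closed n ?R" using cl by (simp add: closed_Diff)
  have x3: "3 \<le> x" using r x_range by (simp add: relevant_def)
  have "(0, 2) \<notin> orb n (0, x)"
  proof
    assume "(0, 2) \<in> orb n (0, x)"
    then have "relevant n (0, 2)" using relevant_eqv[OF n0(1) _ r] by simp
    then show False using n3 by (simp add: relevant_def)
  qed
  then have "(0, 2) \<in> ?R" using facet_boundary[OF n0(2) T, of 0] by simp
  then obtain w where w: "(0, w) \<in> ?R" "w < x" "2 \<le> w"
    and between: "\<And>j. w < j \<Longrightarrow> j < x \<Longrightarrow> (0, j) \<notin> ?R"
    using last_neighbour[of "\<lambda>j. (0, j) \<in> ?R" 2 x] x3 by auto
  interpret F: flattening n w y using n3 w x1 xy y4 by unfold_locales auto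
  \<comment> \<open>The ridge has no chord from 0 ending after \<open>w\<close> and up to
    \<open>x\<close>, so lowering the threshold from \<open>x\<close> to \<open>w\<close> changes no
    number and breaks no rule on the ridge.\<close>
  have same: "F.allowed i j \<and> F.kappa i j = kappa i j" if ij: "(i, j) \<in> ?R - ear" for i j
  proof -
    let ?d = "(j - i) mod (4 * n)"
    have al: "allowed i j" using T_allowed ij by blast
    have "?d \<le> w \<or> x < ?d" if "n dvd i"
    proof -
      have "(0, ?d) \<in> ?R"
      proof -
        obtain k where k: "i = n * k" using \<open>n dvd i\<close> by blast
        have "?d = j + n * (- k) + 4 * n * (- ((j - i) div (4 * n)))"
          using mult_div_mod_eq[of "4 * n" "j - i"] k by (simp add: algebra_simps)
        moreover have "0 = i + n * (- k)" using k by simp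
        ultimately show ?thesis
          using closed_shift[OF clR DiffD1[OF ij], of "- k" "- ((j - i) div (4 * n))"] by (simp only:)
      qed
      moreover have "?d \<noteq> x" using calculation by auto
      moreover have "2 \<le> ?d" using ij T_chords by (auto simp: chords_def)
      ultimately show ?thesis using between[of ?d] by linarith
    qed
    then show ?thesis using al w unfolding allowed_def F.allowed_def kappa_def F.kappa_def by auto
  qed
  let ?U = "F.unflat (flat T)"
  have fU: "free n ?U" by (rule F.free_unflat[OF free_flat])
  have sameR: "c \<in> F.lifts (flat T)" "F.key c = key c" if c: "c \<in> ?R - ear" for c
  proof -
    obtain i j where ij: "c = (i, j)" by (cases c)
    have "(j, i) \<in> ?R - ear"
      using closed_swap[OF closed_Diff[OF clR, of ear], of i j] c ij by (simp add: ear_def)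
    note s = same[of i j] same[of j i] this
    show k: "F.key c = key c" using s c unfolding ij F.key_def key_def by simp
    show "c \<in> F.lifts (flat T)"
      using s c k T_chords unfolding F.lifts_def flat_def ij by auto
  qed
  have RU: "?R \<subseteq> ?U" using sameR(1) unfolding F.unflat_def by blast
  have w4: "0 < w" "w < 4 * n" "w < 4 * n - 1" using w x_range by auto
  have d: "(0 - w) mod (4 * n) = 4 * n - w" "(-1 - w) mod (4 * n) = 4 * n - 1 - w" "(w - (-1)) mod (4 * n) = w + 1"
    using dmod[of 0 w] dmod[of "-1" w] w4 by simp_all
  have w_ear: "(0, w) \<notin> ear" using dmod[of 0 w] w4 w x_range not_dvd_small unfolding ear_iff by auto
  then have w0: "(0, w) \<in> ?R - ear" "(w, 0) \<in> ?R - ear"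
    using w(1) closed_swap[OF closed_Diff[OF clR, of ear], of 0 w] by (auto simp: ear_def)
  have keyw: "key (0, w) \<in> flat T" using w0 by (auto simp: flat_def)
  have keyw': "key (0, w) = (- 1, F.kappa w 0)"
    using sameR(2)[OF w0(1)] theta_vals w4 unfolding F.key_def F.kappa_def by simp
  have alw: "F.allowed w 0" using same[OF w0(2)] by blast
  have alm: "F.allowed (-1) j \<longleftrightarrow> w + 1 \<le> (j - (-1)) mod (4 * n)" for j
    using not_dvd_small near(1,2)[of "-1"] unfolding F.allowed_def by simp
  have kam: "F.kappa (-1) j = -1" for j using theta_vals not_dvd_small unfolding F.kappa_def by simp
  \<comment> \<open>Such a chord cannot be in \<open>T\<close>, where \<open>x\<close> is the first
    neighbour of -1 beyond 1. The candidate \<open>(-1, w)\<close>, which merges with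
    \<open>(0, w)\<close>, works unless the rule at its end \<open>w\<close> forbids it.\<close>
  have new: "\<exists>j. (-1, j) \<in> F.lifts (flat T) \<and> 1 < j \<and> j < x"
  proof (cases "n dvd w \<and> 4 * n - w = y")
    case False
    have parity: "4 * n - w \<noteq> w + 1" by presburger
    have al1: "F.allowed w (-1)" and k1: "F.kappa w (-1) = F.kappa w 0"
      using alw False parity unfolding F.allowed_def F.kappa_def d by (auto split: if_splits)
    have "(-1, w) \<in> F.lifts (flat T)"
      using al1 k1 keyw keyw' alm kam d w4 w x_range chordsI[of "-1" w n] unfolding F.lifts_def F.key_def by simp
    then show ?thesis using w by auto
  next
    case True
    have "w = n \<or> w = 2 * n \<or> w = 3 * n" using dvd_cases[of n w] True w4 by blast
    then have wn: "w = n" "y = 3 * n" using True w xy n0 by auto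
    have "n + 1 \<noteq> x"
    proof
      assume "n + 1 = x"
      then have "(0, x) \<in> Q" unfolding Q_def mem_orb
        by (intro eqvI'[of _ _ _ "-3" _ _ 1]) (use wn in simp_all)
      then show False using nQ by simp
    qed
    then have nx: "n + 1 < x" using w wn by simp
    have d': "(-1 - (n + 1)) mod (4 * n) = 3 * n - 2" "(n + 1 - (-1)) mod (4 * n) = n + 2"
      using dmod[of "-1" "n + 1"] n3 by simp_all
    have nd: "\<not> n dvd n + 1" "\<not> n dvd n + 2" using not_dvd_near[OF n3, of n] by simp_all
    have "F.allowed (n + 1) (-1)" using d' nd wn unfolding F.allowed_def by (simp add: add.assoc)
    moreover have "F.kappa (n + 1) (-1) = F.kappa w 0"
      using nd d theta_Suc[OF n0(1), of n] wn n0 unfolding F.kappa_def by simp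
    moreover have "F.allowed (-1) (n + 1)" using d' wn unfolding alm by simp
    ultimately have "(-1, n + 1) \<in> F.lifts (flat T)"
      using keyw keyw' kam chordsI[of "-1" "n + 1" n] n3 unfolding F.lifts_def F.key_def by simp
    then show ?thesis using nx n3 by (intro exI[of _ "n + 1"]) auto
  qed
  have "\<not> ?U \<subseteq> T"
  proof
    assume "?U \<subseteq> T"
    then obtain j where "(-1, j) \<in> T" "1 < j" "j < x" using new unfolding F.unflat_def by blast
    then show False using star_neighbours(1)[OF fr st, of j] by simp
  qed
  then show ?thesis using flip_from_free[OF n0(1) fU RU] by blast
qed

end

section \<open>Flips at ears of arbitrary vertices\<close>

lemma flips_eqv: "eqv n f g \<Longrightarrow> flips n T f = flips n T g"
  unfolding flips_def by (simp add: orb_eq_iff[symmetric])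

lemma flips_transl:
  assumes "flips n (transl s T) (i, j) \<noteq> {}" shows "flips n T (i + s, j + s) \<noteq> {}"
proof -
  obtain S where S: "facet n S" "S \<noteq> transl s T" "transl s T - orb n (i, j) \<subseteq> S"
    using assms unfolding flips_def by blast
  have "transl (- s) S \<noteq> T" using S(2) by auto
  moreover have "T - orb n (i + s, j + s) \<subseteq> transl (- s) S"
  proof
    fix c assume c: "c \<in> T - orb n (i + s, j + s)"
    obtain k l where kl: "c = (k, l)" by (cases c)
    have "(k - s, l - s) \<in> transl s T - orb n (i, j)"
      using c kl eqv_transl[of n i s j "k - s" "l - s"] by simp
    then show "c \<in> transl (- s) S" using S(3) kl by auto
  qed
  ultimately show ?thesis using facet_transl[OF S(1)] unfolding flips_def by blast
qed

lemma flips_mirror: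
  assumes "n > 0" "flips n (mirror T) (i, j) \<noteq> {}" shows "flips n T (- i, - j) \<noteq> {}"
proof -
  obtain S where S: "facet n S" "S \<noteq> mirror T" "mirror T - orb n (i, j) \<subseteq> S"
    using assms unfolding flips_def by blast
  have "mirror S \<noteq> T" using S(2) by auto
  moreover have "T - orb n (- i, - j) \<subseteq> mirror S"
  proof
    fix c assume c: "c \<in> T - orb n (- i, - j)"
    obtain k l where kl: "c = (k, l)" by (cases c)
    have "(- k, - l) \<in> mirror T - orb n (i, j)"
      using c kl eqv_mirror[of n i j "- k" "- l"] by simp
    then show "c \<in> mirror S" using S(3) kl by auto
  qed
  ultimately show ?thesis using facet_mirror[OF assms(1) S(1)] unfolding flips_def by blast
qed

lemma flattened_transl:
  assumes n: "n \<ge> 3" and T: "facet n T" and s: "star n T v x y"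
  shows "flattened n (x - v) (y - v) (transl v T)"
proof
  show "facet n (transl v T)" using T by (rule facet_transl)
  show "star n (transl v T) 0 (x - v) (y - v)" using s by (simp add: star_transl)
qed (use n s in \<open>auto simp: star_def\<close>)

lemma flip_ray_at:
  assumes n: "n \<ge> 3" and T: "facet n T" and s: "star n T v x y" and r: "relevant n f"
    and e: "eqv n f (v, x)" "\<not> eqv n f (v + 1, y)"
  shows "flips n T f \<noteq> {}"
proof -
  interpret flattened n "x - v" "y - v" "transl v T" by (rule flattened_transl[OF n T s])
  have "relevant n (v, x)" using relevant_eqv[OF n0(1) e(1) r] .
  then have "relevant n (0, x - v)" by (simp add: relevant_def)
  moreover have "(0, x - v) \<notin> Q"
  proof
    assume "(0, x - v) \<in> Q"
    then have "eqv n (v + 1, y) (v, x)" using eqv_transl[of n 1 v "y - v" 0 "x - v"] by (simp add: Q_def add.commute)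
    then show False using e eqv_trans eqv_sym by blast
  qed
  ultimately have "flips n (transl v T) (0, x - v) \<noteq> {}" by (rule flip_ray)
  then have "flips n T (0 + v, x - v + v) \<noteq> {}" by (rule flips_transl)
  then show ?thesis using flips_eqv[OF e(1)] by simp
qed

text \<open>Reflection turns the last ray of the ear into a first one, so this is the mirror image
  of \<open>flip_ray_at\<close>.\<close>

lemma flip_ray_at':
  assumes n: "n \<ge> 3" and T: "facet n T" and s: "star n T v x y" and r: "relevant n f"
    and e: "eqv n f (v, y)" "\<not> eqv n f (v - 1, x)"
  shows "flips n T f \<noteq> {}"
proof -
  obtain i j where f: "f = (i, j)" by (cases f)
  have n0: "n > 0" using n by simp
  have turn: "eqv n (u, w) (u, 4 * n + w)" for u w
    by (rule eqvI[of _ _ _ 0 _ _ 1]) simp_all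
  have m1: "eqv n (- i, - j) (- v, 4 * n - y)"
    using eqv_trans[OF _ turn[of "- v" "- y"], of "(- i, - j)"] e(1) eqv_mirror[of n i j v y] f by simp
  have "\<not> eqv n (- i, - j) (- v + 1, 4 * n - x)"
  proof
    assume "eqv n (- i, - j) (- v + 1, 4 * n - x)"
    then have "eqv n (- i, - j) (- (v - 1), - x)"
      using eqv_trans[OF _ eqv_sym[OF turn[of "- v + 1" "- x"]], of "(- i, - j)"] by simp
    then show False using e(2) eqv_mirror[of n i j "v - 1" x] f by simp
  qed
  moreover have "relevant n (- i, - j)"
    using relevant_eqv[OF n0 eqv_swap r[unfolded f]] by (simp add: relevant_def)
  ultimately have "flips n (mirror T) (- i, - j) \<noteq> {}"
    using flip_ray_at[OF n facet_mirror[OF n0 T] star_mirror[OF facet_closed[OF T] s]] m1 by blast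
  then show ?thesis using flips_mirror[OF n0] f by fastforce
qed

lemma flip_lift_at:
  assumes n: "n \<ge> 3" and T: "facet n T" and s: "star n T v x y" and f: "f \<in> T" and r: "relevant n f"
    and e: "\<not> eqv n f (v - 1, x)" "\<not> eqv n f (v, x)" "\<not> eqv n f (v, y)" "\<not> eqv n f (v + 1, y)"
    and IH: "\<And>S g. facet (n - 1) S \<Longrightarrow> g \<in> S \<Longrightarrow> relevant (n - 1) g \<Longrightarrow> flips (n - 1) S g \<noteq> {}"
  shows "flips n T f \<noteq> {}"
proof -
  interpret flattened n "x - v" "y - v" "transl v T" by (rule flattened_transl[OF n T s])
  obtain i j where ij: "f = (i, j)" by (cases f)
  let ?f = "(i - v, j - v)"
  have tr: "eqv n ?f (a - v, b - v) \<longleftrightarrow> eqv n f (a, b)" for a b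
    using eqv_transl[of n "i - v" v "j - v" "a - v" "b - v"] ij by simp
  have e': "\<not> eqv n ?f (-1, x - v)" "\<not> eqv n ?f (0, x - v)" "\<not> eqv n ?f (0, y - v)" "\<not> eqv n ?f (1, y - v)"
    using e tr[of "v - 1" x] tr[of v x] tr[of v y] tr[of "v + 1" y] by simp_all
  have r': "relevant n ?f" using r by (simp add: ij relevant_def)
  have "?f \<notin> ear" using ear_mod[of "i - v" "j - v"] r' by (auto simp: relevant_def)
  then have f': "?f \<in> transl v T - ear - P - Q"
    using f ij e' eqv_sym unfolding P_def Q_def by auto
  have "key ?f \<in> flat (transl v T)" using f' by (auto simp: flat_def)
  then have "flips (n - 1) (flat (transl v T)) (key ?f) \<noteq> {}"
    using IH[OF facet_flat] key_relevant[OF f' e'(2,3) r'] by blast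
  then have "flips n (transl v T) ?f \<noteq> {}" using flip_lift[OF f' e'(2,3)] by blast
  then have "flips n T (i - v + v, j - v + v) \<noteq> {}" by (rule flips_transl)
  then show ?thesis by (simp add: ij)
qed

lemma eqv_class:
  assumes "eqv n (u, w) (i, j)" shows "n dvd i - u \<or> n dvd i - w"
  using assms by (cases rule: eqvE) auto

text \<open>If a chord is both the first and the last neighbour of one of its ends \<open>e\<close>, then its ends
  and the boundary chords are all the neighbours of \<open>e\<close>, so it is a ray of the ear at \<open>e\<close>.\<close>

lemma flip_lonely:
  assumes n: "n \<ge> 3" and T: "facet n T" and r: "relevant n f"
    and s1: "star n T (e + 1) x1 y1" "eqv n f (e, x1)"
    and s2: "star n T (e - 1) x2 y2" "eqv n f (e, y2)"
    and nd: "\<not> n dvd x1 - e"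
  shows "flips n T f \<noteq> {}"
proof -
  note fr = facet_free[OF T]
  have no1: "\<not> n dvd 1" "\<not> n dvd 2" using n by (auto dest: zdvd_imp_le)
  have range: "e + 2 < x1" "x1 < e + 4 * n" "e < y2" "y2 < e - 2 + 4 * n"
    using s1(1) s2(1) by (auto simp: star_def)
  have "eqv n (e, x1) (e, y2)" using s1(2) s2(2) eqv_sym eqv_trans by blast
  \<comment> \<open>The hypothesis \<open>nd\<close> excludes the reversal, so the corners agree:
    \<open>x1\<close> is at once the first and the last neighbour of \<open>e\<close> apart from
    \<open>e + 2\<close> and \<open>e - 2\<close>.\<close>
  then have z: "y2 = x1"
  proof (cases rule: eqvE)
    case (direct k a)
    then have "4 * n dvd y2 - x1" using n by simp
    then show ?thesis using range zdvd_imp_le[of "4 * n" "y2 - x1"] zdvd_imp_le[of "4 * n" "x1 - y2"]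
      by (smt (verit) dvd_diff_commute)
  next
    case (swap k a)
    then have "x1 - e = n * (- k)" by simp
    then show ?thesis using nd by (metis dvd_triv_left)
  qed
  have only: "j = e + 2 \<or> j = x1 \<or> j = e + 4 * n - 2" if "(e, j) \<in> T" "e + 2 \<le> j" "j \<le> e + 4 * n - 2" for j
    using star_neighbours(1)[OF fr s1(1), of j] star_neighbours(3)[OF fr s2(1), of j] that z by force
  obtain X Y where s: "star n T e X Y" using star_exists[OF n T] .
  have XY: "e + 1 < X" "X < Y" "Y < e - 1 + 4 * n" "(e, X) \<in> T" "(e, Y) \<in> T" using s by (auto simp: star_def)
  have ex: "(e, x1) \<in> T" using s1(1) by (simp add: star_def)
  have "X = x1 \<or> Y = x1"
    using only[of X] only[of Y] star_neighbours(2)[OF fr s ex] XY range z by linarith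
  then show ?thesis
  proof
    assume X: "X = x1"
    then have Y: "Y = e + 4 * n - 2" using only[of Y] XY range by linarith
    have "\<not> eqv n f (e + 1, Y)"
    proof
      assume "eqv n f (e + 1, Y)"
      then have "eqv n (e, x1) (e + 1, Y)" using s1(2) eqv_sym eqv_trans by blast
      then show False
        using eqv_class'[of n e x1 "e + 1" Y] no1 dvd_diff_right_iff[of n "4 * n" 2] Y
        by (auto simp: algebra_simps)
    qed
    then show ?thesis using flip_ray_at[OF n T s r] s1(2) X by blast
  next
    assume Y: "Y = x1"
    then have X: "X = e + 2" using only[of X] XY range z by linarith
    have "\<not> eqv n f (e - 1, X)"
    proof
      assume "eqv n f (e - 1, X)"
      then have "eqv n (e, x1) (e - 1, X)" using s1(2) eqv_sym eqv_trans by blast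
      then show False using eqv_class'[of n e x1 "e - 1" X] no1 X by auto
    qed
    then show ?thesis using flip_ray_at'[OF n T s r] s1(2) Y by blast
  qed
qed

lemma star_shift:
  assumes "closed n T" "star n T v x y" shows "star n T (v + n * k) (x + n * k) (y + n * k)"
  using assms closed_translate[OF assms(1), of "v - 1" k x] closed_translate[OF assms(1), of v k x]
    closed_translate[OF assms(1), of v k y] closed_translate[OF assms(1), of "v + 1" k y]
  unfolding star_def by (simp add: algebra_simps)

text \<open>Ends of rotations of the chord lie in the classes of \<open>u\<close> and
  \<open>u + 1\<close> modulo \<open>n\<close>. Thus the ears at \<open>u + 1\<close> and
  \<open>u - 1\<close> make it the first and the last neighbour of \<open>u\<close>, unless
  \<open>u - 2\<close> and \<open>u + 1\<close> are congruent. That happens only for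
  \<open>n = 3\<close>, and then the same argument runs at \<open>w\<close>.\<close>

lemma flip_exists_aux:
  assumes n: "n \<ge> 3" and T: "facet n T" and r: "relevant n (u, w)"
    and uw: "n dvd w - u - 1"
    and A: "\<And>v. \<exists>x y. star n T v x y \<and> (eqv n (u, w) (v - 1, x) \<or> eqv n (u, w) (v + 1, y))"
  shows "flips n T (u, w) \<noteq> {}"
proof -
  have no1: "\<not> n dvd 1" "\<not> n dvd 2" using n by (auto dest: zdvd_imp_le)
  obtain q where q: "w - u - 1 = n * q" using uw by blast
  then have w: "w = u + 1 + n * q" by simp
  have nwu: "\<not> n dvd w - u"
  proof
    assume "n dvd w - u"
    then have "n dvd (w - u) - (w - u - 1)" using uw by (rule dvd_diff)
    then show False using no1 by simp
  qed
  have nwu': "\<not> n dvd u - w" using nwu by (simp add: dvd_diff_commute)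
  have far: "\<not> n dvd j - e" if "n dvd j - e'" "\<not> n dvd e - e'" for j e e'
  proof
    assume "n dvd j - e"
    with that(1) have "n dvd (j - e') - (j - e)" by (rule dvd_diff)
    then show False using that(2) by simp
  qed
  have cls: "\<not> eqv n (u, w) (i, j)" if "\<not> n dvd i - u" "\<not> n dvd i - u - 1" for i j
  proof
    assume "eqv n (u, w) (i, j)"
    then have "n dvd i - w" using eqv_class that(1) by blast
    then have "n dvd (i - w) + (w - u - 1)" using uw by (rule dvd_add)
    moreover have "(i - w) + (w - u - 1) = i - u - 1" by simp
    ultimately show False using that(2) by (simp only:)
  qed
  obtain x1 y1 where s1: "star n T (u + 1) x1 y1" "eqv n (u, w) (u, x1)"
  proof -
    obtain x y where "star n T (u + 1) x y" "eqv n (u, w) (u + 1 - 1, x) \<or> eqv n (u, w) (u + 1 + 1, y)"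
      using A by blast
    moreover have "\<not> eqv n (u, w) (u + 1 + 1, y)" by (rule cls) (use no1 in auto)
    ultimately show ?thesis using that by simp
  qed
  obtain x2 y2 where s2: "star n T (u - 1) x2 y2" "eqv n (u, w) (u - 2, x2) \<or> eqv n (u, w) (u, y2)"
    using A[of "u - 1"] by auto
  show ?thesis
  proof (cases "eqv n (u, w) (u, y2)")
    case True
    have "n dvd x1 - w \<and> n dvd u - u \<or> n dvd x1 - u \<and> n dvd u - w" using eqv_class'[OF s1(2)] .
    then have "\<not> n dvd x1 - u" using far[of x1 w u] nwu' by blast
    then show ?thesis using flip_lonely[OF n T r s1 s2(1) True] by blast
  next
    case False
    then have e2: "eqv n (u, w) (u - 2, x2)" using s2(2) by blast
    then have "n dvd - 2 \<or> n dvd - 3" using cls[of "u - 2" x2] by auto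
    then have "n dvd 3" using no1 by simp
    then have n3: "n = 3" using n zdvd_imp_le[of n 3] by simp
    obtain x3 y3 where s3: "star n T u x3 y3" "eqv n (u, w) (u + 1, y3)"
    proof -
      obtain x y where "star n T u x y" "eqv n (u, w) (u - 1, x) \<or> eqv n (u, w) (u + 1, y)"
        using A by blast
      moreover have "\<not> eqv n (u, w) (u - 1, x)" by (rule cls) (use no1 in auto)
      ultimately show ?thesis using that by blast
    qed
    have sh: "eqv n (u, w) (i, j) \<Longrightarrow> eqv n (u, w) (i + n * k, j + n * k)" for i j k
      by (erule eqv_trans) (rule eqvI[of _ _ _ k _ _ 0], simp_all)
    have t3: "star n T (w - 1) (x3 + n * q) (y3 + n * q)" "eqv n (u, w) (w, y3 + n * q)"
      using star_shift[OF facet_closed[OF T] s3(1), of q] sh[OF s3(2), of q] w by (simp_all add: algebra_simps)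
    have t2: "star n T (w + 1) (x2 + n * (q + 1)) (y2 + n * (q + 1))" "eqv n (u, w) (w, x2 + n * (q + 1))"
      using star_shift[OF facet_closed[OF T] s2(1), of "q + 1"] sh[OF e2, of "q + 1"] w n3
      by (simp_all add: algebra_simps)
    have "\<not> n dvd x2 + n * (q + 1) - w"
      using eqv_class'[OF t2(2)] far[of "x2 + n * (q + 1)" u w] nwu by auto
    then show ?thesis using flip_lonely[OF n T r t2 t3] by blast
  qed
qed

text \<open>Without a flip, neither lifting nor moving a ray would work at any vertex, so
  \<open>f\<close> would be an outer side of the ear at each vertex up to rotation. For the ear at
  \<open>u\<close> this forces the ends of \<open>f\<close> into adjacent residue classes.\<close>

lemma flip_exists:
  assumes n: "n \<ge> 3" and T: "facet n T" and f: "f \<in> T" and r: "relevant n f"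
    and IH: "\<And>S g. facet (n - 1) S \<Longrightarrow> g \<in> S \<Longrightarrow> relevant (n - 1) g \<Longrightarrow> flips (n - 1) S g \<noteq> {}"
  shows "flips n T f \<noteq> {}"
proof (rule ccontr)
  assume no: "\<not> flips n T f \<noteq> {}"
  obtain u w where uw: "f = (u, w)" by (cases f)
  have no1: "\<not> n dvd 1" "\<not> n dvd - 1" using n by (auto dest: zdvd_imp_le)
  have A: "\<exists>x y. star n T v x y \<and> (eqv n f (v - 1, x) \<or> eqv n f (v + 1, y))" for v
  proof -
    obtain x y where s: "star n T v x y" using star_exists[OF n T] .
    show ?thesis
      using flip_lift_at[OF n T s f r _ _ _ _ IH] flip_ray_at[OF n T s r] flip_ray_at'[OF n T s r] no s by blast
  qed
  have sw: "eqv n f c \<longleftrightarrow> eqv n (w, u) c" for c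
    unfolding uw using eqv_trans eqv_swap by blast
  obtain x y where "eqv n f (u - 1, x) \<or> eqv n f (u + 1, y)" using A[of u] by blast
  then have "n dvd u - 1 - w \<or> n dvd u + 1 - w"
    unfolding uw using eqv_class[of n u w "u - 1" x] eqv_class[of n u w "u + 1" y] no1 by auto
  then show False
  proof
    assume "n dvd u - 1 - w"
    then have "n dvd u - w - 1" by (simp add: algebra_simps)
    moreover have "relevant n (w, u)"
      using relevant_eqv[of n f "(w, u)"] r n uw by simp
    ultimately have "flips n T (w, u) \<noteq> {}"
      using flip_exists_aux[OF n T, of w u] A unfolding sw by blast
    then show False using no flips_eqv[of n f "(w, u)" T] uw by simp
  next
    assume "n dvd u + 1 - w"
    then have "n dvd - (u + 1 - w)" by (simp only: dvd_minus_iff)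
    then have "n dvd w - u - 1" by (simp add: algebra_simps)
    then show False using flip_exists_aux[OF n T, of u w] A r no unfolding uw by blast
  qed
qed

section \<open>Uniqueness of flips\<close>

lemma three_types:
  fixes p q :: "nat \<Rightarrow> bool"
  assumes "\<And>i. i < 3 \<Longrightarrow> \<not> (p i \<and> q i)"
    and p: "\<And>i j. i < 3 \<Longrightarrow> j < 3 \<Longrightarrow> i \<noteq> j \<Longrightarrow> \<not> (p i \<and> p j)"
    and q: "\<And>i j. i < 3 \<Longrightarrow> j < 3 \<Longrightarrow> i \<noteq> j \<Longrightarrow> \<not> (q i \<and> q j)"
    and r: "\<And>i j. i < 3 \<Longrightarrow> j < 3 \<Longrightarrow> i \<noteq> j \<Longrightarrow> p i \<or> p j \<or> q i \<or> q j"
  obtains i j k where "i < 3" "j < 3" "k < 3" "i \<noteq> k" "p i" "q j" "\<not> p k" "\<not> q k"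
proof -
  have "\<not> (p 0 \<and> q 0)" "\<not> (p 1 \<and> q 1)" "\<not> (p 2 \<and> q 2)"
    "\<not> (p 0 \<and> p 1)" "\<not> (p 0 \<and> p 2)" "\<not> (p 1 \<and> p 2)"
    "\<not> (q 0 \<and> q 1)" "\<not> (q 0 \<and> q 2)" "\<not> (q 1 \<and> q 2)"
    "p 0 \<or> p 1 \<or> q 0 \<or> q 1" "p 0 \<or> p 2 \<or> q 0 \<or> q 2" "p 1 \<or> p 2 \<or> q 1 \<or> q 2"
    using assms(1)[of 0] assms(1)[of 1] assms(1)[of 2] p[of 0 1] p[of 0 2] p[of 1 2]
      q[of 0 1] q[of 0 2] q[of 1 2] r[of 0 1] r[of 0 2] r[of 1 2] by simp_all
  then consider "p 0 \<and> q 1 \<and> \<not> p 2 \<and> \<not> q 2" | "p 0 \<and> q 2 \<and> \<not> p 1 \<and> \<not> q 1"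
    | "p 1 \<and> q 0 \<and> \<not> p 2 \<and> \<not> q 2" | "p 1 \<and> q 2 \<and> \<not> p 0 \<and> \<not> q 0"
    | "p 2 \<and> q 0 \<and> \<not> p 1 \<and> \<not> q 1" | "p 2 \<and> q 1 \<and> \<not> p 0 \<and> \<not> q 0"
    by argo
  then show ?thesis
  proof cases
    case 1 then show ?thesis by (intro that[of 0 1 2]) simp_all
  next
    case 2 then show ?thesis by (intro that[of 0 2 1]) simp_all
  next
    case 3 then show ?thesis by (intro that[of 1 0 2]) simp_all
  next
    case 4 then show ?thesis by (intro that[of 1 2 0]) simp_all
  next
    case 5 then show ?thesis by (intro that[of 2 0 1]) simp_all
  next
    case 6 then show ?thesis by (intro that[of 2 1 0]) simp_all
  qed
qed

text \<open>Call a facet of type P (type Q) if the first (last) of the four chords of its ear at 0 is the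
  one outside the common ridge. Types P and Q each occur at most once, and so does the remaining
  type; the three types cannot occur together either.\<close>

lemma ear_in_ridge:
  fixes f :: "nat \<Rightarrow> int \<times> int" and x y :: "nat \<Rightarrow> int" and T :: "nat \<Rightarrow> (int \<times> int) set"
  assumes n: "n \<ge> 3" and T: "\<And>i. i < 3 \<Longrightarrow> facet n (T i)"
    and st: "\<And>i. i < 3 \<Longrightarrow> star n (T i) 0 (x i) (y i)"
    and TR: "\<And>i. i < 3 \<Longrightarrow> T i = R \<union> orb n (f i)"
    and dist: "\<And>i j. i < 3 \<Longrightarrow> j < 3 \<Longrightarrow> i \<noteq> j \<Longrightarrow> \<not> eqv n (f i) (f j)"
  shows "\<exists>i<3. (-1, x i) \<in> R \<and> (0, x i) \<in> R \<and> (0, y i) \<in> R \<and> (1, y i) \<in> R"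
proof (rule ccontr)
  assume neg: "\<not> ?thesis"
  have out: "eqv n (f i) c" if "c \<in> T i" "c \<notin> R" "i < 3" for i c
    using TR[OF that(3)] that(1,2) by auto
  \<comment> \<open>The added orbits are pairwise distinct, so a chord outside the ridge belongs to
    only one of the three facets.\<close>
  have clash: "i = j" if "i < 3" "j < 3" "c \<in> T i" "c \<in> T j" "c \<notin> R" for i j c
    using out[of c i] out[of c j] that dist[of i j] eqv_trans eqv_sym by blast
  have s: "1 < x i" "x i < y i" "y i < 4 * n - 1" "(-1, x i) \<in> T i" "(0, x i) \<in> T i" "(0, y i) \<in> T i"
    "(1, y i) \<in> T i" if "i < 3" for i
    using st[OF that] by (auto simp: star_def)
  have fl: "flattened n (x i) (y i) (T i)" if "i < 3" for i
    using n s[OF that] T[OF that] st[OF that] by unfold_locales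
  have fr: "free n (T i)" if "i < 3" for i using facet_free[OF T[OF that]] .
  \<comment> \<open>All sides of one ear that are missing from the ridge lie in a single orbit,
    whereas these pairs of sides never share an orbit.\<close>
  have PX: "\<not> ((-1, x i) \<notin> R \<and> (0, x i) \<notin> R)" and PQ: "\<not> ((-1, x i) \<notin> R \<and> (1, y i) \<notin> R)"
    and QY: "\<not> ((1, y i) \<notin> R \<and> (0, y i) \<notin> R)" if i: "i < 3" for i
  proof -
    interpret flattened n "x i" "y i" "T i" by (rule fl[OF i])
    have e: "eqv n c d" if "c \<in> T i" "c \<notin> R" "d \<in> T i" "d \<notin> R" for c d
      using out[OF that(1,2) i] out[OF that(3,4) i] eqv_trans eqv_sym by blast
    show "\<not> ((-1, x i) \<notin> R \<and> (0, x i) \<notin> R)"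
      using e[of "(-1, x i)" "(0, x i)"] s[OF i] P_facts(2) unfolding P_def by auto
    show "\<not> ((-1, x i) \<notin> R \<and> (1, y i) \<notin> R)"
      using e[of "(1, y i)" "(-1, x i)"] s[OF i] P_Q_disjoint unfolding Q_def by auto
    show "\<not> ((1, y i) \<notin> R \<and> (0, y i) \<notin> R)"
      using e[of "(1, y i)" "(0, y i)"] s[OF i] Q_facts(2) unfolding Q_def by auto
  qed
  have sub: "R \<subseteq> T i" if "i < 3" for i using TR[OF that] by blast
  \<comment> \<open>A side in the ridge belongs to all three facets and therefore bounds the
    corresponding corner of every ear at 0.\<close>
  have xle: "x j \<le> x i" if "(-1, x i) \<in> R" "i < 3" "j < 3" for i j
    using star_neighbours(1)[OF fr[OF that(3)] st[OF that(3)], of "x i"] sub[OF that(3)] s[OF that(2)] that(1) by auto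
  have yle: "y i \<le> y j" if "(1, y i) \<in> R" "i < 3" "j < 3" for i j
    using star_neighbours(3)[OF fr[OF that(3)] st[OF that(3)], of "y i"] sub[OF that(3)] s[OF that(2)] that(1) by auto
  have mid: "z \<le> x j \<or> y j \<le> z" if "(0, z) \<in> R" "j < 3" for z j
    using star_neighbours(2)[OF fr[OF that(2)] st[OF that(2)], of z] sub[OF that(2)] that(1) by auto
  have P1: "\<not> (i \<noteq> j \<and> (-1, x i) \<notin> R \<and> (-1, x j) \<notin> R)" if i: "i < 3" and j: "j < 3" for i j
  proof
    assume h: "i \<noteq> j \<and> (-1, x i) \<notin> R \<and> (-1, x j) \<notin> R"
    then have "y i = y j" using PQ i j yle[of i j] yle[of j i] by force
    moreover have "x i \<noteq> x j" using clash[OF i j, of "(-1, x i)"] s[OF i] s[OF j] h by auto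
    moreover have "(0, x i) \<in> R" "(0, x j) \<in> R" using PX i j h by blast+
    ultimately show False using mid[of "x i" j] mid[of "x j" i] s[OF i] s[OF j] i j by linarith
  qed
  have Q1: "\<not> (i \<noteq> j \<and> (1, y i) \<notin> R \<and> (1, y j) \<notin> R)" if i: "i < 3" and j: "j < 3" for i j
  proof
    assume h: "i \<noteq> j \<and> (1, y i) \<notin> R \<and> (1, y j) \<notin> R"
    then have "x i = x j" using PQ i j xle[of i j] xle[of j i] by force
    moreover have "y i \<noteq> y j" using clash[OF i j, of "(1, y i)"] s[OF i] s[OF j] h by auto
    moreover have "(0, y i) \<in> R" "(0, y j) \<in> R" using QY i j h by blast+
    ultimately show False using mid[of "y i" j] mid[of "y j" i] s[OF i] s[OF j] i j by linarith
  qed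
  have N1: "\<not> (i \<noteq> j \<and> (-1, x i) \<in> R \<and> (-1, x j) \<in> R \<and> (1, y i) \<in> R \<and> (1, y j) \<in> R)"
    if i: "i < 3" and j: "j < 3" for i j
  proof
    assume h: "i \<noteq> j \<and> (-1, x i) \<in> R \<and> (-1, x j) \<in> R \<and> (1, y i) \<in> R \<and> (1, y j) \<in> R"
    then have e: "x i = x j" "y i = y j" using xle yle i j by (meson antisym)+
    have "(0, x i) \<notin> R \<or> (0, y i) \<notin> R" using neg i h by blast
    then show False using clash[OF i j, of "(0, x i)"] clash[OF i j, of "(0, y i)"] s[OF i] s[OF j] e h by auto
  qed
  obtain i j k where ijk: "i < 3" "j < 3" "k < 3" "i \<noteq> k"
    "(-1, x i) \<notin> R" "(1, y j) \<notin> R" "\<not> (-1, x k) \<notin> R" "\<not> (1, y k) \<notin> R"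
    by (rule three_types[of "\<lambda>i. (-1, x i) \<notin> R" "\<lambda>i. (1, y i) \<notin> R"]) (use PQ P1 Q1 N1 in blast)+
  have Qi: "(1, y i) \<in> R" and Pj: "(-1, x j) \<in> R" using PQ ijk by blast+
  \<comment> \<open>The facets \<open>i\<close>, \<open>j\<close>, \<open>k\<close> have type P,
    type Q and neither. The ray to \<open>x k\<close> falls strictly inside the ear of
    \<open>i\<close>, the ray to \<open>y k\<close> inside that of \<open>j\<close>, so neither is
    in the ridge; but \<open>y i = y k\<close> lets \<open>i\<close> and \<open>k\<close> share the
    latter.\<close>
  have xi: "x i < x k" "y i = y k"
    using xle[of k i] yle[of i k] yle[of k i] ijk Qi by (force simp: order_less_le)+
  have yj: "y k < y j" "x j = x k"
    using yle[of k j] xle[of j k] xle[of k j] ijk Pj by (force simp: order_less_le)+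
  have "(0, x k) \<notin> R" using mid[of "x k" i] xi s(2)[OF ijk(3)] ijk by auto
  moreover have "(0, y k) \<notin> R" using mid[of "y k" j] yj s(2)[OF ijk(3)] ijk by auto
  ultimately show False
    using clash[OF ijk(1,3), of "(0, y k)"] s(6)[OF ijk(1)] s(6)[OF ijk(3)] xi ijk by simp
qed

text \<open>Purity enters here: by the count, a facet through a ridge is the ridge plus a single
  orbit.\<close>

lemma one_more_orbit:
  assumes n: "n > 0" and T': "facet n T'" and R: "closed n R" "R \<subseteq> T'"
    and card: "card (orb n ` T') = card (orb n ` R) + 1"
  obtains g where "T' = R \<union> orb n g" "g \<notin> R"
proof -
  note cl = facet_closed[OF T']
  have fin: "finite (orb n ` T')" using finite_orbs[OF n cl free_chords[OF facet_free[OF T']]] .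
  have "orb n ` R \<subseteq> orb n ` T'" using R(2) by blast
  then have "card (orb n ` T' - orb n ` R) = 1"
    using card card_Diff_subset[OF finite_subset[OF _ fin], of "orb n ` R"] by simp
  then obtain A where A: "orb n ` T' - orb n ` R = {A}" by (auto simp: card_1_singleton_iff)
  then have "A \<in> orb n ` T' - orb n ` R" by simp
  then obtain g where g: "g \<in> T'" "A = orb n g" by (auto elim: imageE)
  have mem: "c \<in> R \<longleftrightarrow> orb n c \<in> orb n ` R" for c
  proof
    assume "orb n c \<in> orb n ` R"
    then obtain d where "d \<in> R" "orb n d = orb n c" by (metis imageE)
    then have "d \<in> R" "eqv n d c" unfolding orb_eq_iff by blast+
    then show "c \<in> R" using closedD[OF R(1)] by blast
  qed simp
  have "g \<notin> R" using A g mem by blast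
  moreover have "T' = R \<union> orb n g"
  proof
    show "R \<union> orb n g \<subseteq> T'" using R(2) closedD[OF cl g(1)] by auto
    show "T' \<subseteq> R \<union> orb n g"
    proof
      fix c assume c: "c \<in> T'"
      show "c \<in> R \<union> orb n g"
      proof (cases "c \<in> R")
        case False
        then have "orb n c \<in> orb n ` T' - orb n ` R" using mem c by blast
        then have "eqv n g c" using A g(2) orb_eq_iff[of n g c] by simp
        then show ?thesis by simp
      qed simp
    qed
  qed
  ultimately show ?thesis using that by blast
qed

text \<open>By \<open>ear_in_ridge\<close>, one of the ears at 0 of \<open>T\<close>,
  \<open>T1\<close>, \<open>T2\<close> lies in the common ridge and so is an ear of all three.
  Contracted along it, \<open>T1\<close> and \<open>T2\<close> become flips of the same chord, equal
  by induction, and expansion recovers them.\<close>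

lemma flips_unique:
  assumes n: "n \<ge> 3" and T: "facet n T" and f: "f \<in> T" and r: "relevant n f"
    and card: "\<And>S. facet n S \<Longrightarrow> card (orb n ` S) = m"
    and IH: "\<And>S g S1 S2. facet (n - 1) S \<Longrightarrow> g \<in> S \<Longrightarrow> relevant (n - 1) g \<Longrightarrow>
      S1 \<in> flips (n - 1) S g \<Longrightarrow> S2 \<in> flips (n - 1) S g \<Longrightarrow> S1 = S2"
    and T12: "T1 \<in> flips n T f" "T2 \<in> flips n T f"
  shows "T1 = T2"
proof (rule ccontr)
  assume ne: "T1 \<noteq> T2"
  have n0: "n > 0" using n by simp
  let ?R = "T - orb n f"
  have R: "closed n ?R" using facet_closed[OF T] by (simp add: closed_Diff)
  have Tf: "T = ?R \<union> orb n f" using closedD[OF facet_closed[OF T] f] by auto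
  have F: "facet n T1" "T1 \<noteq> T" "?R \<subseteq> T1" "facet n T2" "T2 \<noteq> T" "?R \<subseteq> T2"
    using T12 unfolding flips_def by auto
  have "orb n ` T = insert (orb n f) (orb n ` ?R)"
  proof -
    have "orb n c = orb n f" if "c \<in> orb n f" for c using that orb_eq_iff eqv_sym by auto
    then have "orb n ` orb n f = {orb n f}" using eqv_refl by (force simp del: mem_orb simp: orb_def)
    then show ?thesis
      using arg_cong[OF Tf, of "(`) (orb n)"] unfolding image_Un by (simp only: Un_insert_right Un_empty_right)
  qed
  moreover have "orb n f \<notin> orb n ` ?R" using orb_eq_iff by auto
  moreover have "finite (orb n ` ?R)"
    using finite_orbs[OF n0 R] free_chords[OF facet_free[OF T]] by blast
  ultimately have cR: "m = card (orb n ` ?R) + 1" using card[OF T] by simp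
  obtain f1 where f1: "T1 = ?R \<union> orb n f1" "f1 \<notin> ?R"
    using one_more_orbit[OF n0 F(1) R F(3)] card[OF F(1)] cR by metis
  obtain f2 where f2: "T2 = ?R \<union> orb n f2" "f2 \<notin> ?R"
    using one_more_orbit[OF n0 F(4) R F(6)] card[OF F(4)] cR by metis
  define g where "g i = (if i = 0 then f else if i = 1 then f1 else f2)" for i :: nat
  define U where "U i = (if i = 0 then T else if i = 1 then T1 else T2)" for i :: nat
  have fU: "facet n (U i)" for i using T F by (simp add: U_def)
  have UR: "U i = ?R \<union> orb n (g i)" for i using Tf f1 f2 by (simp add: U_def g_def)
  have "\<exists>x y. star n (U i) 0 x y" for i using star_exists[OF n fU] by metis
  then obtain x y where st: "\<And>i. star n (U i) 0 (x i) (y i)" by metis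
  have dist: "\<not> eqv n (g i) (g j)" if "i < 3" "j < 3" "i \<noteq> j" for i j
  proof
    assume "eqv n (g i) (g j)"
    then have "U i = U j" unfolding UR orb_eq_iff[symmetric] by simp
    then show False using that ne F(2,5) unfolding U_def by (auto split: if_splits)
  qed
  obtain i where i: "(-1, x i) \<in> ?R" "(0, x i) \<in> ?R" "(0, y i) \<in> ?R" "(1, y i) \<in> ?R"
    using ear_in_ridge[of n U x y ?R g, OF n fU st UR] dist by blast
  have "star n T 0 (x i) (y i)" using st[of i] i unfolding star_def by auto
  then interpret flattened n "x i" "y i" T
    using n T by unfold_locales (auto simp: star_def)
  have nf: "\<not> eqv n f (-1, x i)" "\<not> eqv n f (0, x i)" "\<not> eqv n f (0, y i)" "\<not> eqv n f (1, y i)"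
    using i by auto
  have "f \<notin> ear" using ear_mod[of "fst f" "snd f"] r by (auto simp: relevant_def)
  then have f0: "f \<in> T - ear - P - Q" using f nf eqv_sym[of n _ f] unfolding P_def Q_def by auto
  have "key f \<in> flat T" using f0 by (auto simp: flat_def)
  then have "flat T1 = flat T2"
    using IH[OF facet_flat _ key_relevant[OF f0 nf(2,3) r]] flip_flat(1)[OF nf] T12 by blast
  then show False using flip_flat(2)[OF nf] T12 ne by metis
qed

section \<open>The base case\<close>

text \<open>For n = 2 a facet consists of the boundary chords, one of the two orbits of chords of length 3
  (selected by \<open>a\<close>) and one of the two orbits of diameters (selected by \<open>b\<close>).\<close>

definition base_facet :: "int \<Rightarrow> int \<Rightarrow> (int \<times> int) set" where
  "base_facet a b = {(i, j). let d = (j - i) mod 8 in d = 2 \<or> d = 6 \<or> d = 3 \<and> even (i - a) \<or>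
     d = 5 \<and> even (j - a) \<or> d = 4 \<and> even (i - b)}"

lemma base_mem:
  assumes "i < j" "j < i + 8"
  shows "(i, j) \<in> base_facet a b \<longleftrightarrow> j = i + 2 \<or> j = i + 6 \<or> j = i + 3 \<and> even (i - a) \<or>
     j = i + 5 \<and> even (i + 1 - a) \<or> j = i + 4 \<and> even (i - b)"
proof -
  have m: "(j - i) mod 8 = j - i" using assms by simp
  have d: "j - i = k \<longleftrightarrow> j = i + k" for k by auto
  have A: "(i, j) \<in> base_facet a b \<longleftrightarrow> j = i + 2 \<or> j = i + 6 \<or> j = i + 3 \<and> even (i - a) \<or>
     j = i + 5 \<and> even (j - a) \<or> j = i + 4 \<and> even (i - b)"
    unfolding base_facet_def Let_def mem_Collect_eq prod.case m d by (rule refl)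
  have B: "j = i + 5 \<and> even (j - a) \<longleftrightarrow> j = i + 5 \<and> even (i + 1 - a)" by auto
  show ?thesis unfolding A B by (rule refl)
qed

lemma mod8_flip: "(i - j) mod 8 = (if (j - i) mod 8 = 0 then 0 else 8 - (j - i) mod 8)" for i j :: int
  using zmod_zminus1_eq_if[of "j - i" 8] by simp

lemma mod8_parity: "(j - i) mod 8 = d \<Longrightarrow> even d \<longleftrightarrow> (even j \<longleftrightarrow> even i)" for i j d :: int
  using dvd_mod_iff[of 2 8 "j - i"] by auto

lemma base_closed: "closed 2 (base_facet a b)"
proof (rule closedI)
  fix i j assume "(i, j) \<in> base_facet a b"
  then show "(j, i) \<in> base_facet a b"
    using mod8_parity[of j i "(j - i) mod 8"]
    unfolding base_facet_def Let_def mem_Collect_eq prod.case mod8_flip[of i j]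
    by (elim disjE conjE) auto
next
  fix i j k l assume "(i, j) \<in> base_facet a b"
  moreover have "(j + 2 * k + 4 * 2 * l - (i + 2 * k)) mod 8 = (j - i) mod 8"
    using mod_diff_shift[of j 2 k l i] by simp
  ultimately show "(i + 2 * k, j + 2 * k + 4 * 2 * l) \<in> base_facet a b"
    unfolding base_facet_def Let_def by simp
qed

lemma base_free: "free 2 (base_facet a b)"
proof -
  have "\<not> hexa 2 (base_facet a b) p q r p' q' r'" for p q r p' q' r'
  proof
    assume h: "hexa 2 (base_facet a b) p q r p' q' r'"
    then have o: "p < q" "q < r" "r < p'" "p' < q'" "q' < r'" "r' < p + 8"
      and m: "(p, p') \<in> base_facet a b" "(q, q') \<in> base_facet a b" "(r, r') \<in> base_facet a b"
      unfolding hexa_def by auto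
    have "p' = p + 3 \<and> even (p - a) \<or> p' = p + 5 \<and> even (p + 1 - a) \<or> p' = p + 4 \<and> even (p - b)"
      using m(1) o base_mem[of p p' a b] by linarith
    moreover have "q' = q + 3 \<and> even (q - a) \<or> q' = q + 5 \<and> even (q + 1 - a) \<or> q' = q + 4 \<and> even (q - b)"
      using m(2) o base_mem[of q q' a b] by linarith
    moreover have "r' = r + 3 \<and> even (r - a) \<or> r' = r + 5 \<and> even (r + 1 - a) \<or> r' = r + 4 \<and> even (r - b)"
      using m(3) o base_mem[of r r' a b] by linarith
    moreover have "q = p + 1 \<or> q = p + 2 \<or> q = p + 3" "r = p + 2 \<or> r = p + 3 \<or> r = p + 4"
      using o calculation by linarith+
    ultimately show False using o by (elim disjE conjE) auto
  qed
  moreover have "base_facet a b \<subseteq> chords 2"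
    unfolding base_facet_def chords_def Let_def by auto
  ultimately show ?thesis using base_closed by (simp add: free_def)
qed

lemma mem_norm_mod:
  assumes "n > 0" "closed n T" "(i, j) \<in> T" shows "(i mod n, i mod n + (j - i) mod (4 * n)) \<in> T"
proof -
  have "i mod n + (j - i) mod (4 * n) = j + n * (- (i div n)) + 4 * n * (- ((j - i) div (4 * n)))"
    using mult_div_mod_eq[of n i] mult_div_mod_eq[of "4 * n" "j - i"] by (simp add: algebra_simps)
  moreover have "i mod n = i + n * (- (i div n))"
    using mult_div_mod_eq[of n i] by (simp add: algebra_simps)
  ultimately show ?thesis
    using closed_shift[OF assms(2,3), of "- (i div n)" "- ((j - i) div (4 * n))"] by (simp only:)
qed

text \<open>The chords \<open>(0, 3)\<close>, \<open>(1, 4)\<close>, \<open>(2, 5)\<close> cross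
  pairwise, and so do \<open>(0, 4)\<close>, \<open>(1, 5)\<close>, \<open>(2, 6)\<close>; the first
  and third of each triple are rotations of each other. Hence one orbit of each kind is missing, and
  \<open>T\<close> lies in a set of the list.\<close>

lemma base_facet_of:
  assumes T: "facet 2 T"
  obtains a b where "a \<in> {0, 1}" "b \<in> {0, 1}" "T = base_facet a b"
proof -
  note cl = facet_closed[OF T] and fr = facet_free[OF T]
  define a b :: int where "a = (if (1, 4) \<in> T then 1 else 0)" and "b = (if (1, 5) \<in> T then 1 else 0)"
  have nm: "(i mod 2, i mod 2 + (j - i) mod 8) \<in> T" if "(i, j) \<in> T" for i j
    using mem_norm_mod[OF _ cl that] by simp
  have 3: "(0, 3) \<notin> T \<or> (1, 4) \<notin> T"
    using free_hexa[OF fr, of 0 1 2 3 4 5] closed_shift[OF cl, of 0 3 1 0] unfolding hexa_def by auto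
  have 4: "(0, 4) \<notin> T \<or> (1, 5) \<notin> T"
    using free_hexa[OF fr, of 0 1 2 4 5 6] closed_shift[OF cl, of 0 4 1 0] unfolding hexa_def by auto
  have T3: "even (i - a)" if "(i, j) \<in> T" "(j - i) mod 8 = 3" for i j
    using nm[OF that(1)] that(2) 3 unfolding a_def by (cases "even i") (auto simp: odd_iff_mod_2_eq_one)
  have T4: "even (i - b)" if "(i, j) \<in> T" "(j - i) mod 8 = 4" for i j
    using nm[OF that(1)] that(2) 4 unfolding b_def by (cases "even i") (auto simp: odd_iff_mod_2_eq_one)
  have "T \<subseteq> base_facet a b"
  proof
    fix c assume c: "c \<in> T"
    obtain i j where ij: "c = (i, j)" by (cases c)
    have "2 \<le> (j - i) mod 8" "(j - i) mod 8 \<le> 6"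
      using free_chords[OF fr] c ij by (auto simp: chords_def)
    then consider "(j - i) mod 8 = 2" | "(j - i) mod 8 = 3" | "(j - i) mod 8 = 4" | "(j - i) mod 8 = 5"
      | "(j - i) mod 8 = 6" by linarith
    then show "c \<in> base_facet a b"
    proof cases
      case 4
      have "(j, i) \<in> T" using closed_swap[OF cl] c ij by blast
      then have "even (j - a)" by (rule T3) (use 4 mod8_flip[of i j] in simp)
      then show ?thesis using 4 ij by (simp add: base_facet_def)
    qed (use ij c T3 T4 in \<open>auto simp: base_facet_def\<close>)
  qed
  then have "T = base_facet a b" using facet_max[OF T base_free] by blast
  moreover have "a \<in> {0, 1}" "b \<in> {0, 1}" unfolding a_def b_def by auto
  ultimately show ?thesis using that by blast
qed

lemma base_inj:
  assumes "base_facet a b \<subseteq> base_facet a' b'"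
  shows "even (a - a')" "even (b - b')"
proof -
  have "(a, a + 3) \<in> base_facet a b" "(b, b + 4) \<in> base_facet a b" by (simp_all add: base_facet_def)
  then have "(a, a + 3) \<in> base_facet a' b'" "(b, b + 4) \<in> base_facet a' b'" using assms by blast+
  then show "even (a - a')" "even (b - b')" by (simp_all add: base_facet_def)
qed

text \<open>An extension to a facet is again in the list, and no set of the list properly contains
  another.\<close>

lemma base_is_facet: assumes "a \<in> {0, 1}" "b \<in> {0, 1}" shows "facet 2 (base_facet a b)"
proof -
  obtain T where T: "facet 2 T" "base_facet a b \<subseteq> T" using free_extend[OF _ base_free] by (metis zero_less_numeral)
  obtain a' b' where a': "a' \<in> {0, 1}" "b' \<in> {0, 1}" "T = base_facet a' b'" using base_facet_of[OF T(1)] .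
  have "a = a'" "b = b'" using base_inj[of a b a' b'] T(2) assms a' by auto
  then show ?thesis using T a' by simp
qed

lemma eqv2I:
  assumes "even (i' - i)" "(j' - i') mod 8 = (j - i) mod 8" shows "eqv 2 (i, j) (i', j')"
proof -
  obtain k where k: "i' - i = 2 * k" using assms(1) by blast
  have "8 dvd (j' - i') - (j - i)" using assms(2) by (simp add: mod_eq_dvd_iff)
  then obtain l where "(j' - i') - (j - i) = 8 * l" by blast
  then show ?thesis by (intro eqvI[of _ _ _ k _ _ l]) (use k in linarith)+
qed

lemma eqv2_iff: "eqv 2 (i, j) (i', j') \<longleftrightarrow> even (i' - i) \<and> (j' - i') mod 8 = (j - i) mod 8 \<or>
    even (i' - j) \<and> (j' - i') mod 8 = (i - j) mod 8"
proof
  assume "eqv 2 (i, j) (i', j')"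
  then show "even (i' - i) \<and> (j' - i') mod 8 = (j - i) mod 8 \<or> even (i' - j) \<and> (j' - i') mod 8 = (i - j) mod 8"
  proof (cases rule: eqvE)
    case (direct k a)
    then have "i' - i = 2 * k" "j' - i' = (j - i) + 8 * a" by simp_all
    then show ?thesis by simp
  next
    case (swap k a)
    then have "i' - j = 2 * k" "j' - i' = (i - j) + 8 * a" by simp_all
    then show ?thesis by simp
  qed
next
  assume "even (i' - i) \<and> (j' - i') mod 8 = (j - i) mod 8 \<or> even (i' - j) \<and> (j' - i') mod 8 = (i - j) mod 8"
  then show "eqv 2 (i, j) (i', j')"
    using eqv2I[of i' i j' j] eqv2I[of i' j j' i] eqv_trans[OF eqv_swap] by blast
qed

lemma base_orbs:
  "orb 2 ` base_facet a b = {orb 2 (0, 2), orb 2 (1, 3), orb 2 (a, a + 3), orb 2 (b, b + 4)}"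
proof -
  have "eqv 2 (0, 2) c \<or> eqv 2 (1, 3) c \<or> eqv 2 (a, a + 3) c \<or> eqv 2 (b, b + 4) c"
    if "c \<in> base_facet a b" for c
  proof -
    obtain i j where ij: "c = (i, j)" by (cases c)
    show ?thesis using that mod8_parity[of j i "(j - i) mod 8"]
      unfolding ij eqv2_iff base_facet_def Let_def mem_Collect_eq prod.case
      by (elim disjE conjE) auto
  qed
  moreover have "(0, 2) \<in> base_facet a b" "(1, 3) \<in> base_facet a b" "(a, a + 3) \<in> base_facet a b"
    "(b, b + 4) \<in> base_facet a b" by (simp_all add: base_facet_def)
  ultimately show ?thesis unfolding orb_eq_iff[symmetric] by (auto simp del: mem_orb) 
qed

lemma base_card: "card (orb 2 ` base_facet a b) = 4"
  unfolding base_orbs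
proof -
  have "\<not> eqv 2 (0, 2) (1, 3)" "\<not> eqv 2 (0, 2) (a, a + 3)" "\<not> eqv 2 (0, 2) (b, b + 4)"
    "\<not> eqv 2 (1, 3) (a, a + 3)" "\<not> eqv 2 (1, 3) (b, b + 4)" "\<not> eqv 2 (a, a + 3) (b, b + 4)"
    unfolding eqv2_iff by simp_all
  then show "card {orb 2 (0, 2), orb 2 (1, 3), orb 2 (a, a + 3), orb 2 (b, b + 4)} = 4"
    by (simp add: orb_eq_iff)
qed

text \<open>The complex is a 4-cycle: replacing the orbit of length 3 changes \<open>a\<close>,
  replacing the diameters changes \<open>b\<close>.\<close>

lemma base_flips:
  assumes T: "facet 2 T" and f: "f \<in> T" and r: "relevant 2 f"
  obtains T' where "flips 2 T f = {T'}"
proof -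
  obtain a b where a: "a \<in> {0, 1}" "b \<in> {0, 1}" "T = base_facet a b" using base_facet_of[OF T] .
  obtain i j where ij: "f = (i, j)" by (cases f)
  have *: "flips 2 T f = {base_facet c d}"
    if cd: "c \<in> {0, 1}" "d \<in> {0, 1}" "(c, d) \<noteq> (a, b)"
      and sub: "\<And>c' d'. c' \<in> {0, 1} \<Longrightarrow> d' \<in> {0, 1} \<Longrightarrow> (c', d') \<noteq> (a, b) \<Longrightarrow>
        T - orb 2 f \<subseteq> base_facet c' d' \<longleftrightarrow> c' = c \<and> d' = d" for c d
  proof (intro equalityI subsetI)
    fix S assume "S \<in> flips 2 T f"
    then have S: "facet 2 S" "S \<noteq> T" "T - orb 2 f \<subseteq> S" unfolding flips_def by auto
    obtain c' d' where "c' \<in> {0, 1}" "d' \<in> {0, 1}" "S = base_facet c' d'" using base_facet_of[OF S(1)] .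
    then show "S \<in> {base_facet c d}" using S(2,3) sub[of c' d'] a(3) by auto
  next
    fix S assume "S \<in> {base_facet c d}"
    moreover have "base_facet c d \<noteq> T" using base_inj[of c d a b] cd a by auto
    ultimately show "S \<in> flips 2 T f"
      using base_is_facet[OF cd(1,2)] sub[OF cd] unfolding flips_def by auto
  qed
  have mem: "(a, a + 3) \<in> T" "(b, b + 4) \<in> T"
    unfolding a(3) by (simp_all add: base_facet_def)
  have ne: "\<not> eqv 2 (a, a + 3) (b, b + 4)" "\<not> eqv 2 (b, b + 4) (a, a + 3)" unfolding eqv2_iff by simp_all
  have "eqv 2 (a, a + 3) f \<or> eqv 2 (b, b + 4) f"
    using f r mod8_parity[of j i "(j - i) mod 8"]
    unfolding ij a(3) eqv2_iff base_facet_def Let_def mem_Collect_eq prod.case relevant_def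
    by (elim disjE conjE) auto
  then show ?thesis
  proof
    assume e: "eqv 2 (a, a + 3) f"
    have "(k, l) \<in> base_facet (1 - a) b" if "(k, l) \<in> T - orb 2 f" for k l
    proof -
      have "\<not> eqv 2 (a, a + 3) (k, l)" using that eqv_trans[OF eqv_sym[OF e], of "(k, l)"] by auto
      then show ?thesis using that mod8_parity[of l k "(l - k) mod 8"]
        unfolding a(3) eqv2_iff base_facet_def Let_def by auto
    qed
    moreover have other: "(b, b + 4) \<in> T - orb 2 f" using mem ne(1) eqv_trans[OF e, of "(b, b + 4)"] by auto
    have "d' = b" if "T - orb 2 f \<subseteq> base_facet c' d'" "d' \<in> {0, 1}" for c' d'
      using subsetD[OF that(1) other] that(2) a(2) by (auto simp: base_facet_def)
    ultimately have "flips 2 T f = {base_facet (1 - a) b}" using a by (intro *) auto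
    then show ?thesis by (rule that)
  next
    assume e: "eqv 2 (b, b + 4) f"
    have "(k, l) \<in> base_facet a (1 - b)" if "(k, l) \<in> T - orb 2 f" for k l
    proof -
      have "\<not> eqv 2 (b, b + 4) (k, l)" using that eqv_trans[OF eqv_sym[OF e], of "(k, l)"] by auto
      then show ?thesis using that mod8_parity[of l k "(l - k) mod 8"]
        unfolding a(3) eqv2_iff base_facet_def Let_def by auto
    qed
    moreover have other: "(a, a + 3) \<in> T - orb 2 f" using mem ne(2) eqv_trans[OF e, of "(a, a + 3)"] by auto
    have "c' = a" if "T - orb 2 f \<subseteq> base_facet c' d'" "c' \<in> {0, 1}" for c' d'
      using subsetD[OF that(1) other] that(2) a(1) by (auto simp: base_facet_def)
    ultimately have "flips 2 T f = {base_facet a (1 - b)}" using a by (intro *) auto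
    then show ?thesis by (rule that)
  qed
qed

text \<open>Count and flips go through one induction, as uniqueness of flips uses the count for the
  same \<open>n\<close>. The count \<open>3 * n - 2\<close> is 4 for \<open>n = 2\<close> and grows
  by the 3 lost orbits; it splits into \<open>n\<close> boundary orbits and
  \<open>2 * (n - 1)\<close> relevant ones.\<close>

theorem facet_structure:
  assumes "n \<ge> 2"
  shows "(\<forall>T. facet n T \<longrightarrow> card (orb n ` T) = nat (3 * n - 2)) \<and>
    (\<forall>T f. facet n T \<longrightarrow> f \<in> T \<longrightarrow> relevant n f \<longrightarrow> (\<exists>T'. flips n T f = {T'}))"
  using assms
proof (induct n rule: int_ge_induct)
  case base
  show ?case
  proof (intro conjI allI impI)
    fix T assume "facet 2 T"
    then obtain a b where "T = base_facet a b" using base_facet_of by blast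
    then show "card (orb 2 ` T) = nat (3 * 2 - 2)" using base_card by simp
  next
    fix T f assume "facet 2 T" "f \<in> T" "relevant 2 f"
    then show "\<exists>T'. flips 2 T f = {T'}" using base_flips by metis
  qed
next
  case (step n)
  have n3: "n + 1 \<ge> 3" using step(1) by simp
  have card: "card (orb (n + 1) ` T) = nat (3 * (n + 1) - 2)" if T: "facet (n + 1) T" for T
  proof -
    obtain x y where st: "star (n + 1) T 0 x y" using star_exists[OF n3 T] .
    interpret flattened "n + 1" x y T using n3 T st by unfold_locales (auto simp: star_def)
    have "card (orb n ` flat T) = nat (3 * n - 2)" using step(2) facet_flat by simp
    then show ?thesis using card_orbs_flat step(1) by simp
  qed
  moreover have "\<exists>T'. flips (n + 1) T f = {T'}"
    if T: "facet (n + 1) T" and f: "f \<in> T" and r: "relevant (n + 1) f" for T f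
  proof -
    have "flips (n + 1) T f \<noteq> {}"
      by (rule flip_exists[OF n3 T f r]) (use step(2) in fastforce)
    moreover have "T1 = T2" if "T1 \<in> flips (n + 1) T f" "T2 \<in> flips (n + 1) T f" for T1 T2
      by (rule flips_unique[OF n3 T f r card _ that]) (use step(2) in fastforce)+
    ultimately show ?thesis by blast
  qed
  ultimately show ?case by blast
qed

section \<open>Edges of the half-cylinder as chords\<close>

lemma pair_proj_eq:
  assumes "u < w" "u' < w'"
  shows "proj n {u, w} = proj n {u', w'} \<longleftrightarrow> (\<exists>l. u' = u + l * int n \<and> w' = w + l * int n)"
  unfolding proj_eq_iff using assms by (auto simp: doubleton_eq_iff)

text \<open>The bound \<open>2 * n\<close> is half the circumference, so a chord is represented by
  an interval on its shorter side. A diameter has two such sides, but they are rotations of each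
  other.\<close>

definition short :: "nat \<Rightarrow> int \<Rightarrow> int \<Rightarrow> bool" where
  "short n u w \<longleftrightarrow> 2 \<le> w - u \<and> w - u \<le> 2 * int n"

definition cyc :: "nat \<Rightarrow> int set set set \<Rightarrow> (int \<times> int) set" where
  "cyc n T = {c. \<exists>u w. short n u w \<and> proj n {u, w} \<in> T \<and> eqv (int n) (u, w) c}"

definition uncyc :: "nat \<Rightarrow> (int \<times> int) set \<Rightarrow> int set set set" where
  "uncyc n E = {proj n {u, w} | u w. short n u w \<and> (u, w) \<in> E}"

lemma eqv_short:
  assumes n: "n \<ge> 1" and s: "short n u w" "short n u' w'"
  shows "eqv (int n) (u, w) (u', w') \<longleftrightarrow> proj n {u, w} = proj n {u', w'}"
proof -
  have lt: "u < w" "u' < w'" using s by (auto simp: short_def)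
  show ?thesis unfolding pair_proj_eq[OF lt]
  proof
    assume "eqv (int n) (u, w) (u', w')"
    then show "\<exists>l. u' = u + l * int n \<and> w' = w + l * int n"
    proof (cases rule: eqvE)
      case (direct k a)
      have "4 * int n dvd (w' - u') - (w - u)" using direct by simp
      moreover have "\<bar>(w' - u') - (w - u)\<bar> < 4 * int n" using s n by (auto simp: short_def)
      ultimately have "(w' - u') - (w - u) = 0" using dvd_imp_le_int[of "(w' - u') - (w - u)" "4 * int n"] by force
      then show ?thesis using direct by (intro exI[of _ k]) (simp add: mult.commute)
    next
      case (swap k a)
      \<comment> \<open>A reversal is possible only if both lengths equal \<open>2 * n\<close>;
        reversing a diameter is the rotation by \<open>2 * n\<close>, whence
        \<open>k + 2\<close>.\<close>
      have "(w' - u') + (w - u) = 4 * int n * a" using swap by simp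
      then have d: "4 * int n dvd (w' - u') + (w - u)" by simp
      then have "4 * int n \<le> (w' - u') + (w - u)" using s by (intro zdvd_imp_le) (auto simp: short_def)
      then have "w' = u' + 2 * int n" "w = u + 2 * int n" using s by (auto simp: short_def)
      then show ?thesis using swap by (intro exI[of _ "k + 2"]) (simp add: algebra_simps)
    qed
  next
    assume "\<exists>l. u' = u + l * int n \<and> w' = w + l * int n"
    then obtain l where "u' = u + l * int n" "w' = w + l * int n" by blast
    then show "eqv (int n) (u, w) (u', w')"
      by (intro eqvI[of _ _ _ l _ _ 0]) (simp_all add: mult.commute)
  qed
qed

lemma short_rep:
  assumes "i < j" "j < i + 4 * int n" "(i, j) \<in> chords (int n)"
  shows "short n i j \<or> short n j (i + 4 * int n)"
  using assms chords_iff[OF assms(1,2)] by (auto simp: short_def)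

lemma eqv_turn: "eqv n (i, j) (j, i + 4 * n)"
  by (rule eqvI'[of _ _ _ 0 _ _ 1]) simp_all

lemma short_exists:
  assumes n: "n \<ge> 1" and c: "c \<in> chords (int n)"
  obtains u w where "short n u w" "eqv (int n) c (u, w)"
proof -
  obtain i j where ij: "c = (i, j)" by (cases c)
  obtain j' where j': "i + 2 \<le> j'" "j' \<le> i + 4 * int n - 2" "(i, j') \<in> chords (int n)" "eqv (int n) c (i, j')"
    using chord_rep[of "int n" "chords (int n)" i j] closed_chords[of "int n"] n c ij by auto
  then have "short n i j' \<or> short n j' (i + 4 * int n)" by (intro short_rep) auto
  then show ?thesis using that j'(4) eqv_trans[OF j'(4) eqv_turn] by blast
qed

lemma short_cyl:
  assumes "short n u w"
  shows "proj n {u, w} \<in> cyl_edges n" "cyl_length (proj n {u, w}) = w - u"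
proof -
  have e: "{u, w} \<in> cover_edges" using assms by (intro cover_edgesI) (auto simp: short_def)
  then show "proj n {u, w} \<in> cyl_edges n" by (simp add: cyl_edges_def)
  show "cyl_length (proj n {u, w}) = w - u"
    using assms cyl_length_proj[OF e] by (simp add: edge_length_pair short_def)
qed

lemma cyl_short:
  assumes "c \<in> cyl_edges n" "2 \<le> cyl_length c" "cyl_length c \<le> 2 * int n"
  obtains u w where "short n u w" "c = proj n {u, w}"
proof -
  obtain e where e: "e \<in> cover_edges" "c = proj n e" using assms(1) by (auto simp: cyl_edges_def)
  obtain u w where uw: "e = {u, w}" "u < w" using e(1) by (rule cover_edgeE)
  have "cyl_length c = w - u" using e uw by (simp add: cyl_length_proj edge_length_pair)
  then show ?thesis using that[of u w] assms e uw by (simp add: short_def)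
qed

lemma free_short:
  assumes n: "n \<ge> 1" and T: "three_crossing_free n T" and c: "c \<in> T"
  obtains u w where "short n u w" "c = proj n {u, w}"
proof -
  have "c \<in> cyl_edges n" "2 \<le> cyl_length c" using T c by (auto simp: three_crossing_free_def)
  then show ?thesis using cyl_short three_crossing_free_length_le[OF n T c] that by blast
qed

lemma mem_cyc_short:
  assumes "n \<ge> 1" "short n u w"
  shows "(u, w) \<in> cyc n T \<longleftrightarrow> proj n {u, w} \<in> T"
proof
  assume "(u, w) \<in> cyc n T"
  then show "proj n {u, w} \<in> T" unfolding cyc_def using eqv_short[OF assms(1) _ assms(2)] by auto
next
  assume "proj n {u, w} \<in> T"
  then show "(u, w) \<in> cyc n T" unfolding cyc_def using assms(2) eqv_refl by blast
qed

lemma closed_cyc: "closed (int n) (cyc n T)"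
  unfolding closed_def orb_def cyc_def using eqv_trans by blast

text \<open>Three pairwise crossing chords of the 4n-gon lift to a 3-crossing of the universal cover, or
  else they lift to three intervals that cover the whole circle. In the latter case one compares
  the longest interval with the translates of the other two.\<close>

locale interval_system =
  fixes n :: int and L :: "int \<Rightarrow> int \<Rightarrow> bool"
  assumes pos: "n > 0"
    and translate: "L u w \<Longrightarrow> L (u + n * k) (w + n * k)"
    and no_crossing: "L a a' \<Longrightarrow> L b b' \<Longrightarrow> L c c' \<Longrightarrow> a < b \<Longrightarrow> b < c \<Longrightarrow> c < a' \<Longrightarrow>
      a' < b' \<Longrightarrow> b' < c' \<Longrightarrow> False"
    and length_le: "L u w \<Longrightarrow> w - u \<le> 2 * n"
begin

lemma no_covering_intervals_longest:
  assumes L: "L p1 q1" "L p2 q2" "L p3 q3"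
    and ord: "p1 < p2" "p2 < q1" "q1 < p3" "p3 < q2" "q2 < p1 + 4 * n" "p1 + 4 * n < q3" "q3 < p2 + 4 * n"
    and long: "q2 - p2 \<le> q1 - p1" "q3 - p3 \<le> q1 - p1"
  shows False
proof -
  note l = length_le[OF L(1)] length_le[OF L(2)] length_le[OF L(3)]
  have shp: "L (u + n) (w + n)" and shm: "L (u - n) (w - n)" if "L u w" for u w
    using translate[OF that, of 1] translate[OF that, of "-1"] by simp_all
  \<comment> \<open>The three lengths add up to more than \<open>4 * n\<close>, so the longest
    interval overlaps its translate by \<open>n\<close>.\<close>
  have ln: "q1 - p1 > n" using ord long by linarith
  \<comment> \<open>Otherwise the first interval, the second, and the first shifted by
    \<open>n\<close> form a 3-crossing. The next three bounds rest on the same idea with other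
    translates.\<close>
  have p2: "p1 + n \<le> p2"
  proof (rule ccontr)
    assume "\<not> p1 + n \<le> p2"
    then show False using no_crossing[OF L(1) L(2) shp[OF L(1)]] ord ln long by linarith
  qed
  have q2: "q2 \<le> q1 + n"
  proof (rule ccontr)
    assume h: "\<not> q2 \<le> q1 + n"
    then have "p1 + n < p2" using long by linarith
    then show False using no_crossing[OF L(1) shm[OF L(2)] shp[OF L(1)]] ord ln long h l by linarith
  qed
  define r s where "r = p3 - 4 * n" and "s = q3 - 4 * n"
  have Lr: "L r s" using translate[OF L(3), of "-4"] by (simp add: r_def s_def mult.commute)
  have s: "s \<le> q1 - n"
  proof (rule ccontr)
    assume h: "\<not> s \<le> q1 - n"
    then have "r > p1 - n \<or> r \<le> p1 - n" by linarith
    then show False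
    proof
      assume "r > p1 - n"
      then show False using no_crossing[OF shm[OF L(1)] Lr L(1)] h ord ln l pos unfolding r_def s_def by linarith
    next
      assume "r \<le> p1 - n"
      then show False using h long unfolding r_def s_def by linarith
    qed
  qed
  have "p1 - n \<le> r"
  proof (rule ccontr)
    assume h: "\<not> p1 - n \<le> r"
    then have "s < q1 - n" using long s unfolding r_def s_def by linarith
    then show False using no_crossing[OF shm[OF L(1)] shp[OF Lr] L(1)] h ord ln l pos unfolding r_def s_def by linarith
  qed
  \<comment> \<open>Now \<open>q2 \<le> q1 + n \<le> p1 + 3 * n \<le> p3\<close>, against
    \<open>p3 < q2\<close>.\<close>
  then show False using q2 ord l unfolding r_def by linarith
qed

text \<open>The configuration is cyclically symmetric up to full turns, so the longest interval can
  be listed first.\<close>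

lemma no_covering_intervals:
  assumes L: "L p1 q1" "L p2 q2" "L p3 q3"
    and ord: "p1 < p2" "p2 < q1" "q1 < p3" "p3 < q2" "q2 < p1 + 4 * n" "p1 + 4 * n < q3" "q3 < p2 + 4 * n"
  shows False
proof -
  note * = no_covering_intervals_longest
  have L': "L (p1 + 4 * n) (q1 + 4 * n)" "L (p2 + 4 * n) (q2 + 4 * n)"
    using translate[OF L(1), of 4] translate[OF L(2), of 4] by (simp_all add: mult.commute)
  consider "q2 - p2 \<le> q1 - p1" "q3 - p3 \<le> q1 - p1" | "q3 - p3 \<le> q2 - p2" "q1 - p1 \<le> q2 - p2"
    | "q1 - p1 \<le> q3 - p3" "q2 - p2 \<le> q3 - p3" by linarith
  then show False
  proof cases
    case 1
    show False by (rule *[OF L]) (use 1 ord in linarith)+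
  next
    case 2
    show False by (rule *[OF L(2,3) L'(1)]) (use 2 ord in linarith)+
  next
    case 3
    show False by (rule *[OF L(3) L']) (use 3 ord in linarith)+
  qed
qed

end

section \<open>Correspondence between 2-triangulations and facets of chords\<close>

lemma free_cyc:
  assumes n: "n \<ge> 1" and T: "three_crossing_free n T"
  shows "free (int n) (cyc n T)"
proof -
  define L where "L u w \<longleftrightarrow> short n u w \<and> proj n {u, w} \<in> T" for u w
  have ch: "cyc n T \<subseteq> chords (int n)"
  proof
    fix c assume "c \<in> cyc n T"
    then obtain u w where "short n u w" "eqv (int n) (u, w) c" by (auto simp: cyc_def)
    moreover have "(u, w) \<in> chords (int n)" using calculation(1) n by (intro chordsI) (auto simp: short_def)
    ultimately show "c \<in> chords (int n)" using closedD[OF closed_chords] n by simp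
  qed
  have mem: "L i j \<or> L j (i + 4 * int n)" if "(i, j) \<in> cyc n T" "i < j" "j < i + 4 * int n" for i j
  proof -
    have "(j, i + 4 * int n) \<in> cyc n T" using closed_turn[OF closed_cyc that(1)] .
    then show ?thesis
      using short_rep[OF that(2,3)] ch that(1) mem_cyc_short[OF n] unfolding L_def by blast
  qed
  have nl': False if "L a a'" "L b b'" "L c c'" "a < b" "b < c" "c < a'" "a' < b'" "b' < c'" for a b c a' b' c'
  proof -
    have "{u, w} \<in> preimage n T" if "L u w" for u w
      using that unfolding preimage_def L_def short_def by (auto intro!: cover_edgesI)
    then have "{{a, a'}, {b, b'}, {c, c'}} \<subseteq> preimage n T" using that by blast
    then show False using three_crossingI[of a b c a' b' c'] that T unfolding three_crossing_free_def by blast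
  qed
  interpret interval_system "int n" L
  proof
    show "L (u + int n * k) (w + int n * k)" if "L u w" for u w k
      using that proj_shift[of n k "{u, w}"] unfolding L_def short_def by (simp add: mult.commute)
    show "w - u \<le> 2 * int n" if "L u w" for u w using that by (simp add: L_def short_def)
    show False if "L a a'" "L b b'" "L c c'" "a < b" "b < c" "c < a'" "a' < b'" "b' < c'" for a a' b b' c c'
      by (rule nl'[OF that])
  qed (use n in simp)
  have L4: "L (u - 4 * int n) (w - 4 * int n)" if "L u w" for u w
    using translate[OF that, of "-4"] by (simp add: algebra_simps)
  have "\<not> hexa (int n) (cyc n T) a b c a' b' c'" for a b c a' b' c'
  proof
    let ?N = "4 * int n"
    assume "hexa (int n) (cyc n T) a b c a' b' c'"
    then have o: "a < b" "b < c" "c < a'" "a' < b'" "b' < c'" "c' < a + ?N"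
      and m: "(a, a') \<in> cyc n T" "(b, b') \<in> cyc n T" "(c, c') \<in> cyc n T" unfolding hexa_def by auto
    \<comment> \<open>Each chord is an interval on one of its two sides. Of the eight choices the
      two alternating ones cover the circle; the other six lift to a 3-crossing.\<close>
    have A: "L a a' \<or> L a' (a + ?N)" and B: "L b b' \<or> L b' (b + ?N)" and C: "L c c' \<or> L c' (c + ?N)"
      by (rule mem; use o m in simp)+
    from A show False
    proof
      assume a: "L a a'"
      from B show False
      proof
        assume b: "L b b'"
        from C show False
        proof
          assume c: "L c c'" show False by (rule no_crossing[OF a b c]) (use o in simp_all)
        next
          assume c: "L c' (c + ?N)"
          have "L (c' - ?N) c" using L4[OF c] by simp
          then show False by (rule no_crossing[OF _ a b]) (use o in simp_all)
        qed
      next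
        assume b: "L b' (b + ?N)"
        from C show False
        proof
          assume c: "L c c'" show False by (rule no_covering_intervals[OF a c b]) (use o in simp_all)
        next
          assume c: "L c' (c + ?N)"
          have "L (b' - ?N) b" "L (c' - ?N) c" using L4[OF c] L4[OF b] by simp_all
          then show False by (rule no_crossing[OF _ _ a]) (use o in simp_all)
        qed
      qed
    next
      assume a: "L a' (a + ?N)"
      from B show False
      proof
        assume b: "L b b'"
        from C show False
        proof
          assume c: "L c c'" show False by (rule no_crossing[OF b c a]) (use o in simp_all)
        next
          assume c: "L c' (c + ?N)"
          show False by (rule no_covering_intervals[OF b a c]) (use o in simp_all)
        qed
      next
        assume b: "L b' (b + ?N)"
        from C show False
        proof
          assume c: "L c c'" show False by (rule no_crossing[OF c a b]) (use o in simp_all)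
        next
          assume c: "L c' (c + ?N)" show False by (rule no_crossing[OF a b c]) (use o in simp_all)
        qed
      qed
    qed
  qed
  then show ?thesis using ch closed_cyc by (simp add: free_def)
qed

lemma crosses_pair:
  assumes "crosses {u, w} {u', w'}" "u < w" "u' < w'"
  shows "u < u' \<and> u' < w \<and> w < w' \<or> u' < u \<and> u < w' \<and> w' < w"
  using assms unfolding crosses_def by (auto simp: doubleton_eq_iff)

lemma free_uncyc:
  assumes n: "n \<ge> 1" and E: "free (int n) E"
  shows "three_crossing_free n (uncyc n E)"
proof -
  note cl = free_closed[OF E]
  have "\<not> three_crossing X" if X: "X \<subseteq> preimage n (uncyc n E)" for X
  proof
    assume 3: "three_crossing X"
    have ex: "\<exists>u w. e = {u, w} \<and> u < w \<and> w - u \<le> 2 * int n \<and> (u, w) \<in> E" if "e \<in> X" for e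
    proof -
      have e: "e \<in> cover_edges" "proj n e \<in> uncyc n E" using that X by (auto simp: preimage_def)
      obtain u w where uw: "e = {u, w}" "u < w" using e(1) by (rule cover_edgeE)
      obtain u' w' where u': "short n u' w'" "(u', w') \<in> E" "proj n {u', w'} = proj n {u, w}"
        using e(2) uw unfolding uncyc_def by auto
      have "u' < w'" using u'(1) by (simp add: short_def)
      then obtain l where "u = u' + l * int n" "w = w' + l * int n"
        using u'(3) pair_proj_eq[OF _ uw(2)] by blast
      then have "(u, w) \<in> E" "w - u \<le> 2 * int n"
        using closed_shift[OF cl u'(2), of l 0] u'(1) by (simp_all add: mult.commute short_def)
      then show ?thesis using uw by blast
    qed
    obtain f1 f2 f3 where f: "X = {f1, f2, f3}" "f1 \<noteq> f2" "f2 \<noteq> f3" "f1 \<noteq> f3"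
      using 3 by (auto simp: three_crossing_def card_3_iff)
    have cr: "crosses f1 f2" "crosses f2 f3" "crosses f1 f3"
      using 3 f unfolding three_crossing_def by auto
    obtain u1 w1 where 1: "f1 = {u1, w1}" "u1 < w1" "w1 - u1 \<le> 2 * int n" "(u1, w1) \<in> E" using ex f by blast
    obtain u2 w2 where 2: "f2 = {u2, w2}" "u2 < w2" "w2 - u2 \<le> 2 * int n" "(u2, w2) \<in> E" using ex f by blast
    obtain u3 w3 where 3: "f3 = {u3, w3}" "u3 < w3" "w3 - u3 \<le> 2 * int n" "(u3, w3) \<in> E" using ex f by blast
    note c12 = crosses_pair[OF cr(1)[unfolded 1(1) 2(1)] 1(2) 2(2)]
    note c23 = crosses_pair[OF cr(2)[unfolded 2(1) 3(1)] 2(2) 3(2)]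
    note c13 = crosses_pair[OF cr(3)[unfolded 1(1) 3(1)] 1(2) 3(2)]
    \<comment> \<open>As the lengths are at most \<open>2 * n\<close> and \<open>u'' < w\<close>,
      the whole crossing spans less than \<open>4 * n\<close> and fits into one turn of the
      polygon.\<close>
    have H: False if "u < u'" "u' < u''" "u'' < w" "w < w'" "w' < w''" "w - u \<le> 2 * int n" "w'' - u'' \<le> 2 * int n"
      "(u, w) \<in> E" "(u', w') \<in> E" "(u'', w'') \<in> E" for u u' u'' w w' w''
      using free_hexa[OF E, of u u' u'' w w' w''] that unfolding hexa_def by auto
    consider "u1 < u2" "u2 < u3" | "u1 < u3" "u3 < u2" | "u2 < u1" "u1 < u3" | "u2 < u3" "u3 < u1"
      | "u3 < u1" "u1 < u2" | "u3 < u2" "u2 < u1" using c12 c23 c13 by linarith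
    then show False
    proof cases
      case o: 1 show False by (rule H[of u1 u2 u3 w1 w2 w3]) (use o c12 c23 c13 1 2 3 in auto)
    next
      case o: 2 show False by (rule H[of u1 u3 u2 w1 w3 w2]) (use o c12 c23 c13 1 2 3 in auto)
    next
      case o: 3 show False by (rule H[of u2 u1 u3 w2 w1 w3]) (use o c12 c23 c13 1 2 3 in auto)
    next
      case o: 4 show False by (rule H[of u2 u3 u1 w2 w3 w1]) (use o c12 c23 c13 1 2 3 in auto)
    next
      case o: 5 show False by (rule H[of u3 u1 u2 w3 w1 w2]) (use o c12 c23 c13 1 2 3 in auto)
    next
      case o: 6 show False by (rule H[of u3 u2 u1 w3 w2 w1]) (use o c12 c23 c13 1 2 3 in auto)
    qed
  qed
  moreover have "uncyc n E \<subseteq> {c \<in> cyl_edges n. 2 \<le> cyl_length c}"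
  proof
    fix c assume "c \<in> uncyc n E"
    then obtain u w where "short n u w" "c = proj n {u, w}" by (auto simp: uncyc_def)
    then show "c \<in> {c \<in> cyl_edges n. 2 \<le> cyl_length c}" using short_cyl[of n u w] by (simp add: short_def)
  qed
  ultimately show ?thesis unfolding three_crossing_free_def by blast
qed

lemma uncyc_cyc: assumes n: "n \<ge> 1" and T: "three_crossing_free n T" shows "uncyc n (cyc n T) = T"
proof (intro equalityI subsetI)
  fix c assume "c \<in> uncyc n (cyc n T)"
  then show "c \<in> T" using mem_cyc_short[OF n] unfolding uncyc_def by auto
next
  fix c assume c: "c \<in> T"
  obtain u w where "short n u w" "c = proj n {u, w}" using free_short[OF n T c] .
  then show "c \<in> uncyc n (cyc n T)" using mem_cyc_short[OF n] c unfolding uncyc_def by blast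
qed

lemma cyc_uncyc: assumes n: "n \<ge> 1" and E: "free (int n) E" shows "cyc n (uncyc n E) = E"
proof (intro equalityI subsetI)
  fix c assume "c \<in> cyc n (uncyc n E)"
  then obtain u w where uw: "short n u w" "proj n {u, w} \<in> uncyc n E" "eqv (int n) (u, w) c"
    unfolding cyc_def by auto
  then obtain u' w' where u': "short n u' w'" "(u', w') \<in> E" "proj n {u, w} = proj n {u', w'}"
    unfolding uncyc_def by auto
  then have "eqv (int n) (u', w') (u, w)" using eqv_short[OF n u'(1) uw(1)] by simp
  then show "c \<in> E" using closedD[OF free_closed[OF E] u'(2)] eqv_trans uw(3) by blast
next
  fix c assume c: "c \<in> E"
  then obtain u w where uw: "short n u w" "eqv (int n) c (u, w)"
    using short_exists[OF n] free_chords[OF E] by blast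
  then have "(u, w) \<in> E" using closedD[OF free_closed[OF E] c] by blast
  then show "c \<in> cyc n (uncyc n E)" using uw eqv_sym unfolding cyc_def uncyc_def by blast
qed

lemma cyc_mono: "S \<subseteq> T \<Longrightarrow> cyc n S \<subseteq> cyc n T"
  unfolding cyc_def by blast

lemma uncyc_mono: "D \<subseteq> E \<Longrightarrow> uncyc n D \<subseteq> uncyc n E"
  unfolding uncyc_def by blast

lemma facet_cyc: assumes n: "n \<ge> 1" and T: "two_triangulation n T" shows "facet (int n) (cyc n T)"
  unfolding facet_def
proof (intro conjI allI impI)
  have fT: "three_crossing_free n T" using T by (simp add: two_triangulation_def)
  then show "free (int n) (cyc n T)" by (rule free_cyc[OF n])
  fix E assume E: "free (int n) E \<and> cyc n T \<subseteq> E"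
  then have "T \<subseteq> uncyc n E" using uncyc_mono[of "cyc n T" E n] uncyc_cyc[OF n fT] by simp
  then have "uncyc n E = T" using T E free_uncyc[OF n] by (simp add: two_triangulation_def)
  then show "E = cyc n T" using cyc_uncyc[OF n] E by metis
qed

lemma two_triangulation_uncyc:
  assumes n: "n \<ge> 1" and E: "facet (int n) E" shows "two_triangulation n (uncyc n E)"
  unfolding two_triangulation_def
proof (intro conjI allI impI)
  note fE = facet_free[OF E]
  show "three_crossing_free n (uncyc n E)" by (rule free_uncyc[OF n fE])
  fix T assume T: "three_crossing_free n T \<and> uncyc n E \<subseteq> T"
  then have "E \<subseteq> cyc n T" using cyc_mono[of "uncyc n E" T n] cyc_uncyc[OF n fE] by simp
  then have "cyc n T = E" using facet_max[OF E] free_cyc[OF n] T by blast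
  then show "T = uncyc n E" using uncyc_cyc[OF n] T by metis
qed

text \<open>Edges and orbits are classes of the same short pairs under the same relation, by
  \<open>eqv_short\<close>.\<close>

lemma card_orbs_cyc:
  assumes n: "n \<ge> 1" and T: "three_crossing_free n T"
  shows "card T = card (orb (int n) ` cyc n T)"
proof -
  let ?E = "cyc n T"
  define A where "A = {c \<in> ?E. short n (fst c) (snd c)}"
  have "T = (\<lambda>c. proj n {fst c, snd c}) ` A"
  proof -
    have "T = uncyc n ?E" using uncyc_cyc[OF n T] by simp
    also have "\<dots> = (\<lambda>c. proj n {fst c, snd c}) ` A"
    proof (intro equalityI subsetI)
      fix d assume "d \<in> uncyc n ?E"
      then obtain u w where "d = proj n {u, w}" "short n u w" "(u, w) \<in> ?E" unfolding uncyc_def by blast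
      then show "d \<in> (\<lambda>c. proj n {fst c, snd c}) ` A" by (intro image_eqI[of _ _ "(u, w)"]) (simp_all add: A_def)
    next
      fix d assume "d \<in> (\<lambda>c. proj n {fst c, snd c}) ` A"
      then obtain c where "c \<in> A" "d = proj n {fst c, snd c}" by blast
      then show "d \<in> uncyc n ?E" unfolding uncyc_def A_def mem_Collect_eq
        by (intro exI[of _ "fst c"] exI[of _ "snd c"]) simp
    qed
    finally show ?thesis .
  qed
  moreover have "orb (int n) ` ?E = orb (int n) ` A"
  proof (intro equalityI subsetI)
    fix z assume "z \<in> orb (int n) ` ?E"
    then obtain c where c: "c \<in> ?E" "z = orb (int n) c" by blast
    then obtain u w where "short n u w" "eqv (int n) c (u, w)"
      using short_exists[OF n] free_chords[OF free_cyc[OF n T]] by blast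
    then have "(u, w) \<in> A" "z = orb (int n) (u, w)"
      using closedD[OF closed_cyc c(1)] c(2) orb_eq_iff[of "int n" c "(u, w)"] by (auto simp: A_def)
    then show "z \<in> orb (int n) ` A" by blast
  qed (auto simp: A_def)
  moreover have "card ((\<lambda>c. proj n {fst c, snd c}) ` A) = card (orb (int n) ` A)"
    by (rule card_image_cong) (use eqv_short[OF n] in \<open>auto simp: A_def orb_eq_iff\<close>)
  ultimately show ?thesis by simp
qed

lemma card_length_two:
  assumes n: "n \<ge> 1" shows "card {c \<in> cyl_edges n. cyl_length c = 2} = n"
proof -
  have "{c \<in> cyl_edges n. cyl_length c = 2} = (\<lambda>u. proj n {u, u + 2}) ` {0..<int n}"
  proof (intro equalityI subsetI)
    fix c assume "c \<in> {c \<in> cyl_edges n. cyl_length c = 2}"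
    then have c: "c \<in> cyl_edges n" "cyl_length c = 2" by auto
    obtain u w where uw: "short n u w" "c = proj n {u, w}"
      by (rule cyl_short[of c n]) (use c n in auto)
    then have "w - u = 2" using short_cyl(2)[OF uw(1)] c(2) by simp
    then have c': "c = proj n {u, u + 2}" using uw(2) by (simp add: diff_eq_eq add.commute)
    have "proj n {u, u + 2} = proj n {u mod int n, u mod int n + 2}"
      by (subst pair_proj_eq) (auto intro!: exI[of _ "- (u div int n)"] simp: minus_div_mult_eq_mod[symmetric])
    moreover have "u mod int n \<in> {0..<int n}" using n by simp
    ultimately show "c \<in> (\<lambda>u. proj n {u, u + 2}) ` {0..<int n}" unfolding c' by (rule image_eqI)
  next
    fix c assume "c \<in> (\<lambda>u. proj n {u, u + 2}) ` {0..<int n}"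
    then obtain u where "c = proj n {u, u + 2}" by blast
    moreover have "short n u (u + 2)" using n by (simp add: short_def)
    ultimately show "c \<in> {c \<in> cyl_edges n. cyl_length c = 2}" using short_cyl[of n u "u + 2"] by simp
  qed
  moreover have "inj_on (\<lambda>u. proj n {u, u + 2}) {0..<int n}"
  proof (rule inj_onI)
    fix u w assume uw: "u \<in> {0..<int n}" "w \<in> {0..<int n}" "proj n {u, u + 2} = proj n {w, w + 2}"
    then obtain l where "w = u + l * int n" using pair_proj_eq[of u "u + 2" w "w + 2" n] by auto
    then have "w mod int n = u mod int n" by simp
    then show "u = w" using uw by simp
  qed
  ultimately show ?thesis by (simp add: card_image)
qed

section \<open>Facets and ridges of the complex\<close>

lemma card_relevant_part:
  assumes n: "n \<ge> 2" and T: "two_triangulation n T"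
  shows "card (T \<inter> relevant_edges n) = 2 * (n - 1)"
proof -
  have n1: "n \<ge> 1" using n by simp
  have fT: "three_crossing_free n T" using T by (simp add: two_triangulation_def)
  have fin: "finite T"
  proof (rule finite_subset[OF _ finite_short_edges[OF n1, of "2 * int n"]])
    show "T \<subseteq> {c \<in> cyl_edges n. cyl_length c \<le> 2 * int n}"
      using fT three_crossing_free_length_le[OF n1 fT] unfolding three_crossing_free_def by auto
  qed
  have "card T = nat (3 * int n - 2)"
    using card_orbs_cyc[OF n1 fT] facet_structure[of "int n"] facet_cyc[OF n1 T] n by simp
  moreover have "card T = card (T \<inter> relevant_edges n) + n"
  proof -
    let ?B = "{c \<in> cyl_edges n. cyl_length c = 2}"
    have d: "T = (T \<inter> relevant_edges n) \<union> ?B" by (rule two_triangulation_decomp[OF n1 T])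
    have "finite ?B" using fin d by (metis finite_Un)
    moreover have "(T \<inter> relevant_edges n) \<inter> ?B = {}" by (auto simp: relevant_edges_def)
    ultimately have "card ((T \<inter> relevant_edges n) \<union> ?B) = card (T \<inter> relevant_edges n) + card ?B"
      using fin by (intro card_Un_disjoint) auto
    then show ?thesis using d card_length_two[OF n1] by simp
  qed
  ultimately show ?thesis using n by simp
qed

lemma two_facets:
  assumes n: "n \<ge> 2" and T: "two_triangulation n T" and c: "c \<in> T \<inter> relevant_edges n"
  shows "card {F \<in> facets (Delta n). T \<inter> relevant_edges n - {c} \<subseteq> F} = 2"
proof -
  have n1: "n \<ge> 1" using n by simp
  let ?R = "relevant_edges n" and ?E = "cyc n T"
  have free: "three_crossing_free n T" if "two_triangulation n T" for T using that by (simp add: two_triangulation_def)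
  obtain u w where uw: "short n u w" "c = proj n {u, w}" using free_short[OF n1 free[OF T]] c by blast
  have f: "(u, w) \<in> ?E" using mem_cyc_short[OF n1 uw(1)] c uw(2) by simp
  have "2 < w - u" using c uw short_cyl[OF uw(1)] by (auto simp: relevant_edges_def)
  then have "relevant (int n) (u, w)" using uw(1) n by (simp add: relevant_def short_def)
  then obtain E' where E': "flips (int n) ?E (u, w) = {E'}"
    using facet_structure[of "int n"] facet_cyc[OF n1 T] f n by fastforce
  have fE': "facet (int n) E'" "E' \<noteq> ?E" using E' unfolding flips_def by auto
  define T' where "T' = uncyc n E'"
  have T': "two_triangulation n T'" unfolding T'_def by (rule two_triangulation_uncyc[OF n1 fE'(1)])
  have cT': "cyc n T' = E'" unfolding T'_def by (rule cyc_uncyc[OF n1 facet_free[OF fE'(1)]])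
  \<comment> \<open>Edges of length 2 belong to every 2-triangulation, so containment of ridges can
    be compared on the relevant edges alone.\<close>
  have iff: "T \<inter> ?R - {c} \<subseteq> S \<inter> ?R \<longleftrightarrow> ?E - orb (int n) (u, w) \<subseteq> cyc n S" if S: "two_triangulation n S" for S
  proof
    assume h: "T \<inter> ?R - {c} \<subseteq> S \<inter> ?R"
    show "?E - orb (int n) (u, w) \<subseteq> cyc n S"
    proof
      fix d assume d: "d \<in> ?E - orb (int n) (u, w)"
      then have "d \<in> chords (int n)" using free_chords[OF free_cyc[OF n1 free[OF T]]] by blast
      then obtain u' w' where u': "short n u' w'" "eqv (int n) d (u', w')" using short_exists[OF n1] by blast
      have "(u', w') \<in> ?E" using closedD[OF closed_cyc _ u'(2)] d by blast
      then have p: "proj n {u', w'} \<in> T" using mem_cyc_short[OF n1 u'(1)] by blast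
      have "proj n {u', w'} \<noteq> c"
        using d eqv_short[OF n1 uw(1) u'(1)] eqv_trans[OF _ eqv_sym[OF u'(2)]] uw(2) by auto
      moreover have "proj n {u', w'} \<in> ?R \<or> proj n {u', w'} \<in> {e \<in> cyl_edges n. cyl_length e = 2}"
        using p two_triangulation_decomp[OF n1 T] by blast
      ultimately have "proj n {u', w'} \<in> S"
        using h p length_two_in_two_triangulation[OF S] by blast
      then have "(u', w') \<in> cyc n S" using mem_cyc_short[OF n1 u'(1)] by blast
      then show "d \<in> cyc n S" using closedD[OF closed_cyc _ eqv_sym[OF u'(2)]] by blast
    qed
  next
    assume h: "?E - orb (int n) (u, w) \<subseteq> cyc n S"
    show "T \<inter> ?R - {c} \<subseteq> S \<inter> ?R"
    proof
      fix d assume d: "d \<in> T \<inter> ?R - {c}"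
      obtain u' w' where u': "short n u' w'" "d = proj n {u', w'}" using free_short[OF n1 free[OF T]] d by blast
      have "(u', w') \<in> ?E" using mem_cyc_short[OF n1 u'(1)] d u'(2) by blast
      moreover have "\<not> eqv (int n) (u, w) (u', w')" using eqv_short[OF n1 uw(1) u'(1)] d u'(2) uw(2) by auto
      ultimately have "(u', w') \<in> cyc n S" using h by auto
      then show "d \<in> S \<inter> ?R" using mem_cyc_short[OF n1 u'(1)] u'(2) d by blast
    qed
  qed
  have "{F \<in> facets (Delta n). T \<inter> ?R - {c} \<subseteq> F} = {T \<inter> ?R, T' \<inter> ?R}"
  proof (intro equalityI subsetI)
    fix F assume "F \<in> {F \<in> facets (Delta n). T \<inter> ?R - {c} \<subseteq> F}"
    then obtain S where S: "two_triangulation n S" "F = S \<inter> ?R" "T \<inter> ?R - {c} \<subseteq> S \<inter> ?R"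
      using facets_Delta[OF n1] by auto
    have "cyc n S = ?E \<or> cyc n S \<in> flips (int n) ?E (u, w)"
      using iff[OF S(1)] S(3) facet_cyc[OF n1 S(1)] unfolding flips_def by blast
    then have "cyc n S = cyc n T \<or> cyc n S = cyc n T'" using E' cT' by simp
    then have "S = T \<or> S = T'" using uncyc_cyc[OF n1] free S(1) T T' by metis
    then show "F \<in> {T \<inter> ?R, T' \<inter> ?R}" using S(2) by blast
  next
    fix F assume "F \<in> {T \<inter> ?R, T' \<inter> ?R}"
    moreover have "E' \<in> flips (int n) ?E (u, w)" using E' by simp
    then have "T \<inter> ?R - {c} \<subseteq> T' \<inter> ?R" using iff[OF T'] cT' unfolding flips_def by blast
    ultimately show "F \<in> {F \<in> facets (Delta n). T \<inter> ?R - {c} \<subseteq> F}"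
      using facets_Delta[OF n1] T T' by blast
  qed
  moreover have "T \<inter> ?R \<noteq> T' \<inter> ?R"
  proof
    assume "T \<inter> ?R = T' \<inter> ?R"
    then have "T = T'" using two_triangulation_decomp[OF n1 T] two_triangulation_decomp[OF n1 T'] by simp
    then show False using cT' fE'(2) by simp
  qed
  ultimately show ?thesis by simp
qed

theorem corollary6p4:
  fixes n :: nat
  assumes "n \<ge> 1"
  shows "pure_complex (Delta n) \<and>
    (\<forall>F \<in> facets (Delta n). card F = 2 * (n - 1)) \<and>
    weak_pseudomanifold (Delta n)"
proof -
  note fD = facets_Delta[OF assms]
  have fin: "finite (relevant_edges n)"
    by (rule finite_subset[OF _ finite_short_edges[OF assms, of "2 * int n"]]) (auto simp: relevant_edges_def)
  have "three_crossing_free n {}"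
    unfolding three_crossing_free_def three_crossing_def preimage_def by auto
  then obtain T0 where "two_triangulation n T0" using two_triangulation_extend[OF assms] by blast
  then have sc: "simplicial_complex (Delta n)"
    unfolding simplicial_complex_def Delta_def using finite_subset[OF _ fin] by blast
  have card: "card F = 2 * (n - 1)" if F: "F \<in> facets (Delta n)" for F
  proof -
    obtain T where T: "two_triangulation n T" "F = T \<inter> relevant_edges n" using F fD by auto
    show ?thesis
    proof (cases "n = 1")
      \<comment> \<open>No length satisfies \<open>2 < l \<le> 2\<close>, so the only facet is
        empty.\<close>
      case True
      then have "relevant_edges n = {}" by (auto simp: relevant_edges_def)
      then show ?thesis using T True by simp
    next
      case False
      then show ?thesis using card_relevant_part[OF _ T(1)] T(2) assms by simp
    qed
  qed
  then have pure: "pure_complex (Delta n)" using sc by (simp add: pure_complex_def)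
  have "card {F \<in> facets (Delta n). s \<subseteq> F} = 2" if s: "codim1_face (Delta n) s" for s
  proof -
    obtain F where F: "F \<in> facets (Delta n)" "s \<subseteq> F" "card F = card s + 1"
      using s unfolding codim1_face_def by blast
    obtain T where T: "two_triangulation n T" "F = T \<inter> relevant_edges n" using F(1) fD by auto
    \<comment> \<open>A facet above a codimension-1 face is nonempty, which excludes
      \<open>n = 1\<close>.\<close>
    have n2: "n \<ge> 2" using card[OF F(1)] F(3) by simp
    have finF: "finite F" using T(2) fin by simp
    then have "card (F - s) = 1" using F(2,3) by (simp add: card_Diff_subset finite_subset)
    then obtain c where c: "F - s = {c}" by (auto simp: card_1_singleton_iff)
    then have "c \<in> F" "s = F - {c}" using F(2) by auto
    then show ?thesis using two_facets[OF n2 T(1)] T(2) by simp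
  qed
  then show ?thesis using pure card by (simp add: weak_pseudomanifold_def)
qed

end
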